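(* The coalgebras for the comonad $(\mathbf{Fa\grave{a}},\epsilon,\delta)$ on the category of Cartesian restriction categories (with functors preserving the chosen restriction products and restrictions on the nose) are exactly the generalized differential restriction categories. That is, for every Cartesian restriction category $\mathbb{X}$, sending a coalgebra structure $\mathcal{D}:\mathbb{X}\to\mathbf{Fa\grave{a}}(\mathbb{X})$, with $\mathcal{D}(X)=(\mathcal{D}_0(X),\mathcal{D}_1(X))$, to the data $$L(X):=\mathcal{D}_0(X),\qquad D[f]:=[\mathcal{D}(f)]_1$$ defines a bijection between $\mathbf{Fa\grave{a}}$-coalgebra structures on $\mathbb{X}$ and generalized differential restriction structures on $\mathbb{X}$.
   Context: Composition is diagrammatic: $fg$ means first $f$, then $g$. A restriction category is a category with an operation assigning to each $f:X\to Y$ a map $\overline{f}:X\to X$ with: [R.1] $\overline{f}f=f$; [R.2] $\overline{f}\,\overline{g}=\overline{g}\,\overline{f}$ for $f,g$ with the same domain; [R.3] $\overline{\overline{f}g}=\overline{f}\,\overline{g}$ for $f,g$ with the same domain; [R.4] $f\overline{g}=\overline{fg}f$. A map $f$ is total if $\overline{f}=1$. A Cartesian restriction category is a restriction category with chosen restriction products: a chosen object $1$ with, for each $X$, a unique total map $!:X\to1$, such that every $f:X\to1$ equals $\overline{f}\,!$; and for all $X,Y$ a chosen object $X\times Y$ with total projections $\pi_0,\pi_1$ such that for all $f:Z\to X$, $g:Z\to Y$ there is a unique $\langle f,g\rangle:Z\to X\times Y$ with $\langle f,g\rangle\pi_0=\overline{g}f$ and $\langle f,g\rangle\pi_1=\overline{f}g$.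 A total commutative monoid $(A,+,0)$ is a commutative monoid whose structure maps are total; for $f,g:X\to A$, $f+g:=\langle f,g\rangle+$ and $0:X\to A$ denotes $!\,0$. In $A^n\times X$, $\pi_0,\ldots,\pi_{n-1}$ are the projections to the copies of $A$ and $\pi_n$ the projection to $X$. We write $h(z_1,\ldots,z_k)$ for $\langle z_1,\ldots,z_k\rangle h$. A generalized differential restriction structure on a Cartesian restriction category consists of: for each object $X$, a total commutative monoid $L(X)=(L_0(X),+_X,0_X)$ with $L(L_0(X))=L(X)$, $L(X\times Y)=L(X)\times L(Y)$ (product monoid) and $L(1)=1$; and for each map $f:X\to Y$ a map $D[f]:L_0(X)\times X\to L_0(Y)$ such that (for all well-typed maps): [DR.1] $D[+_X]=\pi_0+_X$ and $D[0_X]=\pi_00_X$; [DR.2] $\langle a+b,c\rangle D[f]=\langle a,c\rangle D[f]+\langle b,c\rangle D[f]$ and $\langle0,a\rangle D[f]=\overline{af}\,0$; [DR.3] $D[\pi_0]=\pi_0\pi_0$ and $D[\pi_1]=\pi_0\pi_1$; [DR.4] $D[\langle f,g\rangle]=\langle D[f],D[g]\rangle$; [DR.5] $D[fg]=\langle D[f],\pi_1f\rangle D[g]$; [DR.6] $\langle\langle a,0\rangle,\langle c,d\rangle\rangle D[D[f]]=\overline{c}\,\langle a,d\rangle D[f]$; [DR.7] $\langle\langle0,b\rangle,\langle c,d\rangle\rangle D[D[f]]=\langle\langle0,c\rangle,\langle b,d\rangle\rangle D[D[f]]$; [DR.8] $D[\overline{f}]=(1\times\overline{f})\pi_0=\overline{\pi_1f}\,\pi_0$;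 [DR.9] $\overline{D[f]}=1\times\overline{f}=\overline{\pi_1f}$. A Cartesian restriction category with such a structure is a generalized differential restriction category. The Cartesian restriction category $\mathbf{Fa\grave{a}}(\mathbb{X})$. Objects: pairs $((A,+,0),X)$, abbreviated $(A,X)$, with $(A,+,0)$ a total commutative monoid and $X$ an object of $\mathbb{X}$. Maps $(A,X)\to(B,Y)$: sequences $f=(f_*,f_1,f_2,\ldots)$ with $f_*:X\to Y$ and, for $n\ge1$, $f_n:A^n\times X\to B$ such that $\overline{f_n}=1\times\overline{f_*}=\overline{\pi_nf_*}$, and $f_n$ is symmetric and additive in its first $n$ variables (additive: substituting a sum $a+b$ in a variable gives the sum of the maps obtained by substituting $a$ and $b$, and substituting $0$ gives the corresponding restriction of the zero map). Identities $(1_X,\pi_0,0,0,\ldots)$. Composition: $(fg)_*=f_*g_*$ and $$(fg)_n=\sum_{\{B_1,\ldots,B_k\}}g_k\big(f_{|B_1|}(a_{B_1},x),\ldots,f_{|B_k|}(a_{B_k},x),f_*(x)\big),$$ the sum being over partitions of $\{1,\ldots,n\}$ into nonempty blocks, $a_1,\ldots,a_n,x$ being the projections from $A^n\times X$ and $f_m(a_B,x)=f_m(a_{i_1},\ldots,a_{i_m},x)$ for $B=\{i_1<\cdots<i_m\}$. Restriction: $\overline{f}=(\overline{f_*},\overline{\pi_1f_*}\pi_0,\overline{\pi_2f_*}0,\overline{\pi_3f_*}0,\ldots)$. Chosen products: $(A,X)\times(B,Y)=(A\times B,X\times Y)$ with the product monoid on $A\times B$, projections $(\pi_i,\pi_0\pi_i,0,0,\ldots)$,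 pairing $\langle f,g\rangle_*=\langle f_*,g_*\rangle$, $\langle f,g\rangle_n=\langle f_n,g_n\rangle$; terminal object $(1,1)$. On functors $F$: $\mathbf{Fa\grave{a}}(F)((A,+,0),X)=((FA,F+,F0),FX)$ and $\mathbf{Fa\grave{a}}(F)(f_*,f_1,\ldots)=(F(f_* ),F(f_1),\ldots)$. The comonad structure. $\epsilon((A,+,0),X)=X$, $\epsilon(f)=f_*$. On objects $\delta((A,+,0),X)=\big((((A,+,0),A),(+,\pi_0+,0,\ldots),(0,\pi_00,0,\ldots)),((A,+,0),X)\big)$. For $f:(A,X)\to(B,Y)$: $\delta(f)_*=f$ and, for $n\ge1$, $\delta(f)_n:(A,A)^n\times(A,X)=(A^n\times A,A^n\times X)\to(B,B)$ is the arrow of $\mathbf{Fa\grave{a}}(\mathbb{X})$ with $(\delta(f)_n)_*=f_n$ and, for $r\ge1$, writing the variables (projections) of $(A^n\times A)^r\times(A^n\times X)$ as $v^j=(v^j_1,\ldots,v^j_n,w^j)$ for $1\le j\le r$ and $(a_1,\ldots,a_n,x)$, $$(\delta(f)_n)_r=\sum_{(S,\varphi)}f_{n+r-|S|}\big(a^\varphi_1,\ldots,a^\varphi_n,(w^j)_{j\notin S},x\big),$$ the sum being over all subsets $S\subseteq\{1,\ldots,r\}$ and injections $\varphi:S\to\{1,\ldots,n\}$, where $a^\varphi_i=v^j_i$ if $i=\varphi(j)$ for some $j\in S$ and $a^\varphi_i=a_i$ otherwise. A coalgebra structure on $\mathbb{X}$ is a functor $\mathcal{D}:\mathbb{X}\to\mathbf{Fa\grave{a}}(\mathbb{X})$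 preserving chosen restriction products and restrictions on the nose such that $\mathcal{D}$ followed by $\epsilon$ is the identity, and $\mathcal{D}$ followed by $\delta$ equals $\mathcal{D}$ followed by $\mathbf{Fa\grave{a}}(\mathcal{D})$ (so in particular $\mathcal{D}_1(X)=X$). *)

theory Defs
  imports "HOL-Algebra.FiniteProduct" "HOL-Library.Disjoint_Sets" "HOL-Combinatorics.Permutations"
begin

section \<open>Cartesian restriction categories\<close>

text \<open>
  Composition is diagrammatic: \<open>f \<cdot> g\<close> is first \<open>f\<close>, then \<open>g\<close>.  The operations of a category are total
  functions of HOL; their values outside the intended domains (non-objects, non-composable pairs,
  ...) are irrelevant.
\<close>

record ('o, 'm) rcat =
  Ob :: "'o set"
  Ar :: "'m set"
  Dom :: "'m \<Rightarrow> 'o"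
  Cod :: "'m \<Rightarrow> 'o"
  Idn :: "'o \<Rightarrow> 'm"
  Cmp :: "'m \<Rightarrow> 'm \<Rightarrow> 'm"  (infixl \<open>\<cdot>\<index>\<close> 70)
  Rst :: "'m \<Rightarrow> 'm"

record ('o, 'm) crcat = "('o, 'm) rcat" +
  One :: 'o
  Bang :: "'o \<Rightarrow> 'm"
  Prd :: "'o \<Rightarrow> 'o \<Rightarrow> 'o"  (infixr \<open>\<boxtimes>\<index>\<close> 80)
  Pr0 :: "'o \<Rightarrow> 'o \<Rightarrow> 'm"
  Pr1 :: "'o \<Rightarrow> 'o \<Rightarrow> 'm"
  Tup :: "'m \<Rightarrow> 'm \<Rightarrow> 'm"  (\<open>\<langle>_,/ _\<rangle>\<index>\<close>)

definition Hom :: "('o, 'm, 'e) rcat_scheme \<Rightarrow> 'o \<Rightarrow> 'o \<Rightarrow> 'm set" where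
  "Hom C X Y = {f \<in> Ar C. Dom C f = X \<and> Cod C f = Y}"

definition total_map :: "('o, 'm, 'e) rcat_scheme \<Rightarrow> 'm \<Rightarrow> bool" where
  "total_map C f \<longleftrightarrow> f \<in> Ar C \<and> Rst C f = Idn C (Dom C f)"

locale restriction_category =
  fixes C :: "('o, 'm, 'e) rcat_scheme" (structure)
  assumes Dom_Ob: "f \<in> Ar C \<Longrightarrow> Dom C f \<in> Ob C"
    and Cod_Ob: "f \<in> Ar C \<Longrightarrow> Cod C f \<in> Ob C"
    and Idn_Hom: "X \<in> Ob C \<Longrightarrow> Idn C X \<in> Hom C X X"
    and Cmp_Hom: "\<lbrakk>f \<in> Hom C X Y; g \<in> Hom C Y Z\<rbrakk> \<Longrightarrow> f \<cdot> g \<in> Hom C X Z"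
    and Cmp_Idn_left: "f \<in> Hom C X Y \<Longrightarrow> Idn C X \<cdot> f = f"
    and Cmp_Idn_right: "f \<in> Hom C X Y \<Longrightarrow> f \<cdot> Idn C Y = f"
    and Cmp_assoc: "\<lbrakk>f \<in> Hom C X Y; g \<in> Hom C Y Z; h \<in> Hom C Z W\<rbrakk> \<Longrightarrow> (f \<cdot> g) \<cdot> h = f \<cdot> (g \<cdot> h)"
    and Rst_Hom: "f \<in> Hom C X Y \<Longrightarrow> Rst C f \<in> Hom C X X"
    and R1: "f \<in> Ar C \<Longrightarrow> Rst C f \<cdot> f = f"
    and R2: "\<lbrakk>f \<in> Hom C X Y; g \<in> Hom C X Z\<rbrakk> \<Longrightarrow> Rst C f \<cdot> Rst C g = Rst C g \<cdot> Rst C f"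
    and R3: "\<lbrakk>f \<in> Hom C X Y; g \<in> Hom C X Z\<rbrakk> \<Longrightarrow> Rst C (Rst C f \<cdot> g) = Rst C f \<cdot> Rst C g"
    and R4: "\<lbrakk>f \<in> Hom C X Y; g \<in> Hom C Y Z\<rbrakk> \<Longrightarrow> f \<cdot> Rst C g = Rst C (f \<cdot> g) \<cdot> f"

locale cartesian_restriction_category = restriction_category C
  for C :: "('o, 'm, 'e) crcat_scheme" (structure) +
  assumes One_Ob: "One C \<in> Ob C"
    and Bang_Hom: "X \<in> Ob C \<Longrightarrow> Bang C X \<in> Hom C X (One C)"
    and Bang_total: "X \<in> Ob C \<Longrightarrow> total_map C (Bang C X)"
    and Bang_unique: "\<lbrakk>f \<in> Hom C X (One C); total_map C f\<rbrakk> \<Longrightarrow> f = Bang C X"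
    and Bang_restr: "f \<in> Hom C X (One C) \<Longrightarrow> f = Rst C f \<cdot> Bang C X"
    and Prd_Ob: "\<lbrakk>X \<in> Ob C; Y \<in> Ob C\<rbrakk> \<Longrightarrow> X \<boxtimes> Y \<in> Ob C"
    and Pr0_Hom: "\<lbrakk>X \<in> Ob C; Y \<in> Ob C\<rbrakk> \<Longrightarrow> Pr0 C X Y \<in> Hom C (X \<boxtimes> Y) X"
    and Pr1_Hom: "\<lbrakk>X \<in> Ob C; Y \<in> Ob C\<rbrakk> \<Longrightarrow> Pr1 C X Y \<in> Hom C (X \<boxtimes> Y) Y"
    and Pr0_total: "\<lbrakk>X \<in> Ob C; Y \<in> Ob C\<rbrakk> \<Longrightarrow> total_map C (Pr0 C X Y)"
    and Pr1_total: "\<lbrakk>X \<in> Ob C; Y \<in> Ob C\<rbrakk> \<Longrightarrow> total_map C (Pr1 C X Y)"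
    and Tup_Hom: "\<lbrakk>f \<in> Hom C Z X; g \<in> Hom C Z Y\<rbrakk> \<Longrightarrow> \<langle>f, g\<rangle> \<in> Hom C Z (X \<boxtimes> Y)"
    and Tup_Pr0: "\<lbrakk>f \<in> Hom C Z X; g \<in> Hom C Z Y\<rbrakk> \<Longrightarrow> \<langle>f, g\<rangle> \<cdot> Pr0 C X Y = Rst C g \<cdot> f"
    and Tup_Pr1: "\<lbrakk>f \<in> Hom C Z X; g \<in> Hom C Z Y\<rbrakk> \<Longrightarrow> \<langle>f, g\<rangle> \<cdot> Pr1 C X Y = Rst C f \<cdot> g"
    and Tup_unique: "\<lbrakk>f \<in> Hom C Z X; g \<in> Hom C Z Y; h \<in> Hom C Z (X \<boxtimes> Y);
        h \<cdot> Pr0 C X Y = Rst C g \<cdot> f; h \<cdot> Pr1 C X Y = Rst C f \<cdot> g\<rbrakk> \<Longrightarrow> h = \<langle>f, g\<rangle>"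

definition cross :: "('o, 'm) crcat \<Rightarrow> 'm \<Rightarrow> 'm \<Rightarrow> 'm" where
  "cross C f g = \<langle>Pr0 C (Dom C f) (Dom C g) \<cdot>\<^bsub>C\<^esub> f, Pr1 C (Dom C f) (Dom C g) \<cdot>\<^bsub>C\<^esub> g\<rangle>\<^bsub>C\<^esub>"

text \<open>
  \<open>npow C A n X\<close> is the object $A^n \times X$, nested to the right: $A \times (A \times \cdots (A \times X))$.
  Thus $A^0 \times X$ is \<open>X\<close> and $A^1 \times X$ is the chosen binary product \<open>A \<boxtimes> X\<close>.
  \<open>nproj C A n X i\<close> is $\pi_i$ for \<open>i \<le> n\<close> (for \<open>i = n\<close> it is the projection to \<open>X\<close>), and
  \<open>ntup C [z\<^sub>1, \<dots>, z\<^sub>n] x\<close> is the tuple $\langle z_1, \ldots, z_n, x \rangle$.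
\<close>

primrec npow :: "('o, 'm) crcat \<Rightarrow> 'o \<Rightarrow> nat \<Rightarrow> 'o \<Rightarrow> 'o" where
  "npow C A 0 X = X"
| "npow C A (Suc n) X = A \<boxtimes>\<^bsub>C\<^esub> npow C A n X"

fun nproj :: "('o, 'm) crcat \<Rightarrow> 'o \<Rightarrow> nat \<Rightarrow> 'o \<Rightarrow> nat \<Rightarrow> 'm" where
  "nproj C A 0 X i = Idn C X"
| "nproj C A (Suc n) X 0 = Pr0 C A (npow C A n X)"
| "nproj C A (Suc n) X (Suc i) = Pr1 C A (npow C A n X) \<cdot>\<^bsub>C\<^esub> nproj C A n X i"

definition ntup :: "('o, 'm) crcat \<Rightarrow> 'm list \<Rightarrow> 'm \<Rightarrow> 'm" where
  "ntup C zs x = foldr (Tup C) zs x"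


section \<open>Total commutative monoids\<close>

record ('o, 'm) imonoid =
  Crr :: 'o
  Add :: 'm
  Zro :: 'm

definition addm :: "('o, 'm) crcat \<Rightarrow> ('o, 'm) imonoid \<Rightarrow> 'm \<Rightarrow> 'm \<Rightarrow> 'm" where
  "addm C M f g = \<langle>f, g\<rangle>\<^bsub>C\<^esub> \<cdot>\<^bsub>C\<^esub> Add M"

definition zerom :: "('o, 'm) crcat \<Rightarrow> ('o, 'm) imonoid \<Rightarrow> 'o \<Rightarrow> 'm" where
  "zerom C M Z = Bang C Z \<cdot>\<^bsub>C\<^esub> Zro M"

definition total_comm_monoid :: "('o, 'm) crcat \<Rightarrow> ('o, 'm) imonoid \<Rightarrow> bool" where
  "total_comm_monoid C M \<longleftrightarrow>
    (let A = Crr M; AA = A \<boxtimes>\<^bsub>C\<^esub> A;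
         a = Pr0 C AA A \<cdot>\<^bsub>C\<^esub> Pr0 C A A; b = Pr0 C AA A \<cdot>\<^bsub>C\<^esub> Pr1 C A A; c = Pr1 C AA A
     in A \<in> Ob C \<and>
        Add M \<in> Hom C AA A \<and> total_map C (Add M) \<and>
        Zro M \<in> Hom C (One C) A \<and> total_map C (Zro M) \<and>
        addm C M (addm C M a b) c = addm C M a (addm C M b c) \<and>
        addm C M (Pr0 C A A) (Pr1 C A A) = addm C M (Pr1 C A A) (Pr0 C A A) \<and>
        addm C M (zerom C M A) (Idn C A) = Idn C A)"

definition prod_imonoid ::
  "('o, 'm) crcat \<Rightarrow> ('o, 'm) imonoid \<Rightarrow> ('o, 'm) imonoid \<Rightarrow> ('o, 'm) imonoid" where
  "prod_imonoid C M N =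
    (let A = Crr M; B = Crr N; P = A \<boxtimes>\<^bsub>C\<^esub> B; p = Pr0 C P P; q = Pr1 C P P
     in \<lparr>Crr = P,
         Add = \<langle>addm C M (p \<cdot>\<^bsub>C\<^esub> Pr0 C A B) (q \<cdot>\<^bsub>C\<^esub> Pr0 C A B),
                addm C N (p \<cdot>\<^bsub>C\<^esub> Pr1 C A B) (q \<cdot>\<^bsub>C\<^esub> Pr1 C A B)\<rangle>\<^bsub>C\<^esub>,
         Zro = \<langle>Zro M, Zro N\<rangle>\<^bsub>C\<^esub>\<rparr>)"

definition one_imonoid :: "('o, 'm) crcat \<Rightarrow> ('o, 'm) imonoid" where
  "one_imonoid C = \<lparr>Crr = One C, Add = Bang C (One C \<boxtimes>\<^bsub>C\<^esub> One C), Zro = Bang C (One C)\<rparr>"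

text \<open>
  The maps from \<open>Z\<close> to a total commutative monoid form a commutative monoid (written
  multiplicatively in HOL-Algebra), so a finite sum of such maps is a \<open>finprod\<close>.
\<close>

definition hom_monoid :: "('o, 'm) crcat \<Rightarrow> 'o \<Rightarrow> ('o, 'm) imonoid \<Rightarrow> 'm monoid" where
  "hom_monoid C Z M = \<lparr>partial_object.carrier = Hom C Z (Crr M), monoid.mult = addm C M, monoid.one = zerom C M Z\<rparr>"

definition hom_sum ::
  "('o, 'm) crcat \<Rightarrow> 'o \<Rightarrow> ('o, 'm) imonoid \<Rightarrow> ('i \<Rightarrow> 'm) \<Rightarrow> 'i set \<Rightarrow> 'm" where
  "hom_sum C Z M h I = finprod (hom_monoid C Z M) h I"


section \<open>Generalized differential restriction structures\<close>

text \<open>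
  Both \<open>L\<close> and \<open>D\<close> are extensional (\<open>undefined\<close> off objects and maps respectively), so that
  a structure is determined by its values on objects and maps.
\<close>

locale gen_diff_restriction_structure = cartesian_restriction_category C
  for C :: "('o, 'm) crcat" (structure) +
  fixes L :: "'o \<Rightarrow> ('o, 'm) imonoid" and D :: "'m \<Rightarrow> 'm"
  assumes L_monoid: "L \<in> Ob C \<rightarrow>\<^sub>E {M. total_comm_monoid C M}"
    and L_L: "X \<in> Ob C \<Longrightarrow> L (Crr (L X)) = L X"
    and L_prod: "\<lbrakk>X \<in> Ob C; Y \<in> Ob C\<rbrakk> \<Longrightarrow> L (X \<boxtimes> Y) = prod_imonoid C (L X) (L Y)"
    and L_one: "L (One C) = one_imonoid C"
    and D_ext: "D \<in> extensional (Ar C)"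
    and D_Hom: "f \<in> Hom C X Y \<Longrightarrow> D f \<in> Hom C (Crr (L X) \<boxtimes> X) (Crr (L Y))"
    and DR1_add: "X \<in> Ob C \<Longrightarrow>
        D (Add (L X)) = Pr0 C (Crr (L X) \<boxtimes> Crr (L X)) (Crr (L X) \<boxtimes> Crr (L X)) \<cdot> Add (L X)"
    and DR1_zero: "X \<in> Ob C \<Longrightarrow> D (Zro (L X)) = Pr0 C (One C) (One C) \<cdot> Zro (L X)"
    and DR2_add: "\<lbrakk>f \<in> Hom C X Y; a \<in> Hom C Z (Crr (L X)); b \<in> Hom C Z (Crr (L X)); c \<in> Hom C Z X\<rbrakk> \<Longrightarrow>
        \<langle>addm C (L X) a b, c\<rangle> \<cdot> D f = addm C (L Y) (\<langle>a, c\<rangle> \<cdot> D f) (\<langle>b, c\<rangle> \<cdot> D f)"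
    and DR2_zero: "\<lbrakk>f \<in> Hom C X Y; a \<in> Hom C Z X\<rbrakk> \<Longrightarrow>
        \<langle>zerom C (L X) Z, a\<rangle> \<cdot> D f = Rst C (a \<cdot> f) \<cdot> zerom C (L Y) Z"
    and DR3_0: "\<lbrakk>X \<in> Ob C; Y \<in> Ob C\<rbrakk> \<Longrightarrow>
        D (Pr0 C X Y) = Pr0 C (Crr (L X) \<boxtimes> Crr (L Y)) (X \<boxtimes> Y) \<cdot> Pr0 C (Crr (L X)) (Crr (L Y))"
    and DR3_1: "\<lbrakk>X \<in> Ob C; Y \<in> Ob C\<rbrakk> \<Longrightarrow>
        D (Pr1 C X Y) = Pr0 C (Crr (L X) \<boxtimes> Crr (L Y)) (X \<boxtimes> Y) \<cdot> Pr1 C (Crr (L X)) (Crr (L Y))"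
    and DR4: "\<lbrakk>f \<in> Hom C X Y; g \<in> Hom C X Z\<rbrakk> \<Longrightarrow> D \<langle>f, g\<rangle> = \<langle>D f, D g\<rangle>"
    and DR5: "\<lbrakk>f \<in> Hom C X Y; g \<in> Hom C Y Z\<rbrakk> \<Longrightarrow>
        D (f \<cdot> g) = \<langle>D f, Pr1 C (Crr (L X)) X \<cdot> f\<rangle> \<cdot> D g"
    and DR6: "\<lbrakk>f \<in> Hom C X Y; a \<in> Hom C Z (Crr (L X)); c \<in> Hom C Z (Crr (L X)); d \<in> Hom C Z X\<rbrakk> \<Longrightarrow>
        \<langle>\<langle>a, zerom C (L X) Z\<rangle>, \<langle>c, d\<rangle>\<rangle> \<cdot> D (D f) = Rst C c \<cdot> \<langle>a, d\<rangle> \<cdot> D f"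
    and DR7: "\<lbrakk>f \<in> Hom C X Y; b \<in> Hom C Z (Crr (L X)); c \<in> Hom C Z (Crr (L X)); d \<in> Hom C Z X\<rbrakk> \<Longrightarrow>
        \<langle>\<langle>zerom C (L X) Z, b\<rangle>, \<langle>c, d\<rangle>\<rangle> \<cdot> D (D f) = \<langle>\<langle>zerom C (L X) Z, c\<rangle>, \<langle>b, d\<rangle>\<rangle> \<cdot> D (D f)"
    and DR8: "f \<in> Hom C X Y \<Longrightarrow>
        D (Rst C f) = cross C (Idn C (Crr (L X))) (Rst C f) \<cdot> Pr0 C (Crr (L X)) X \<and>
        D (Rst C f) = Rst C (Pr1 C (Crr (L X)) X \<cdot> f) \<cdot> Pr0 C (Crr (L X)) X"
    and DR9: "f \<in> Hom C X Y \<Longrightarrow>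
        Rst C (D f) = cross C (Idn C (Crr (L X))) (Rst C f) \<and>
        Rst C (D f) = Rst C (Pr1 C (Crr (L X)) X \<cdot> f)"


section \<open>The construction $\mathbf{Fa\grave{a}}(\mathbb{X})$\<close>

text \<open>
  An object is a pair \<open>(M, X)\<close>.  A map $(f_*, f_1, f_2, \ldots)$ is stored together with its
  source and target, and its components are \<open>Fseq f 0\<close> $= f_*$ and \<open>Fseq f n\<close> $= f_n$ for \<open>n \<ge> 1\<close>.
  Variables are numbered from \<open>0\<close>, so the index sets $\{1,\ldots,n\}$ of the partitions, subsets and
  injections below become \<open>{..<n}\<close>.
\<close>

type_synonym ('o, 'm) fobj = "('o, 'm) imonoid \<times> 'o"

record ('o, 'm) farr =
  Fsrc :: "('o, 'm) fobj"
  Ftgt :: "('o, 'm) fobj"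
  Fseq :: "nat \<Rightarrow> 'm"

definition faa_objs :: "('o, 'm) crcat \<Rightarrow> ('o, 'm) fobj set" where
  "faa_objs C = {(M, X). total_comm_monoid C M \<and> X \<in> Ob C}"

definition symmetric_in ::
  "('o, 'm) crcat \<Rightarrow> 'o \<Rightarrow> nat \<Rightarrow> 'o \<Rightarrow> 'm \<Rightarrow> bool" where
  "symmetric_in C A n X h \<longleftrightarrow>
    (\<forall>\<sigma>. \<sigma> permutes {..<n} \<longrightarrow>
      ntup C (map (\<lambda>i. nproj C A n X (\<sigma> i)) [0..<n]) (nproj C A n X n) \<cdot>\<^bsub>C\<^esub> h = h)"

definition additive_in ::
  "('o, 'm) crcat \<Rightarrow> ('o, 'm) imonoid \<Rightarrow> nat \<Rightarrow> 'o \<Rightarrow> ('o, 'm) imonoid \<Rightarrow> 'm \<Rightarrow> bool" where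
  "additive_in C M n X N h \<longleftrightarrow>
    (\<forall>Z\<in>Ob C. \<forall>zs\<in>lists (Hom C Z (Crr M)). \<forall>x\<in>Hom C Z X. \<forall>i<n. length zs = n \<longrightarrow>
      (\<forall>a\<in>Hom C Z (Crr M). \<forall>b\<in>Hom C Z (Crr M).
        ntup C (zs[i := addm C M a b]) x \<cdot>\<^bsub>C\<^esub> h =
          addm C N (ntup C (zs[i := a]) x \<cdot>\<^bsub>C\<^esub> h) (ntup C (zs[i := b]) x \<cdot>\<^bsub>C\<^esub> h)) \<and>
      ntup C (zs[i := zerom C M Z]) x \<cdot>\<^bsub>C\<^esub> h =
        Rst C (ntup C (zs[i := zerom C M Z]) x \<cdot>\<^bsub>C\<^esub> h) \<cdot>\<^bsub>C\<^esub> zerom C N Z)"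

definition faa_arrs :: "('o, 'm) crcat \<Rightarrow> ('o, 'm) farr set" where
  "faa_arrs C = {f.
    (let (M, X) = Fsrc f; (N, Y) = Ftgt f; A = Crr M; B = Crr N
     in Fsrc f \<in> faa_objs C \<and> Ftgt f \<in> faa_objs C \<and>
        Fseq f 0 \<in> Hom C X Y \<and>
        (\<forall>n\<ge>1. Fseq f n \<in> Hom C (npow C A n X) B \<and>
          Rst C (Fseq f n) = Rst C (nproj C A n X n \<cdot>\<^bsub>C\<^esub> Fseq f 0) \<and>
          symmetric_in C A n X (Fseq f n) \<and>
          additive_in C M n X N (Fseq f n)))}"

text \<open>The sequence $(h, h_1, 0, 0, \ldots)$.\<close>

definition faa_linear ::
  "('o, 'm) crcat \<Rightarrow> ('o, 'm) fobj \<Rightarrow> ('o, 'm) fobj \<Rightarrow> 'm \<Rightarrow> 'm \<Rightarrow> ('o, 'm) farr" where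
  "faa_linear C S T h h1 = \<lparr>Fsrc = S, Ftgt = T,
    Fseq = (\<lambda>n. if n = 0 then h else if n = 1 then h1
                else zerom C (fst T) (npow C (Crr (fst S)) n (snd S)))\<rparr>"

text \<open>
  The blocks of a partition are listed by increasing minimum; since the maps $g_k$ are
  symmetric, the order is immaterial.
\<close>

definition faa_comp ::
  "('o, 'm) crcat \<Rightarrow> ('o, 'm) farr \<Rightarrow> ('o, 'm) farr \<Rightarrow> ('o, 'm) farr" where
  "faa_comp C f g =
    (let A = Crr (fst (Fsrc f)); X = snd (Fsrc f)
     in \<lparr>Fsrc = Fsrc f, Ftgt = Ftgt g,
      Fseq = (\<lambda>n.
        if n = 0 then Fseq f 0 \<cdot>\<^bsub>C\<^esub> Fseq g 0
        else
          (let a = nproj C A n X; x = nproj C A n X n;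
               f_at = (\<lambda>B. ntup C (map a (sorted_list_of_set B)) x \<cdot>\<^bsub>C\<^esub> Fseq f (card B))
           in hom_sum C (npow C A n X) (fst (Ftgt g))
                (\<lambda>P. ntup C (map f_at (sorted_key_list_of_set Min P)) (x \<cdot>\<^bsub>C\<^esub> Fseq f 0)
                       \<cdot>\<^bsub>C\<^esub> Fseq g (card P))
                {P. partition_on {..<n} P}))\<rparr>)"

definition faa_restr :: "('o, 'm) crcat \<Rightarrow> ('o, 'm) farr \<Rightarrow> ('o, 'm) farr" where
  "faa_restr C f =
    (let M = fst (Fsrc f); A = Crr M; X = snd (Fsrc f)
     in \<lparr>Fsrc = Fsrc f, Ftgt = Fsrc f,
      Fseq = (\<lambda>n.
        if n = 0 then Rst C (Fseq f 0)
        else if n = 1 then Rst C (Pr1 C A X \<cdot>\<^bsub>C\<^esub> Fseq f 0) \<cdot>\<^bsub>C\<^esub> Pr0 C A X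
        else Rst C (nproj C A n X n \<cdot>\<^bsub>C\<^esub> Fseq f 0) \<cdot>\<^bsub>C\<^esub> zerom C M (npow C A n X))\<rparr>)"

definition faa_one :: "('o, 'm) crcat \<Rightarrow> ('o, 'm) fobj" where
  "faa_one C = (one_imonoid C, One C)"

definition faa_bang :: "('o, 'm) crcat \<Rightarrow> ('o, 'm) fobj \<Rightarrow> ('o, 'm) farr" where
  "faa_bang C S = \<lparr>Fsrc = S, Ftgt = faa_one C,
    Fseq = (\<lambda>n. Bang C (npow C (Crr (fst S)) n (snd S)))\<rparr>"

definition faa_prod :: "('o, 'm) crcat \<Rightarrow> ('o, 'm) fobj \<Rightarrow> ('o, 'm) fobj \<Rightarrow> ('o, 'm) fobj" where
  "faa_prod C S T = (prod_imonoid C (fst S) (fst T), snd S \<boxtimes>\<^bsub>C\<^esub> snd T)"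

definition faa_pr0 :: "('o, 'm) crcat \<Rightarrow> ('o, 'm) fobj \<Rightarrow> ('o, 'm) fobj \<Rightarrow> ('o, 'm) farr" where
  "faa_pr0 C S T =
    (let A = Crr (fst S); B = Crr (fst T); X = snd S; Y = snd T
     in faa_linear C (faa_prod C S T) S
          (Pr0 C X Y) (Pr0 C (A \<boxtimes>\<^bsub>C\<^esub> B) (X \<boxtimes>\<^bsub>C\<^esub> Y) \<cdot>\<^bsub>C\<^esub> Pr0 C A B))"

definition faa_pr1 :: "('o, 'm) crcat \<Rightarrow> ('o, 'm) fobj \<Rightarrow> ('o, 'm) fobj \<Rightarrow> ('o, 'm) farr" where
  "faa_pr1 C S T =
    (let A = Crr (fst S); B = Crr (fst T); X = snd S; Y = snd T
     in faa_linear C (faa_prod C S T) T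
          (Pr1 C X Y) (Pr0 C (A \<boxtimes>\<^bsub>C\<^esub> B) (X \<boxtimes>\<^bsub>C\<^esub> Y) \<cdot>\<^bsub>C\<^esub> Pr1 C A B))"

definition faa_tup :: "('o, 'm) crcat \<Rightarrow> ('o, 'm) farr \<Rightarrow> ('o, 'm) farr \<Rightarrow> ('o, 'm) farr" where
  "faa_tup C f g = \<lparr>Fsrc = Fsrc f, Ftgt = faa_prod C (Ftgt f) (Ftgt g),
    Fseq = (\<lambda>n. \<langle>Fseq f n, Fseq g n\<rangle>\<^bsub>C\<^esub>)\<rparr>"

definition Faa :: "('o, 'm) crcat \<Rightarrow> (('o, 'm) fobj, ('o, 'm) farr) crcat" where
  "Faa C = \<lparr>Ob = faa_objs C, Ar = faa_arrs C, Dom = Fsrc, Cod = Ftgt,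
    Idn = (\<lambda>S. faa_linear C S S (Idn C (snd S)) (Pr0 C (Crr (fst S)) (snd S))),
    Cmp = faa_comp C, Rst = faa_restr C,
    One = faa_one C, Bang = faa_bang C,
    Prd = faa_prod C, Pr0 = faa_pr0 C, Pr1 = faa_pr1 C, Tup = faa_tup C\<rparr>"


section \<open>The comonad\<close>

text \<open>The action of $\mathbf{Fa\grave{a}}$ on a functor with object map \<open>Fo\<close> and arrow map \<open>Fa\<close>.\<close>

definition Faa_ob ::
  "('o \<Rightarrow> 'p) \<Rightarrow> ('m \<Rightarrow> 'n) \<Rightarrow> ('o, 'm) fobj \<Rightarrow> ('p, 'n) fobj" where
  "Faa_ob Fo Fa S =
    (\<lparr>Crr = Fo (Crr (fst S)), Add = Fa (Add (fst S)), Zro = Fa (Zro (fst S))\<rparr>, Fo (snd S))"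

definition Faa_ar ::
  "('o \<Rightarrow> 'p) \<Rightarrow> ('m \<Rightarrow> 'n) \<Rightarrow> ('o, 'm) farr \<Rightarrow> ('p, 'n) farr" where
  "Faa_ar Fo Fa f =
    \<lparr>Fsrc = Faa_ob Fo Fa (Fsrc f), Ftgt = Faa_ob Fo Fa (Ftgt f), Fseq = (\<lambda>n. Fa (Fseq f n))\<rparr>"

definition eps_ob :: "('o, 'm) fobj \<Rightarrow> 'o" where
  "eps_ob S = snd S"

definition eps_ar :: "('o, 'm) farr \<Rightarrow> 'm" where
  "eps_ar f = Fseq f 0"

definition delta_ob ::
  "('o, 'm) crcat \<Rightarrow> ('o, 'm) fobj \<Rightarrow> (('o, 'm) fobj, ('o, 'm) farr) fobj" where
  "delta_ob C S =
    (let M = fst S; A = Crr M; T = (M, A)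
     in (\<lparr>Crr = T,
          Add = faa_linear C (faa_prod C T T) T
                  (Add M) (Pr0 C (A \<boxtimes>\<^bsub>C\<^esub> A) (A \<boxtimes>\<^bsub>C\<^esub> A) \<cdot>\<^bsub>C\<^esub> Add M),
          Zro = faa_linear C (faa_one C) T (Zro M) (Pr0 C (One C) (One C) \<cdot>\<^bsub>C\<^esub> Zro M)\<rparr>,
         S))"

text \<open>
  \<open>delta_comp C f n\<close> is $\delta(f)_n$ for \<open>n \<ge> 1\<close>.  The partial injections \<open>(S, \<phi>)\<close> have \<open>\<phi>\<close>
  extensional, so that each is counted once.
\<close>

definition delta_comp :: "('o, 'm) crcat \<Rightarrow> ('o, 'm) farr \<Rightarrow> nat \<Rightarrow> ('o, 'm) farr" where
  "delta_comp C f n =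
    (let M = fst (Fsrc f); N = fst (Ftgt f); A = Crr M; X = snd (Fsrc f);
         P = npow C A n A; Q = npow C A n X
     in \<lparr>Fsrc = npow (Faa C) (M, A) n (M, X), Ftgt = (N, Crr N),
      Fseq = (\<lambda>r.
        if r = 0 then Fseq f n
        else
          (let v = (\<lambda>j i. nproj C P r Q j \<cdot>\<^bsub>C\<^esub> nproj C A n A i);
               w = (\<lambda>j. nproj C P r Q j \<cdot>\<^bsub>C\<^esub> nproj C A n A n);
               a = (\<lambda>i. nproj C P r Q r \<cdot>\<^bsub>C\<^esub> nproj C A n X i);
               x = nproj C P r Q r \<cdot>\<^bsub>C\<^esub> nproj C A n X n
           in hom_sum C (npow C P r Q) N
                (\<lambda>(S, \<phi>).
                  (let a\<phi> = (\<lambda>i. if i \<in> \<phi> ` S then v (the_inv_into S \<phi> i) i else a i)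
                   in ntup C (map a\<phi> [0..<n] @ map w (filter (\<lambda>j. j \<notin> S) [0..<r])) x
                        \<cdot>\<^bsub>C\<^esub> Fseq f (n + r - card S)))
                {(S, \<phi>). S \<subseteq> {..<r} \<and> \<phi> \<in> S \<rightarrow>\<^sub>E {..<n} \<and> inj_on \<phi> S}))\<rparr>)"

definition delta_ar ::
  "('o, 'm) crcat \<Rightarrow> ('o, 'm) farr \<Rightarrow> (('o, 'm) fobj, ('o, 'm) farr) farr" where
  "delta_ar C f = \<lparr>Fsrc = delta_ob C (Fsrc f), Ftgt = delta_ob C (Ftgt f),
    Fseq = (\<lambda>n. if n = 0 then f else delta_comp C f n)\<rparr>"


section \<open>Coalgebras\<close>

text \<open>
  Functors preserving restrictions and all of the chosen restriction-product structure on the nose.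
  Object and arrow maps are extensional.
\<close>

locale crc_functor =
  fixes C :: "('o, 'm) crcat" and E :: "('p, 'n) crcat"
    and Fo :: "'o \<Rightarrow> 'p" and Fa :: "'m \<Rightarrow> 'n"
  assumes Fo_Ob: "Fo \<in> Ob C \<rightarrow>\<^sub>E Ob E"
    and Fa_Ar: "Fa \<in> Ar C \<rightarrow>\<^sub>E Ar E"
    and Fa_Dom: "f \<in> Ar C \<Longrightarrow> Dom E (Fa f) = Fo (Dom C f)"
    and Fa_Cod: "f \<in> Ar C \<Longrightarrow> Cod E (Fa f) = Fo (Cod C f)"
    and Fa_Idn: "X \<in> Ob C \<Longrightarrow> Fa (Idn C X) = Idn E (Fo X)"
    and Fa_Cmp: "\<lbrakk>f \<in> Hom C X Y; g \<in> Hom C Y Z\<rbrakk> \<Longrightarrow> Fa (f \<cdot>\<^bsub>C\<^esub> g) = Fa f \<cdot>\<^bsub>E\<^esub> Fa g"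
    and Fa_Rst: "f \<in> Ar C \<Longrightarrow> Fa (Rst C f) = Rst E (Fa f)"
    and Fo_One: "Fo (One C) = One E"
    and Fa_Bang: "X \<in> Ob C \<Longrightarrow> Fa (Bang C X) = Bang E (Fo X)"
    and Fo_Prd: "\<lbrakk>X \<in> Ob C; Y \<in> Ob C\<rbrakk> \<Longrightarrow> Fo (X \<boxtimes>\<^bsub>C\<^esub> Y) = Fo X \<boxtimes>\<^bsub>E\<^esub> Fo Y"
    and Fa_Pr0: "\<lbrakk>X \<in> Ob C; Y \<in> Ob C\<rbrakk> \<Longrightarrow> Fa (Pr0 C X Y) = Pr0 E (Fo X) (Fo Y)"
    and Fa_Pr1: "\<lbrakk>X \<in> Ob C; Y \<in> Ob C\<rbrakk> \<Longrightarrow> Fa (Pr1 C X Y) = Pr1 E (Fo X) (Fo Y)"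
    and Fa_Tup: "\<lbrakk>f \<in> Hom C Z X; g \<in> Hom C Z Y\<rbrakk> \<Longrightarrow> Fa \<langle>f, g\<rangle>\<^bsub>C\<^esub> = \<langle>Fa f, Fa g\<rangle>\<^bsub>E\<^esub>"

locale faa_coalgebra = crc_functor C "Faa C" Do Da
  for C :: "('o, 'm) crcat" and Do :: "'o \<Rightarrow> ('o, 'm) fobj" and Da :: "'m \<Rightarrow> ('o, 'm) farr" +
  assumes counit_ob: "X \<in> Ob C \<Longrightarrow> eps_ob (Do X) = X"
    and counit_ar: "f \<in> Ar C \<Longrightarrow> eps_ar (Da f) = f"
    and coassoc_ob: "X \<in> Ob C \<Longrightarrow> delta_ob C (Do X) = Faa_ob Do Da (Do X)"
    and coassoc_ar: "f \<in> Ar C \<Longrightarrow> delta_ar C (Da f) = Faa_ar Do Da (Da f)"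

end

theory Submission
  imports Defs
begin

text \<open>
  Coassociativity at $r = 1$ reads
  $D[f_n](v, w, a, x) = f_{n+1}(a, w, x) + \sum_i f_n(a_1, \ldots, v_i, \ldots, a_n, x)$.
  With $v = 0$ it determines $f_{n+1}$ from $D[f_n]$, so a coalgebra is determined by its first components;
  for $n = 1$ it yields [DR.6] and [DR.7], while the remaining axioms are components of the functor laws.

  Conversely, $f_n$ is defined by iterated partial differentiation. From [DR.6] and [DR.7] one gets the displayed
  formula and the symmetry of $f_n$ by induction on $n$, and [DR.2] then gives additivity.
  Together with the chain rule [DR.5] the formula shows how the sums over partitions and over partial
  injections grow when one more variable is differentiated, which proves the composition law and coassociativity.

  Partiality is controlled by comparing maps out of $Z$ only with maps having the same restriction $e$:
  among these, pairing behaves like an ordinary product.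
\<close>

section \<open>Restriction calculus\<close>

text \<open>The obstacle is that the zero of a monoid is total while the terms of a sum are partial.
  Composing into a zero map, or differentiating it, leaves a zero restricted to some domain, so both
  operations preserve nonempty sums only. Therefore \<open>ze e M\<close>, the zero with domain
  \<open>e\<close>, takes the place of 0, and vanishing terms are dropped only next to a summand
  that carries the domain.

  Identities are proved at generalized elements. Read at the projections, such an identity becomes
  an equation of maps, and this equation can be differentiated again by the chain rule; that is how
  the inductions on \<open>n\<close> advance.

  The recursion for the components puts a new variable in front, whereas the index sets
  \<open>{..<Suc n}\<close> of partitions and partial injections grow at the end. Symmetry
  reconciles the two, so it has to be available before the composition law.

  Of the two round trips, the one that starts from a differential structure is immediate, since
  \<open>F f 1 = D f\<close>.\<close>

context restriction_category
begin

lemma Hom_iff [simp]: "f \<in> Hom C X Y \<longleftrightarrow> f \<in> Ar C \<and> Dom C f = X \<and> Cod C f = Y"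
  by (simp add: Hom_def)

lemma Dom_in [simp]: "f \<in> Ar C \<Longrightarrow> Dom C f \<in> Ob C"
  and Cod_in [simp]: "f \<in> Ar C \<Longrightarrow> Cod C f \<in> Ob C"
  by (rule Dom_Ob Cod_Ob; assumption)+

lemma Idn_simps [simp]:
  assumes "X \<in> Ob C"
  shows "Idn C X \<in> Ar C" "Dom C (Idn C X) = X" "Cod C (Idn C X) = X"
  using Idn_Hom[OF assms] by auto

lemma Cmp_simps [simp]:
  assumes "f \<in> Ar C" "g \<in> Ar C" "Cod C f = Dom C g"
  shows "f \<cdot> g \<in> Ar C" "Dom C (f \<cdot> g) = Dom C f" "Cod C (f \<cdot> g) = Cod C g"
  using Cmp_Hom[of f "Dom C f" "Dom C g" g "Cod C g"] assms by auto

lemma Rst_simps [simp]: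
  assumes "f \<in> Ar C"
  shows "Rst C f \<in> Ar C" "Dom C (Rst C f) = Dom C f" "Cod C (Rst C f) = Dom C f"
  using Rst_Hom[of f "Dom C f" "Cod C f"] assms by auto

lemma Idn_left [simp]: "\<lbrakk>f \<in> Ar C; Dom C f = X\<rbrakk> \<Longrightarrow> Idn C X \<cdot> f = f"
  and Idn_right [simp]: "\<lbrakk>f \<in> Ar C; Cod C f = X\<rbrakk> \<Longrightarrow> f \<cdot> Idn C X = f"
  using Cmp_Idn_left Cmp_Idn_right by auto

lemma assoc [simp]:
  "\<lbrakk>f \<in> Ar C; g \<in> Ar C; h \<in> Ar C; Cod C f = Dom C g; Cod C g = Dom C h\<rbrakk>
    \<Longrightarrow> (f \<cdot> g) \<cdot> h = f \<cdot> (g \<cdot> h)"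
  using Cmp_assoc by auto

lemma Rst_absorb [simp]: "f \<in> Ar C \<Longrightarrow> Rst C f \<cdot> f = f"
  by (rule R1)

lemma Rst_absorb_assoc [simp]:
  assumes "f \<in> Ar C" "g \<in> Ar C" "Cod C f = Dom C g"
  shows "Rst C f \<cdot> (f \<cdot> g) = f \<cdot> g"
  using assoc[of "Rst C f" f g] assms by simp

lemma Rst_commute:
  "\<lbrakk>f \<in> Ar C; g \<in> Ar C; Dom C f = Dom C g\<rbrakk> \<Longrightarrow> Rst C f \<cdot> Rst C g = Rst C g \<cdot> Rst C f"
  using R2 by simp

lemma Rst_Rst_cmp:
  "\<lbrakk>f \<in> Ar C; g \<in> Ar C; Dom C f = Dom C g\<rbrakk> \<Longrightarrow> Rst C (Rst C f \<cdot> g) = Rst C f \<cdot> Rst C g"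
  using R3 by simp

lemma cmp_Rst:
  "\<lbrakk>f \<in> Ar C; g \<in> Ar C; Cod C f = Dom C g\<rbrakk> \<Longrightarrow> f \<cdot> Rst C g = Rst C (f \<cdot> g) \<cdot> f"
  using R4 by simp

lemma Rst_Idn [simp]:
  assumes "X \<in> Ob C" shows "Rst C (Idn C X) = Idn C X"
  using R1[of "Idn C X"] assms by simp

lemma Rst_idem [simp]:
  assumes "f \<in> Ar C" shows "Rst C (Rst C f) = Rst C f"
  using Rst_Rst_cmp[of f "Idn C (Dom C f)"] assms by simp

lemma Rst_Rst_absorb [simp]:
  assumes "f \<in> Ar C" shows "Rst C f \<cdot> Rst C f = Rst C f"
  using R1[of "Rst C f"] assms by simp

lemma Rst_Rst_absorb_assoc [simp]:
  assumes "f \<in> Ar C" "g \<in> Ar C" "Dom C f = Dom C g"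
  shows "Rst C f \<cdot> (Rst C f \<cdot> g) = Rst C f \<cdot> g"
  using assoc[of "Rst C f" "Rst C f" g] assms by simp

lemma Rst_left_commute:
  assumes "f \<in> Ar C" "g \<in> Ar C" "h \<in> Ar C" "Dom C f = Dom C g" "Dom C h = Dom C g"
  shows "Rst C f \<cdot> (Rst C g \<cdot> h) = Rst C g \<cdot> (Rst C f \<cdot> h)"
  using assoc[of "Rst C f" "Rst C g" h] assoc[of "Rst C g" "Rst C f" h] Rst_commute[of f g] assms
  by simp

lemma Rst_below [simp]:
  assumes "f \<in> Ar C" "g \<in> Ar C" "Cod C f = Dom C g"
  shows "Rst C f \<cdot> Rst C (f \<cdot> g) = Rst C (f \<cdot> g)"
  using Rst_Rst_cmp[of f "f \<cdot> g"] assms by simp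

lemma Rst_cmp_Rst:
  assumes "f \<in> Ar C" "g \<in> Ar C" "Cod C f = Dom C g"
  shows "Rst C (f \<cdot> Rst C g) = Rst C (f \<cdot> g)"
  using assms cmp_Rst[of f g] Rst_commute[of "f \<cdot> g" f] by (simp add: Rst_Rst_cmp)

text \<open>By \<open>Rst_cmp_Rst\<close> a composite sees its second factor only through the
  restriction. Together with [DR.9] this computes the domains of all derivatives: \<open>D f\<close>
  may be replaced by a projection followed by \<open>f\<close>.\<close>

lemma Rst_cmp_eq:
  assumes "f \<in> Ar C" "g \<in> Ar C" "g' \<in> Ar C" "Cod C f = Dom C g" "Dom C g' = Dom C g" "Rst C g' = Rst C g"
  shows "Rst C (f \<cdot> g') = Rst C (f \<cdot> g)"
  using assms Rst_cmp_Rst[of f g] Rst_cmp_Rst[of f g'] by simp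

lemma Rst_cmp_total [simp]:
  assumes "f \<in> Ar C" "g \<in> Ar C" "Cod C f = Dom C g" "Rst C g = Idn C (Dom C g)"
  shows "Rst C (f \<cdot> g) = Rst C f"
  using assms Rst_cmp_Rst[of f g] by simp

lemma Rst_cmp_Rst_simp [simp]:
  assumes "f \<in> Ar C" "Rst C f = Rst C g" "g \<in> Ar C" "Dom C g = Dom C f"
  shows "Rst C g \<cdot> f = f"
  using assms by (metis R1)

end

section \<open>Pairing of partial maps\<close>

context cartesian_restriction_category
begin

lemma One_in [simp]: "One C \<in> Ob C" by (rule One_Ob)

lemma Bang_simps [simp]:
  assumes "X \<in> Ob C"
  shows "Bang C X \<in> Ar C" "Dom C (Bang C X) = X" "Cod C (Bang C X) = One C"
    "Rst C (Bang C X) = Idn C X"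
  using Bang_Hom[OF assms] Bang_total[OF assms] by (auto simp: total_map_def)

lemma Prd_in [simp]: "\<lbrakk>X \<in> Ob C; Y \<in> Ob C\<rbrakk> \<Longrightarrow> X \<boxtimes> Y \<in> Ob C" by (rule Prd_Ob)

lemma Pr0_simps [simp]:
  assumes "X \<in> Ob C" "Y \<in> Ob C"
  shows "Pr0 C X Y \<in> Ar C" "Dom C (Pr0 C X Y) = X \<boxtimes> Y" "Cod C (Pr0 C X Y) = X"
    "Rst C (Pr0 C X Y) = Idn C (X \<boxtimes> Y)"
  using Pr0_Hom[OF assms] Pr0_total[OF assms] by (auto simp: total_map_def)

lemma Pr1_simps [simp]:
  assumes "X \<in> Ob C" "Y \<in> Ob C"
  shows "Pr1 C X Y \<in> Ar C" "Dom C (Pr1 C X Y) = X \<boxtimes> Y" "Cod C (Pr1 C X Y) = Y"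
    "Rst C (Pr1 C X Y) = Idn C (X \<boxtimes> Y)"
  using Pr1_Hom[OF assms] Pr1_total[OF assms] by (auto simp: total_map_def)

lemma Tup_simps0 [simp]:
  assumes "f \<in> Ar C" "g \<in> Ar C" "Dom C f = Dom C g"
  shows "\<langle>f, g\<rangle> \<in> Ar C" "Dom C \<langle>f, g\<rangle> = Dom C f" "Cod C \<langle>f, g\<rangle> = Cod C f \<boxtimes> Cod C g"
  using Tup_Hom[of f "Dom C f" "Cod C f" g "Cod C g"] assms by auto

lemma Tup_Pr0':
  "\<lbrakk>f \<in> Ar C; g \<in> Ar C; Dom C f = Dom C g; Cod C f = X; Cod C g = Y\<rbrakk>
    \<Longrightarrow> \<langle>f, g\<rangle> \<cdot> Pr0 C X Y = Rst C g \<cdot> f"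
  using Tup_Pr0 by auto

lemma Tup_Pr1':
  "\<lbrakk>f \<in> Ar C; g \<in> Ar C; Dom C f = Dom C g; Cod C f = X; Cod C g = Y\<rbrakk>
    \<Longrightarrow> \<langle>f, g\<rangle> \<cdot> Pr1 C X Y = Rst C f \<cdot> g"
  using Tup_Pr1 by auto

text \<open>A total projection does not change the restriction, so the pair may be replaced by its
  restricted first component.\<close>

lemma Rst_Tup [simp]:
  assumes "f \<in> Ar C" "g \<in> Ar C" "Dom C f = Dom C g"
  shows "Rst C \<langle>f, g\<rangle> = Rst C f \<cdot> Rst C g"
proof -
  have "Rst C \<langle>f, g\<rangle> = Rst C (\<langle>f, g\<rangle> \<cdot> Pr0 C (Cod C f) (Cod C g))"
    using assms by simp
  then show ?thesis
    using assms by (simp add: Tup_Pr0' Rst_Rst_cmp Rst_commute)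
qed

lemma Tup_eqI:
  assumes "f \<in> Ar C" "g \<in> Ar C" "h \<in> Ar C" "Dom C f = Dom C g" "Dom C h = Dom C f"
    "Cod C f = X" "Cod C g = Y"
    "Cod C h = X \<boxtimes> Y" "h \<cdot> Pr0 C X Y = Rst C g \<cdot> f" "h \<cdot> Pr1 C X Y = Rst C f \<cdot> g"
  shows "h = \<langle>f, g\<rangle>"
  using assms Tup_unique[of f "Dom C f" X g Y h] by auto

lemma Tup_Pr [simp]:
  assumes "f \<in> Ar C" "g \<in> Ar C" "Dom C f = Dom C g" "Rst C f = Rst C g" "Cod C f = X" "Cod C g = Y"
  shows "\<langle>f, g\<rangle> \<cdot> Pr0 C X Y = f" "\<langle>f, g\<rangle> \<cdot> Pr1 C X Y = g"
  using assms by (simp_all add: Tup_Pr0' Tup_Pr1')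

lemma Tup_Pr_assoc [simp]:
  assumes "f \<in> Ar C" "g \<in> Ar C" "Dom C f = Dom C g" "Rst C f = Rst C g" "Cod C f = X" "Cod C g = Y"
    "h \<in> Ar C"
  shows "Dom C h = X \<Longrightarrow> \<langle>f, g\<rangle> \<cdot> (Pr0 C X Y \<cdot> h) = f \<cdot> h"
    "Dom C h = Y \<Longrightarrow> \<langle>f, g\<rangle> \<cdot> (Pr1 C X Y \<cdot> h) = g \<cdot> h"
proof -
  have [simp]: "X \<in> Ob C" "Y \<in> Ob C" using assms by auto
  show "Dom C h = X \<Longrightarrow> \<langle>f, g\<rangle> \<cdot> (Pr0 C X Y \<cdot> h) = f \<cdot> h"
    using assoc[of "\<langle>f, g\<rangle>" "Pr0 C X Y" h] assms by simp
  show "Dom C h = Y \<Longrightarrow> \<langle>f, g\<rangle> \<cdot> (Pr1 C X Y \<cdot> h) = g \<cdot> h"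
    using assoc[of "\<langle>f, g\<rangle>" "Pr1 C X Y" h] assms by simp
qed

text \<open>Both sides have the same projections: [R.4] moves the restriction of one component
  across \<open>a\<close>, and uniqueness of pairing finishes.\<close>

lemma cmp_Tup [simp]:
  assumes "a \<in> Ar C" "f \<in> Ar C" "g \<in> Ar C" "Dom C f = Dom C g" "Cod C a = Dom C g"
  shows "a \<cdot> \<langle>f, g\<rangle> = \<langle>a \<cdot> f, a \<cdot> g\<rangle>"
proof (rule Tup_eqI[where X="Cod C f" and Y="Cod C g"])
  show "(a \<cdot> \<langle>f, g\<rangle>) \<cdot> Pr0 C (Cod C f) (Cod C g) = Rst C (a \<cdot> g) \<cdot> (a \<cdot> f)"
    using assms assoc[of a "Rst C g" f] assoc[of "Rst C (a \<cdot> g)" a f] cmp_Rst[of a g]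
    by (simp add: Tup_Pr0' del: assoc) (simp add: Tup_Pr0')
  show "(a \<cdot> \<langle>f, g\<rangle>) \<cdot> Pr1 C (Cod C f) (Cod C g) = Rst C (a \<cdot> f) \<cdot> (a \<cdot> g)"
    using assms assoc[of a "Rst C f" g] assoc[of "Rst C (a \<cdot> f)" a g] cmp_Rst[of a f]
    by (simp add: Tup_Pr1' del: assoc) (simp add: Tup_Pr1')
qed (use assms in simp_all)

lemma Tup_Rst_left:
  assumes "a \<in> Ar C" "f \<in> Ar C" "g \<in> Ar C" "Dom C f = Dom C g" "Dom C a = Dom C g"
  shows "\<langle>Rst C a \<cdot> f, g\<rangle> = Rst C a \<cdot> \<langle>f, g\<rangle>"
  using assms
  by (intro Tup_eqI[symmetric, where X="Cod C f" and Y="Cod C g"])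
    (simp_all add: Tup_Pr0' Tup_Pr1' Rst_Rst_cmp Rst_left_commute del: cmp_Tup)

lemma Tup_Rst_right:
  assumes "a \<in> Ar C" "f \<in> Ar C" "g \<in> Ar C" "Dom C f = Dom C g" "Dom C a = Dom C g"
  shows "\<langle>f, Rst C a \<cdot> g\<rangle> = Rst C a \<cdot> \<langle>f, g\<rangle>"
  using assms
  by (intro Tup_eqI[symmetric, where X="Cod C f" and Y="Cod C g"])
    (simp_all add: Tup_Pr0' Tup_Pr1' Rst_Rst_cmp Rst_left_commute del: cmp_Tup)

text \<open>A pair is defined only where both components are, so restricting one component to the
  domain of the other changes nothing. This is what allows a total zero inside a pair to be
  exchanged for a zero restricted to the domain of its partner.\<close>

lemma Tup_restrict:
  assumes "f \<in> Ar C" "g \<in> Ar C" "Dom C f = Dom C g"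
  shows "\<langle>Rst C g \<cdot> f, g\<rangle> = \<langle>f, g\<rangle>" "\<langle>f, Rst C f \<cdot> g\<rangle> = \<langle>f, g\<rangle>"
proof -
  have "Rst C \<langle>f, g\<rangle> \<cdot> \<langle>f, g\<rangle> = \<langle>f, g\<rangle>" using assms Rst_absorb[of "\<langle>f, g\<rangle>"] by (simp del: cmp_Tup)
  then have *: "Rst C f \<cdot> (Rst C g \<cdot> \<langle>f, g\<rangle>) = \<langle>f, g\<rangle>" using assms by (simp del: cmp_Tup)
  have "Rst C g \<cdot> \<langle>f, g\<rangle> = \<langle>f, g\<rangle>"
    by (subst (1 2) *[symmetric]) (use assms in \<open>simp del: cmp_Tup add: Rst_left_commute[of g f]\<close>)
  then show "\<langle>Rst C g \<cdot> f, g\<rangle> = \<langle>f, g\<rangle>" using assms by (simp add: Tup_Rst_left del: cmp_Tup)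
  have "Rst C f \<cdot> \<langle>f, g\<rangle> = \<langle>f, g\<rangle>"
    by (subst (1 2) *[symmetric]) (use assms in \<open>simp del: cmp_Tup\<close>)
  then show "\<langle>f, Rst C f \<cdot> g\<rangle> = \<langle>f, g\<rangle>" using assms by (simp add: Tup_Rst_right del: cmp_Tup)
qed

lemma Tup_Pr_id [simp]:
  assumes "X \<in> Ob C" "Y \<in> Ob C"
  shows "\<langle>Pr0 C X Y, Pr1 C X Y\<rangle> = Idn C (X \<boxtimes> Y)"
  using assms by (intro Tup_eqI[symmetric, where X=X and Y=Y]) auto

lemma Tup_eta:
  assumes "h \<in> Ar C" "Cod C h = X \<boxtimes> Y" "X \<in> Ob C" "Y \<in> Ob C"
  shows "\<langle>h \<cdot> Pr0 C X Y, h \<cdot> Pr1 C X Y\<rangle> = h"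
  using cmp_Tup[of h "Pr0 C X Y" "Pr1 C X Y"] assms by (simp del: cmp_Tup)

text \<open>A map into the terminal object is its restriction followed by \<open>Bang\<close>; hence
  only domains have to be compared. Zero maps factor through the terminal object and are treated
  this way.\<close>

lemma to_One_eq:
  assumes "f \<in> Ar C" "g \<in> Ar C" "Cod C f = One C" "Cod C g = One C" "Dom C f = Dom C g" "Rst C f = Rst C g"
  shows "f = g"
  using Bang_restr[of f "Dom C f"] Bang_restr[of g "Dom C f"] assms by simp

end

lemma (in restriction_category) Rst_absorb_eq: "\<lbrakk>f \<in> Ar C; Rst C f = e\<rbrakk> \<Longrightarrow> e \<cdot> f = f"
  by (metis R1)

lemma (in cartesian_restriction_category) Tup_absorb:
  assumes "f \<in> Ar C" "g \<in> Ar C" "Dom C f = Dom C g"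
  shows "Rst C f \<cdot> \<langle>f, g\<rangle> = \<langle>f, g\<rangle>" "Rst C g \<cdot> \<langle>f, g\<rangle> = \<langle>f, g\<rangle>"
  using Tup_restrict[OF assms] Tup_Rst_left[of g f g] Tup_Rst_right[of f f g] assms by metis+

text \<open>
  The generalized elements of \<open>X\<close> with domain \<open>e\<close>; for fixed \<open>e\<close> pairing is an ordinary product.
\<close>

definition (in restriction_category) El :: "'o \<Rightarrow> 'm \<Rightarrow> 'o \<Rightarrow> 'm set" where
  "El Z e X = {h \<in> Hom C Z X. Rst C h = e}"

text \<open>The facts about \<open>e\<close> hold because it is the restriction of \<open>h\<close>.
  They are listed so that simplification still has them when \<open>e\<close> is a variable.\<close>

lemma (in restriction_category) El_iff [simp]:
  "h \<in> El Z e X \<longleftrightarrow> h \<in> Ar C \<and> Dom C h = Z \<and> Cod C h = X \<and> Rst C h = e \<and>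
     e \<in> Ar C \<and> Dom C e = Z \<and> Cod C e = Z \<and> Rst C e = e \<and> e \<cdot> e = e"
  by (auto simp: El_def)

lemma (in restriction_category) El_Hom: "h \<in> El Z e X \<Longrightarrow> h \<in> Hom C Z X"
  by simp

text \<open>Fixes the record type without extension, the type for which \<open>npow\<close>,
  \<open>ntup\<close> and the monoid notions are defined.\<close>

locale crc = cartesian_restriction_category C for C :: "('o, 'm) crcat" (structure)
begin

section \<open>Powers, tuples and their projections\<close>

lemma npow_Ob [simp]: "\<lbrakk>A \<in> Ob C; X \<in> Ob C\<rbrakk> \<Longrightarrow> npow C A n X \<in> Ob C"
  by (induction n) auto

lemma nproj_simps [simp]:
  assumes "A \<in> Ob C" "X \<in> Ob C" "i \<le> n"
  shows "nproj C A n X i \<in> Ar C" "Dom C (nproj C A n X i) = npow C A n X"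
    "Cod C (nproj C A n X i) = (if i < n then A else X)"
    "Rst C (nproj C A n X i) = Idn C (npow C A n X)"
proof -
  have "nproj C A n X i \<in> Ar C \<and> Dom C (nproj C A n X i) = npow C A n X \<and>
    Cod C (nproj C A n X i) = (if i < n then A else X) \<and>
    Rst C (nproj C A n X i) = Idn C (npow C A n X)"
    using assms
  proof (induction n arbitrary: i)
    case (Suc n)
    then show ?case by (cases i) auto
  qed auto
  then show "nproj C A n X i \<in> Ar C" "Dom C (nproj C A n X i) = npow C A n X"
    "Cod C (nproj C A n X i) = (if i < n then A else X)"
    "Rst C (nproj C A n X i) = Idn C (npow C A n X)" by auto
qed

lemma ntup_Nil [simp]: "ntup C [] x = x"
  and ntup_Cons [simp]: "ntup C (z # zs) x = \<langle>z, ntup C zs x\<rangle>"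
  by (simp_all add: ntup_def)

lemma ntup_El:
  assumes "\<forall>z\<in>set zs. z \<in> El Z e A" "x \<in> El Z e X" "length zs = n"
  shows "ntup C zs x \<in> El Z e (npow C A n X)"
  using assms by (induction zs arbitrary: n) auto

lemma ntup_Hom:
  assumes "\<forall>z\<in>set zs. z \<in> Hom C Z A" "x \<in> Hom C Z X" "length zs = n"
  shows "ntup C zs x \<in> Hom C Z (npow C A n X)"
  using assms by (induction zs arbitrary: n) auto

lemma cmp_ntup:
  assumes "\<forall>z\<in>set zs. z \<in> Hom C Z A" "x \<in> Hom C Z X" "a \<in> Ar C" "Cod C a = Z"
  shows "a \<cdot> ntup C zs x = ntup C (map (\<lambda>z. a \<cdot> z) zs) (a \<cdot> x)"
  using assms
proof (induction zs)
  case (Cons z zs)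
  moreover have "ntup C zs x \<in> Hom C Z (npow C A (length zs) X)"
    using Cons by (intro ntup_Hom) auto
  ultimately show ?case by auto
qed auto

lemma ntup_nproj:
  assumes "\<forall>z\<in>set zs. z \<in> El Z e A" "x \<in> El Z e X" "length zs = n" "i \<le> n" "A \<in> Ob C"
  shows "ntup C zs x \<cdot> nproj C A n X i = (if i < n then zs ! i else x)"
  using assms
proof (induction zs arbitrary: n i)
  case (Cons z zs)
  have "ntup C zs x \<in> El Z e (npow C A (length zs) X)"
    using Cons by (intro ntup_El) auto
  with Cons show ?case by (cases i) auto
qed auto

lemma ntup_nproj_eta:
  assumes "h \<in> Ar C" "Cod C h = npow C A n X" "A \<in> Ob C" "X \<in> Ob C"
  shows "ntup C (map (\<lambda>i. h \<cdot> nproj C A n X i) [0..<n]) (h \<cdot> nproj C A n X n) = h"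
  using assms
proof (induction n arbitrary: h)
  case (Suc n)
  have "ntup C (map (\<lambda>i. (h \<cdot> Pr1 C A (npow C A n X)) \<cdot> nproj C A n X i) [0..<n])
     ((h \<cdot> Pr1 C A (npow C A n X)) \<cdot> nproj C A n X n) = h \<cdot> Pr1 C A (npow C A n X)"
    using Suc by (intro Suc.IH) auto
  moreover have "map (\<lambda>i. (h \<cdot> Pr1 C A (npow C A n X)) \<cdot> nproj C A n X i) [0..<n] =
     map (\<lambda>i. h \<cdot> nproj C A (Suc n) X (Suc i)) [0..<n]"
    using Suc by (intro map_cong) auto
  ultimately show ?case
    using Suc.prems Tup_eta[of h A "npow C A n X"]
    by (simp add: upt_conv_Cons map_Suc_upt[symmetric] comp_def del: upt_Suc)
qed auto

lemma ntup_nproj_id [simp]: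
  assumes "A \<in> Ob C" "X \<in> Ob C"
  shows "ntup C (map (nproj C A n X) [0..<n]) (nproj C A n X n) = Idn C (npow C A n X)"
proof -
  have "map (\<lambda>i. Idn C (npow C A n X) \<cdot> nproj C A n X i) [0..<n] = map (nproj C A n X) [0..<n]"
    using assms by (intro map_cong) auto
  moreover have "Idn C (npow C A n X) \<cdot> nproj C A n X n = nproj C A n X n" using assms by simp
  moreover have "ntup C (map (\<lambda>i. Idn C (npow C A n X) \<cdot> nproj C A n X i) [0..<n])
      (Idn C (npow C A n X) \<cdot> nproj C A n X n) = Idn C (npow C A n X)"
    using assms by (intro ntup_nproj_eta) auto
  ultimately show ?thesis by (simp only:)
qed

text \<open>The domain \<open>e\<close> of a tuple is contained in the domain of each entry, so
  restricting all entries to \<open>e\<close> keeps the tuple. This passes from arbitrary arguments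
  to arguments with a common domain.\<close>

lemma ntup_restrict:
  assumes "\<forall>z\<in>set zs. z \<in> Hom C Z A" "x \<in> Hom C Z X" "e = Rst C (ntup C zs x)"
  shows "ntup C (map (\<lambda>z. e \<cdot> z) zs) (e \<cdot> x) = ntup C zs x"
    "\<forall>z\<in>set zs. e \<cdot> Rst C z = e" "e \<cdot> Rst C x = e" "e \<in> El Z e Z"
proof -
  have H: "ntup C zs x \<in> Hom C Z (npow C A (length zs) X)"
    using assms by (intro ntup_Hom) auto
  show "e \<in> El Z e Z" using H assms by simp
  show "ntup C (map (\<lambda>z. e \<cdot> z) zs) (e \<cdot> x) = ntup C zs x"
    using H assms by (subst cmp_ntup[symmetric, where Z=Z and A=A and X=X]) auto
  have "(\<forall>z\<in>set zs. Rst C (ntup C zs x) \<cdot> Rst C z = Rst C (ntup C zs x)) \<and>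
    Rst C (ntup C zs x) \<cdot> Rst C x = Rst C (ntup C zs x)"
    using assms(1,2)
  proof (induction zs)
    case (Cons w zs)
    have H: "ntup C zs x \<in> Hom C Z (npow C A (length zs) X)"
      using Cons by (intro ntup_Hom) auto
    have "(Rst C w \<cdot> Rst C (ntup C zs x)) \<cdot> Rst C w = Rst C w \<cdot> Rst C (ntup C zs x)"
      using H Cons by (simp add: Rst_commute)
    then show ?case using H Cons by auto
  qed auto
  then show "\<forall>z\<in>set zs. e \<cdot> Rst C z = e" "e \<cdot> Rst C x = e" using assms(3) by auto
qed

text \<open>Stated for any \<open>h\<close> whose restriction has the form required of a component
  of a Faa map, so that it serves both the iterated derivatives \<open>F f n\<close> and the
  components of a given coalgebra.\<close>

lemma ntup_cmp_simps:
  assumes h: "h \<in> Ar C" "Dom C h = npow C A n X" "Rst C h = Rst C (nproj C A n X n \<cdot> f)" "f \<in> Ar C" "Dom C f = X"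
    and el: "\<forall>z\<in>set zs. z \<in> El Z e A" "x \<in> El Z e X" "length zs = n"
  shows "ntup C zs x \<cdot> h \<in> Ar C" "Dom C (ntup C zs x \<cdot> h) = Z"
    "Cod C (ntup C zs x \<cdot> h) = Cod C h" "A \<in> Ob C \<Longrightarrow> Rst C (ntup C zs x \<cdot> h) = Rst C (x \<cdot> f)"
proof -
  have t: "ntup C zs x \<in> El Z e (npow C A n X)" using el by (intro ntup_El)
  show "ntup C zs x \<cdot> h \<in> Ar C" "Dom C (ntup C zs x \<cdot> h) = Z" "Cod C (ntup C zs x \<cdot> h) = Cod C h"
    using t h by auto
  assume A: "A \<in> Ob C"
  have X: "X \<in> Ob C" using h by auto
  have "Rst C (ntup C zs x \<cdot> h) = Rst C (ntup C zs x \<cdot> (nproj C A n X n \<cdot> f))"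
    using h t A X by (intro Rst_cmp_eq) auto
  also have "ntup C zs x \<cdot> (nproj C A n X n \<cdot> f) = (ntup C zs x \<cdot> nproj C A n X n) \<cdot> f"
    using h t A X by simp
  also have "ntup C zs x \<cdot> nproj C A n X n = x" using ntup_nproj[OF el order_refl A] by simp
  finally show "Rst C (ntup C zs x \<cdot> h) = Rst C (x \<cdot> f)" .
qed

section \<open>Sums of maps\<close>

abbreviation tcm :: "('o, 'm) imonoid \<Rightarrow> bool" where "tcm \<equiv> total_comm_monoid C"

lemma tcm_simps [simp]:
  assumes "tcm M"
  shows "Crr M \<in> Ob C" "Add M \<in> Ar C" "Dom C (Add M) = Crr M \<boxtimes> Crr M" "Cod C (Add M) = Crr M"
    "Rst C (Add M) = Idn C (Crr M \<boxtimes> Crr M)"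
    "Zro M \<in> Ar C" "Dom C (Zro M) = One C" "Cod C (Zro M) = Crr M" "Rst C (Zro M) = Idn C (One C)"
  using assms by (auto simp: total_comm_monoid_def total_map_def Let_def)

lemma addm_simps [simp]:
  assumes "tcm M" "f \<in> Ar C" "g \<in> Ar C" "Dom C f = Dom C g" "Cod C f = Crr M" "Cod C g = Crr M"
  shows "addm C M f g \<in> Ar C" "Dom C (addm C M f g) = Dom C f" "Cod C (addm C M f g) = Crr M"
    "Rst C (addm C M f g) = Rst C f \<cdot> Rst C g"
  using assms by (auto simp: addm_def)

lemma zerom_simps [simp]:
  assumes "tcm M" "Z \<in> Ob C"
  shows "zerom C M Z \<in> Ar C" "Dom C (zerom C M Z) = Z" "Cod C (zerom C M Z) = Crr M"
    "Rst C (zerom C M Z) = Idn C Z"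
  using assms by (auto simp: zerom_def)

lemma cmp_addm:
  assumes "tcm M" "f \<in> Ar C" "g \<in> Ar C" "Dom C f = Dom C g" "Cod C f = Crr M" "Cod C g = Crr M"
    "a \<in> Ar C" "Cod C a = Dom C g"
  shows "a \<cdot> addm C M f g = addm C M (a \<cdot> f) (a \<cdot> g)"
  using assms assoc[of a "\<langle>f, g\<rangle>" "Add M", symmetric] by (simp add: addm_def del: assoc)

text \<open>After the factorization through the terminal object only the domain of \<open>a\<close>
  survives, by \<open>to_One_eq\<close>.\<close>

lemma cmp_zerom:
  assumes "tcm M" "a \<in> Ar C" "Cod C a = Z"
  shows "a \<cdot> zerom C M Z = Rst C a \<cdot> zerom C M (Dom C a)"
proof -
  have [simp]: "Z \<in> Ob C" using assms by auto
  have "a \<cdot> Bang C Z = Rst C a \<cdot> Bang C (Dom C a)"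
    by (rule to_One_eq) (use assms in auto)
  then have "(a \<cdot> Bang C Z) \<cdot> Zro M = (Rst C a \<cdot> Bang C (Dom C a)) \<cdot> Zro M" by simp
  then show ?thesis using assms by (simp add: zerom_def)
qed

lemma total_zerom [simp]:
  assumes "tcm M" "a \<in> Ar C" "Cod C a = Z" "Rst C a = Idn C (Dom C a)"
  shows "a \<cdot> zerom C M Z = zerom C M (Dom C a)"
  using cmp_zerom[OF assms(1-3)] assms by simp

text \<open>The monoid laws are given at the universal pair or triple of projections. Precomposition
  with a tuple carries them to arbitrary maps, and the cross restrictions that appear are absorbed
  by pairing. Associativity is obtained in the same way.\<close>

lemma addm_commute:
  assumes "tcm M" "f \<in> Ar C" "g \<in> Ar C" "Dom C f = Dom C g" "Cod C f = Crr M" "Cod C g = Crr M"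
  shows "addm C M f g = addm C M g f"
proof -
  let ?A = "Crr M"
  have *: "addm C M (Pr0 C ?A ?A) (Pr1 C ?A ?A) = addm C M (Pr1 C ?A ?A) (Pr0 C ?A ?A)"
    using assms unfolding total_comm_monoid_def Let_def by blast
  have "\<langle>f, g\<rangle> \<cdot> addm C M (Pr0 C ?A ?A) (Pr1 C ?A ?A) = \<langle>f, g\<rangle> \<cdot> addm C M (Pr1 C ?A ?A) (Pr0 C ?A ?A)"
    by (simp only: *)
  then have "addm C M (Rst C g \<cdot> f) (Rst C f \<cdot> g) = addm C M (Rst C f \<cdot> g) (Rst C g \<cdot> f)"
    using assms by (simp add: cmp_addm Tup_Pr0' Tup_Pr1')
  moreover have "\<langle>Rst C g \<cdot> f, Rst C f \<cdot> g\<rangle> = \<langle>f, g\<rangle>" "\<langle>Rst C f \<cdot> g, Rst C g \<cdot> f\<rangle> = \<langle>g, f\<rangle>"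
    using assms by (simp_all add: Tup_Rst_left Tup_restrict(2) Tup_absorb del: cmp_Tup)
  ultimately show ?thesis by (simp add: addm_def)
qed

lemma addm_assoc:
  assumes M: "tcm M" and f: "f \<in> Ar C" "g \<in> Ar C" "h \<in> Ar C" "Dom C f = Dom C g" "Dom C h = Dom C g"
    "Cod C f = Crr M" "Cod C g = Crr M" "Cod C h = Crr M"
  shows "addm C M (addm C M f g) h = addm C M f (addm C M g h)"
proof -
  let ?A = "Crr M" let ?AA = "?A \<boxtimes> ?A"
  let ?a = "Pr0 C ?AA ?A \<cdot> Pr0 C ?A ?A" and ?b = "Pr0 C ?AA ?A \<cdot> Pr1 C ?A ?A" and ?c = "Pr1 C ?AA ?A"
  have *: "addm C M (addm C M ?a ?b) ?c = addm C M ?a (addm C M ?b ?c)"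
    using M unfolding total_comm_monoid_def Let_def by blast
  define k where "k = \<langle>\<langle>f, g\<rangle>, h\<rangle>"
  have k: "k \<in> Ar C" "Dom C k = Dom C g" "Cod C k = ?AA \<boxtimes> ?A" "Rst C k = Rst C f \<cdot> (Rst C g \<cdot> Rst C h)"
    using f by (simp_all add: k_def)
  have "k \<cdot> addm C M (addm C M ?a ?b) ?c = k \<cdot> addm C M ?a (addm C M ?b ?c)"
    by (simp only: *)
  moreover have "k \<cdot> Pr0 C ?AA ?A = Rst C h \<cdot> \<langle>f, g\<rangle>"
    using M f by (simp add: k_def Tup_Pr0' del: cmp_Tup)
  then have "(k \<cdot> Pr0 C ?AA ?A) \<cdot> Pr0 C ?A ?A = (Rst C h \<cdot> \<langle>f, g\<rangle>) \<cdot> Pr0 C ?A ?A"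
    "(k \<cdot> Pr0 C ?AA ?A) \<cdot> Pr1 C ?A ?A = (Rst C h \<cdot> \<langle>f, g\<rangle>) \<cdot> Pr1 C ?A ?A" by simp_all
  then have "k \<cdot> ?a = Rst C h \<cdot> (Rst C g \<cdot> f)" "k \<cdot> ?b = Rst C h \<cdot> (Rst C f \<cdot> g)"
    using M f k by (simp_all add: Tup_Pr0' Tup_Pr1' del: cmp_Tup)
  moreover have "Rst C k \<cdot> f = Rst C h \<cdot> (Rst C g \<cdot> f)"
    using f k by (simp add: Rst_left_commute[of f g] Rst_left_commute[of f h] Rst_left_commute[of g h])
  moreover have "Rst C k \<cdot> g = Rst C h \<cdot> (Rst C f \<cdot> g)"
    using f k by (simp add: Rst_left_commute[of f h] Rst_left_commute[of g h])
  moreover have "k \<cdot> ?c = Rst C k \<cdot> h"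
    using M f by (simp add: k_def Tup_Pr1' del: cmp_Tup)
  ultimately have "Rst C k \<cdot> addm C M (addm C M f g) h = Rst C k \<cdot> addm C M f (addm C M g h)"
    using M f k(1-3) by (simp add: cmp_addm)
  moreover have "Rst C k \<cdot> addm C M (addm C M f g) h = addm C M (addm C M f g) h"
     "Rst C k \<cdot> addm C M f (addm C M g h) = addm C M f (addm C M g h)"
    by (rule Rst_absorb_eq; use M f k(4) in simp)+
  ultimately show ?thesis by simp
qed

lemma addm_zero_left [simp]:
  assumes "tcm M" "f \<in> Ar C" "Dom C f = Z" "Cod C f = Crr M"
  shows "addm C M (zerom C M Z) f = f"
proof -
  have *: "addm C M (zerom C M (Crr M)) (Idn C (Crr M)) = Idn C (Crr M)"
    using assms unfolding total_comm_monoid_def Let_def by blast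
  have [simp]: "Z \<in> Ob C" using assms by auto
  have "f \<cdot> addm C M (zerom C M (Crr M)) (Idn C (Crr M)) = f"
    using assms by (simp only: *) simp
  then have "addm C M (Rst C f \<cdot> zerom C M Z) f = f"
    using assms cmp_zerom[of M f "Crr M"] by (simp add: cmp_addm)
  then show ?thesis using assms by (simp add: addm_def Tup_restrict)
qed

lemma addm_zero_right [simp]:
  assumes "tcm M" "f \<in> Ar C" "Dom C f = Z" "Cod C f = Crr M"
  shows "addm C M f (zerom C M Z) = f"
  using addm_commute[of M f "zerom C M Z"] assms by (metis addm_zero_left Dom_in zerom_simps)

text \<open>Pairing intersects domains anyway, so a zero defined exactly where \<open>f\<close> is
  defined is as neutral as the total one.\<close>

lemma addm_El_zero [simp]:
  assumes "tcm M" "f \<in> Ar C" "Dom C f = Z" "Cod C f = Crr M" "Rst C f = e"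
  shows "addm C M f (e \<cdot> zerom C M Z) = f" "addm C M (e \<cdot> zerom C M Z) f = f"
proof -
  have [simp]: "Z \<in> Ob C" using assms by auto
  have "addm C M f (Rst C f \<cdot> zerom C M Z) = f"
    using assms Tup_restrict(2)[of f "zerom C M Z"] addm_zero_right[of M f Z] by (simp add: addm_def)
  then show "addm C M f (e \<cdot> zerom C M Z) = f" using assms by simp
  have "addm C M (Rst C f \<cdot> zerom C M Z) f = f"
    using assms Tup_restrict(1)[of "zerom C M Z" f] addm_zero_left[of M f Z] by (simp add: addm_def)
  then show "addm C M (e \<cdot> zerom C M Z) f = f" using assms by simp
qed

lemma hom_monoid_simps [simp]:
  "carrier (hom_monoid C Z M) = Hom C Z (Crr M)"
  "x \<otimes>\<^bsub>hom_monoid C Z M\<^esub> y = addm C M x y"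
  "\<one>\<^bsub>hom_monoid C Z M\<^esub> = zerom C M Z"
  by (simp_all add: hom_monoid_def)

lemma hom_monoid_comm_monoid:
  assumes M: "tcm M" and Z: "Z \<in> Ob C"
  shows "comm_monoid (hom_monoid C Z M)"
proof (rule comm_monoidI)
  fix x y z assume "x \<in> carrier (hom_monoid C Z M)" "y \<in> carrier (hom_monoid C Z M)"
    "z \<in> carrier (hom_monoid C Z M)"
  then show "x \<otimes>\<^bsub>hom_monoid C Z M\<^esub> y \<otimes>\<^bsub>hom_monoid C Z M\<^esub> z =
    x \<otimes>\<^bsub>hom_monoid C Z M\<^esub> (y \<otimes>\<^bsub>hom_monoid C Z M\<^esub> z)"
    using M by (simp add: addm_assoc)
next
  fix x y assume "x \<in> carrier (hom_monoid C Z M)" "y \<in> carrier (hom_monoid C Z M)"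
  then show "x \<otimes>\<^bsub>hom_monoid C Z M\<^esub> y = y \<otimes>\<^bsub>hom_monoid C Z M\<^esub> x"
    using M addm_commute[of M x y] by simp
qed (use M Z in auto)

context
  fixes M Z assumes M [simp]: "tcm M" and Z [simp]: "Z \<in> Ob C"
begin

interpretation HM: comm_monoid "hom_monoid C Z M"
  by (rule hom_monoid_comm_monoid) simp_all

lemma hom_sum_Hom:
  assumes "\<And>i. i \<in> I \<Longrightarrow> h i \<in> Hom C Z (Crr M)"
  shows "hom_sum C Z M h I \<in> Hom C Z (Crr M)"
  using HM.finprod_closed[of h I] assms by (auto simp: hom_sum_def Pi_iff)

lemma hom_sum_empty [simp]: "hom_sum C Z M h {} = zerom C M Z"
  by (simp add: hom_sum_def)

lemma hom_sum_insert:
  assumes "finite I" "i \<notin> I" "\<And>j. j \<in> insert i I \<Longrightarrow> h j \<in> Hom C Z (Crr M)"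
  shows "hom_sum C Z M h (insert i I) = addm C M (h i) (hom_sum C Z M h I)"
  using HM.finprod_insert[of I i h] assms by (auto simp: hom_sum_def Pi_iff)

lemma hom_sum_singleton [simp]:
  assumes "h i \<in> Hom C Z (Crr M)"
  shows "hom_sum C Z M h {i} = h i"
  using hom_sum_insert[of "{}" i h] assms by simp

lemma hom_sum_cong:
  assumes "I = J" "\<And>i. i \<in> J \<Longrightarrow> g i \<in> Hom C Z (Crr M)" "\<And>i. i \<in> J \<Longrightarrow> h i = g i"
  shows "hom_sum C Z M h I = hom_sum C Z M g J"
  unfolding hom_sum_def using assms by (intro HM.finprod_cong') auto

lemma hom_sum_Un_disjoint:
  assumes "finite I" "finite J" "I \<inter> J = {}" "\<And>i. i \<in> I \<union> J \<Longrightarrow> h i \<in> Hom C Z (Crr M)"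
  shows "hom_sum C Z M h (I \<union> J) = addm C M (hom_sum C Z M h I) (hom_sum C Z M h J)"
  using HM.finprod_Un_disjoint[of I J h] assms by (auto simp: hom_sum_def Pi_iff)

lemma hom_sum_UN_disjoint:
  assumes "finite I" "\<And>i. i \<in> I \<Longrightarrow> finite (A i)"
    "\<And>i j. i \<in> I \<Longrightarrow> j \<in> I \<Longrightarrow> i \<noteq> j \<Longrightarrow> A i \<inter> A j = {}"
    "\<And>i x. i \<in> I \<Longrightarrow> x \<in> A i \<Longrightarrow> h x \<in> Hom C Z (Crr M)"
  shows "hom_sum C Z M h (\<Union>i\<in>I. A i) = hom_sum C Z M (\<lambda>i. hom_sum C Z M h (A i)) I"
  unfolding hom_sum_def
  using assms by (intro HM.finprod_UN_disjoint) (auto simp: pairwise_def disjnt_def)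

lemma hom_sum_reindex:
  assumes "inj_on k I" "\<And>i. i \<in> I \<Longrightarrow> h (k i) \<in> Hom C Z (Crr M)"
  shows "hom_sum C Z M h (k ` I) = hom_sum C Z M (\<lambda>i. h (k i)) I"
  unfolding hom_sum_def using assms by (intro HM.finprod_reindex) auto

end

text \<open>Nonempty index sets are essential for the intended \<open>T\<close>: precomposition and
  differentiation send the total zero, which is the empty sum, to a restricted zero.\<close>

lemma hom_sum_additive_image:
  assumes "tcm M" "tcm N" "Z \<in> Ob C" "W \<in> Ob C"
    and "finite I" "I \<noteq> {}" "\<And>i. i \<in> I \<Longrightarrow> h i \<in> Hom C Z (Crr M)"
    and T: "\<And>f. f \<in> Hom C Z (Crr M) \<Longrightarrow> T f \<in> Hom C W (Crr N)"
    and add: "\<And>f g. f \<in> Hom C Z (Crr M) \<Longrightarrow> g \<in> Hom C Z (Crr M) \<Longrightarrow> T (addm C M f g) = addm C N (T f) (T g)"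
  shows "T (hom_sum C Z M h I) = hom_sum C W N (\<lambda>i. T (h i)) I"
  using assms(5-7)
proof (induction I rule: finite_ne_induct)
  case (singleton i)
  have "T (h i) \<in> Hom C W (Crr N)" using singleton by (intro T) blast
  then show ?case using singleton assms(1-4) by simp
next
  case (insert i I)
  have s: "hom_sum C Z M h I \<in> Hom C Z (Crr M)" using insert assms by (intro hom_sum_Hom) auto
  have "hom_sum C Z M h (insert i I) = addm C M (h i) (hom_sum C Z M h I)"
    using insert assms by (intro hom_sum_insert) auto
  moreover have "hom_sum C W N (\<lambda>i. T (h i)) (insert i I) =
    addm C N (T (h i)) (hom_sum C W N (\<lambda>i. T (h i)) I)"
    using insert assms(1-4) T by (intro hom_sum_insert) blast+
  moreover have "h i \<in> Hom C Z (Crr M)" using insert by blast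
  ultimately show ?case using insert add s by simp
qed

lemma cmp_hom_sum:
  assumes "tcm M" "a \<in> Ar C" "Cod C a = Z"
    and "finite I" "I \<noteq> {}" "\<And>i. i \<in> I \<Longrightarrow> h i \<in> Hom C Z (Crr M)"
  shows "a \<cdot> hom_sum C Z M h I = hom_sum C (Dom C a) M (\<lambda>i. a \<cdot> h i) I"
  using assms by (intro hom_sum_additive_image) (auto simp: cmp_addm)

end

section \<open>Restricted zeros and product monoids\<close>

context crc
begin

text \<open>The neutral element among the maps with restriction \<open>e\<close>; the total zero
  lies among them only when \<open>e\<close> is an identity.\<close>

definition ze :: "'m \<Rightarrow> ('o, 'm) imonoid \<Rightarrow> 'm" where
  "ze e M = e \<cdot> zerom C M (Dom C e)"

lemma ze_simps [simp]:
  assumes "tcm M" "e \<in> Ar C" "Cod C e = Dom C e" "Rst C e = e"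
  shows "ze e M \<in> Ar C" "Dom C (ze e M) = Dom C e" "Cod C (ze e M) = Crr M" "Rst C (ze e M) = e"
  using assms by (simp_all add: ze_def)

lemma ze_Idn [simp]:
  assumes "tcm M" "Z \<in> Ob C"
  shows "ze (Idn C Z) M = zerom C M Z"
  using assms by (simp add: ze_def)

lemma Crr_prod [simp]: "Crr (prod_imonoid C M N) = Crr M \<boxtimes> Crr N"
  by (simp add: prod_imonoid_def Let_def)

lemma zerom_prod:
  assumes "tcm M" "tcm N" "Z \<in> Ob C"
  shows "zerom C (prod_imonoid C M N) Z = \<langle>zerom C M Z, zerom C N Z\<rangle>"
  using assms by (simp add: zerom_def prod_imonoid_def Let_def)

lemma ze_prod:
  assumes "tcm M" "tcm N" "e \<in> Ar C" "Cod C e = Dom C e"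
  shows "ze e (prod_imonoid C M N) = \<langle>ze e M, ze e N\<rangle>"
  using assms by (simp add: ze_def zerom_prod)

lemma addm_prod:
  assumes "tcm M" "tcm N" "a \<in> El Z e (Crr M)" "b \<in> El Z e (Crr N)" "c \<in> El Z e (Crr M)" "d \<in> El Z e (Crr N)"
  shows "addm C (prod_imonoid C M N) \<langle>a, b\<rangle> \<langle>c, d\<rangle> = \<langle>addm C M a c, addm C N b d\<rangle>"
proof -
  let ?P = "Crr M \<boxtimes> Crr N"
  have "\<langle>\<langle>a, b\<rangle>, \<langle>c, d\<rangle>\<rangle> \<cdot> addm C M (Pr0 C ?P ?P \<cdot> Pr0 C (Crr M) (Crr N)) (Pr1 C ?P ?P \<cdot> Pr0 C (Crr M) (Crr N))
     = addm C M a c"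
    using assms by (subst cmp_addm) auto
  moreover have "\<langle>\<langle>a, b\<rangle>, \<langle>c, d\<rangle>\<rangle> \<cdot> addm C N (Pr0 C ?P ?P \<cdot> Pr1 C (Crr M) (Crr N)) (Pr1 C ?P ?P \<cdot> Pr1 C (Crr M) (Crr N))
     = addm C N b d"
    using assms by (subst cmp_addm) auto
  moreover have "addm C (prod_imonoid C M N) \<langle>a, b\<rangle> \<langle>c, d\<rangle> = \<langle>\<langle>a, b\<rangle>, \<langle>c, d\<rangle>\<rangle> \<cdot>
      \<langle>addm C M (Pr0 C ?P ?P \<cdot> Pr0 C (Crr M) (Crr N)) (Pr1 C ?P ?P \<cdot> Pr0 C (Crr M) (Crr N)),
       addm C N (Pr0 C ?P ?P \<cdot> Pr1 C (Crr M) (Crr N)) (Pr1 C ?P ?P \<cdot> Pr1 C (Crr M) (Crr N))\<rangle>"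
    unfolding addm_def[of C "prod_imonoid C M N"] by (simp only: prod_imonoid_def Let_def imonoid.simps)
  ultimately show ?thesis using assms by simp
qed

lemma cross_Idn:
  assumes "A \<in> Ob C" "f \<in> Ar C" "Cod C f = Dom C f"
  shows "cross C (Idn C A) f = \<langle>Pr0 C A (Dom C f), Pr1 C A (Dom C f) \<cdot> f\<rangle>"
  using assms by (simp add: cross_def)

text \<open>[R.4] pulls the restriction in front of the projection. This is why the two forms given
  in [DR.8] and in [DR.9] agree.\<close>

lemma cross_Idn_Rst:
  assumes "A \<in> Ob C" "f \<in> Ar C" "Dom C f = X"
  shows "cross C (Idn C A) (Rst C f) = Rst C (Pr1 C A X \<cdot> f)"
    "cross C (Idn C A) (Rst C f) \<cdot> Pr0 C A X = Rst C (Pr1 C A X \<cdot> f) \<cdot> Pr0 C A X"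
proof -
  have [simp]: "X \<in> Ob C" using assms by auto
  have "Pr1 C A X \<cdot> Rst C f = Rst C (Pr1 C A X \<cdot> f) \<cdot> Pr1 C A X"
    using assms by (intro cmp_Rst) auto
  then show *: "cross C (Idn C A) (Rst C f) = Rst C (Pr1 C A X \<cdot> f)"
    using assms by (simp add: cross_Idn Tup_Rst_right del: cmp_Tup)
  show "cross C (Idn C A) (Rst C f) \<cdot> Pr0 C A X = Rst C (Pr1 C A X \<cdot> f) \<cdot> Pr0 C A X"
    by (simp only: *)
qed

end

section \<open>Derivatives along generalized elements\<close>

sublocale gen_diff_restriction_structure \<subseteq> crc C
  by unfold_locales

context gen_diff_restriction_structure
begin

abbreviation l :: "'o \<Rightarrow> 'o" where "l X \<equiv> Crr (L X)"

lemma L_tcm [simp]: "X \<in> Ob C \<Longrightarrow> tcm (L X)"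
  using L_monoid by auto

lemma L_l [simp]: "X \<in> Ob C \<Longrightarrow> L (l X) = L X" by (rule L_L)

lemma l_Prd [simp]: "\<lbrakk>X \<in> Ob C; Y \<in> Ob C\<rbrakk> \<Longrightarrow> l (X \<boxtimes> Y) = l X \<boxtimes> l Y"
  by (simp add: L_prod)

lemma l_One [simp]: "l (One C) = One C"
  by (simp add: L_one one_imonoid_def)

lemma l_npow [simp]: "\<lbrakk>A \<in> Ob C; X \<in> Ob C\<rbrakk> \<Longrightarrow> l (npow C A n X) = npow C (l A) n (l X)"
  by (induction n) auto

lemma ze_L_Prd:
  assumes "X \<in> Ob C" "Y \<in> Ob C" "e \<in> Ar C" "Cod C e = Dom C e"
  shows "ze e (L (X \<boxtimes> Y)) = \<langle>ze e (L X), ze e (L Y)\<rangle>"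
  using assms by (simp add: L_prod ze_prod)

lemma ntup_ze:
  assumes "X \<in> Ob C" "Y \<in> Ob C" "e \<in> Ar C" "Cod C e = Dom C e"
  shows "ntup C (replicate n (ze e (L X))) (ze e (L Y)) = ze e (L (npow C X n Y))"
  using assms by (induction n) (auto simp: ze_L_Prd)

lemma D_simps [simp]:
  assumes "f \<in> Ar C"
  shows "D f \<in> Ar C" "Dom C (D f) = l (Dom C f) \<boxtimes> Dom C f" "Cod C (D f) = l (Cod C f)"
    "Rst C (D f) = Rst C (Pr1 C (l (Dom C f)) (Dom C f) \<cdot> f)"
  using D_Hom[of f "Dom C f" "Cod C f"] DR9[of f "Dom C f" "Cod C f"] assms by auto

text \<open>The derivative of \<open>f\<close> at the point \<open>u\<close> in the direction \<open>u'\<close>.\<close>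

definition dv :: "'m \<Rightarrow> 'm \<Rightarrow> 'm \<Rightarrow> 'm" where
  "dv u' u f = \<langle>u', u\<rangle> \<cdot> D f"

lemma dv_simps [simp]:
  assumes "f \<in> Ar C" "u' \<in> Ar C" "u \<in> Ar C" "Dom C u' = Dom C u" "Cod C u' = l (Dom C f)"
    "Cod C u = Dom C f" "Rst C u' = Rst C u"
  shows "dv u' u f \<in> Ar C" "Dom C (dv u' u f) = Dom C u" "Cod C (dv u' u f) = l (Cod C f)"
    "Rst C (dv u' u f) = Rst C (u \<cdot> f)"
proof -
  show "dv u' u f \<in> Ar C" "Dom C (dv u' u f) = Dom C u" "Cod C (dv u' u f) = l (Cod C f)"
    using assms by (simp_all add: dv_def)
  have "Rst C (dv u' u f) = Rst C (\<langle>u', u\<rangle> \<cdot> (Pr1 C (l (Dom C f)) (Dom C f) \<cdot> f))"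
    unfolding dv_def using assms by (intro Rst_cmp_eq) simp_all
  then show "Rst C (dv u' u f) = Rst C (u \<cdot> f)" using assms by simp
qed

context
  fixes u' u assumes u [simp]: "u' \<in> Ar C" "u \<in> Ar C" "Dom C u' = Dom C u" "Rst C u' = Rst C u"
begin

lemma dv_Cmp:
  assumes "f \<in> Ar C" "g \<in> Ar C" "Cod C f = Dom C g" "Cod C u' = l (Dom C f)" "Cod C u = Dom C f"
  shows "dv u' u (f \<cdot> g) = dv (dv u' u f) (u \<cdot> f) g"
proof -
  have "D (f \<cdot> g) = \<langle>D f, Pr1 C (l (Dom C f)) (Dom C f) \<cdot> f\<rangle> \<cdot> D g"
    using assms by (intro DR5[of f "Dom C f" "Dom C g" g "Cod C g"]) auto
  then have "dv u' u (f \<cdot> g) = (\<langle>u', u\<rangle> \<cdot> \<langle>D f, Pr1 C (l (Dom C f)) (Dom C f) \<cdot> f\<rangle>) \<cdot> D g"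
    unfolding dv_def using assms by (simp del: cmp_Tup)
  also have "\<langle>u', u\<rangle> \<cdot> \<langle>D f, Pr1 C (l (Dom C f)) (Dom C f) \<cdot> f\<rangle> = \<langle>dv u' u f, u \<cdot> f\<rangle>"
    using assms by (simp add: dv_def)
  finally show ?thesis by (simp add: dv_def)
qed

lemma dv_Tup [simp]:
  assumes "f \<in> Ar C" "g \<in> Ar C" "Dom C f = Dom C g" "Cod C u' = l (Dom C f)" "Cod C u = Dom C f"
  shows "dv u' u \<langle>f, g\<rangle> = \<langle>dv u' u f, dv u' u g\<rangle>"
proof -
  have "D \<langle>f, g\<rangle> = \<langle>D f, D g\<rangle>"
    using assms by (intro DR4[of f "Dom C f" "Cod C f" g "Cod C g"]) auto
  then show ?thesis using assms by (simp add: dv_def)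
qed

lemma dv_Pr0 [simp]:
  assumes "X \<in> Ob C" "Y \<in> Ob C" "Cod C u' = l X \<boxtimes> l Y" "Cod C u = X \<boxtimes> Y"
  shows "dv u' u (Pr0 C X Y) = u' \<cdot> Pr0 C (l X) (l Y)"
  using assms by (simp add: dv_def DR3_0)

lemma dv_Pr1 [simp]:
  assumes "X \<in> Ob C" "Y \<in> Ob C" "Cod C u' = l X \<boxtimes> l Y" "Cod C u = X \<boxtimes> Y"
  shows "dv u' u (Pr1 C X Y) = u' \<cdot> Pr1 C (l X) (l Y)"
  using assms by (simp add: dv_def DR3_1)

lemma dv_Rst:
  assumes "f \<in> Ar C" "Cod C u' = l (Dom C f)" "Cod C u = Dom C f"
  shows "dv u' u (Rst C f) = Rst C (u \<cdot> f) \<cdot> u'"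
proof -
  let ?X = "Dom C f"
  have "D (Rst C f) = Rst C (Pr1 C (l ?X) ?X \<cdot> f) \<cdot> Pr0 C (l ?X) ?X"
    using DR8[of f ?X "Cod C f"] assms by auto
  then have "dv u' u (Rst C f) = (\<langle>u', u\<rangle> \<cdot> Rst C (Pr1 C (l ?X) ?X \<cdot> f)) \<cdot> Pr0 C (l ?X) ?X"
    using assms by (simp add: dv_def)
  also have "\<langle>u', u\<rangle> \<cdot> Rst C (Pr1 C (l ?X) ?X \<cdot> f) = Rst C (u \<cdot> f) \<cdot> \<langle>u', u\<rangle>"
    using assms by (subst cmp_Rst) auto
  finally show ?thesis using assms by (simp del: cmp_Tup)
qed

lemma dv_Idn [simp]:
  assumes "X \<in> Ob C" "Cod C u' = l X" "Cod C u = X"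
  shows "dv u' u (Idn C X) = u'"
  using dv_Rst[of "Idn C X"] assms by (metis Rst_Idn Idn_simps Idn_right u Rst_absorb)

lemma dv_nproj [simp]:
  assumes "A \<in> Ob C" "X \<in> Ob C" "i \<le> n" "Cod C u' = npow C (l A) n (l X)" "Cod C u = npow C A n X"
  shows "dv u' u (nproj C A n X i) = u' \<cdot> nproj C (l A) n (l X) i"
  using assms u
proof (induction n arbitrary: i u u')
  case (Suc n)
  show ?case
  proof (cases i)
    case (Suc j)
    then have "dv (u' \<cdot> Pr1 C (l A) (npow C (l A) n (l X))) (u \<cdot> Pr1 C A (npow C A n X)) (nproj C A n X j)
      = (u' \<cdot> Pr1 C (l A) (npow C (l A) n (l X))) \<cdot> nproj C (l A) n (l X) j"
      using Suc.prems by (intro Suc.IH) auto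
    \<comment> \<open>The chain rule leads to another point and direction, so the rules are used in
      their exported form, in which both are variables.\<close>
    moreover have "dv u' u (Pr1 C A (npow C A n X) \<cdot> nproj C A n X j) =
        dv (u' \<cdot> Pr1 C (l A) (npow C (l A) n (l X))) (u \<cdot> Pr1 C A (npow C A n X)) (nproj C A n X j)"
      using Suc Suc.prems by (subst gen_diff_restriction_structure.dv_Cmp[OF gen_diff_restriction_structure_axioms])
        (auto simp: gen_diff_restriction_structure.dv_Pr1[OF gen_diff_restriction_structure_axioms])
    ultimately show ?thesis using Suc Suc.prems by simp
  next
    case 0 then show ?thesis using Suc.prems
      by (simp add: gen_diff_restriction_structure.dv_Pr0[OF gen_diff_restriction_structure_axioms])
  qed
qed (simp add: gen_diff_restriction_structure.dv_Idn[OF gen_diff_restriction_structure_axioms])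

lemma dv_zerom [simp]:
  assumes "Z \<in> Ob C" "Y \<in> Ob C" "Cod C u' = l Z" "Cod C u = Z"
  shows "dv u' u (zerom C (L Y) Z) = ze (Rst C u) (L Y)"
proof -
  have *: "dv u' u (Bang C Z) = Rst C u \<cdot> Bang C (Dom C u)"
    by (rule to_One_eq) (use assms in auto)
  have "u \<cdot> Bang C Z = Rst C u \<cdot> Bang C (Dom C u)"
    by (rule to_One_eq) (use assms in auto)
  then have "dv u' u (zerom C (L Y) Z) =
      \<langle>Rst C u \<cdot> Bang C (Dom C u), Rst C u \<cdot> Bang C (Dom C u)\<rangle> \<cdot> D (Zro (L Y))"
    unfolding zerom_def using assms by (subst dv_Cmp) (auto simp: * dv_def[of _ _ "Zro (L Y)"])
  then show ?thesis
    using assms by (simp add: DR1_zero ze_def zerom_def)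
qed

text \<open>By [DR.1] the derivative of \<open>Add\<close> is \<open>Add\<close> applied to the
  direction, whatever the base point.\<close>

lemma dv_addm:
  assumes "f \<in> Ar C" "g \<in> Ar C" "Dom C f = Dom C g" "Cod C f = l Y" "Cod C g = l Y" "Y \<in> Ob C"
    "Cod C u' = l (Dom C f)" "Cod C u = Dom C f"
  shows "dv u' u (addm C (L Y) f g) = addm C (L Y) (dv u' u f) (dv u' u g)"
proof -
  have "dv u' u (addm C (L Y) f g) = \<langle>\<langle>dv u' u f, dv u' u g\<rangle>, \<langle>u \<cdot> f, u \<cdot> g\<rangle>\<rangle> \<cdot> D (Add (L Y))"
    unfolding addm_def using assms by (subst dv_Cmp) (auto simp: dv_def[of _ _ "Add (L Y)"])
  then show ?thesis using assms by (simp add: DR1_add addm_def)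
qed

lemma dv_ntup:
  assumes "\<forall>z\<in>set zs. z \<in> Hom C Z A" "x \<in> Hom C Z X" "Cod C u' = l Z" "Cod C u = Z"
  shows "dv u' u (ntup C zs x) = ntup C (map (dv u' u) zs) (dv u' u x)"
  using assms
proof (induction zs)
  case (Cons z zs)
  moreover have "ntup C zs x \<in> Hom C Z (npow C A (length zs) X)"
    using Cons by (intro ntup_Hom) auto
  ultimately show ?case by auto
qed auto

end

lemma dv_hom_sum:
  assumes u: "u' \<in> Ar C" "u \<in> Ar C" "Dom C u' = Dom C u" "Rst C u' = Rst C u" "Cod C u' = l Z" "Cod C u = Z"
    and Y: "Y \<in> Ob C" and I: "finite I" "I \<noteq> {}" "\<And>i. i \<in> I \<Longrightarrow> h i \<in> Hom C Z (l Y)"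
  shows "dv u' u (hom_sum C Z (L Y) h I) = hom_sum C (Dom C u) (L Y) (\<lambda>i. dv u' u (h i)) I"
proof (rule hom_sum_additive_image)
  show "Z \<in> Ob C" using u by auto
qed (use u Y I in \<open>auto simp: dv_addm\<close>)

lemma dv_add_dir:
  assumes "f \<in> Ar C" "Dom C f = X" "a \<in> El Z e (l X)" "b \<in> El Z e (l X)" "c \<in> El Z e X"
  shows "dv (addm C (L X) a b) c f = addm C (L (Cod C f)) (dv a c f) (dv b c f)"
  using DR2_add[of f X "Cod C f" a Z b c] assms by (simp add: dv_def)

lemma dv_ze_dir [simp]:
  assumes "f \<in> Ar C" "Dom C f = X" "c \<in> El Z e X"
  shows "dv (ze e (L X)) c f = ze (Rst C (c \<cdot> f)) (L (Cod C f))"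
proof -
  have [simp]: "X \<in> Ob C" "Z \<in> Ob C" using assms by auto
  have "ze e (L X) = Rst C c \<cdot> zerom C (L X) Z" using assms by (simp add: ze_def)
  then have "\<langle>ze e (L X), c\<rangle> = \<langle>zerom C (L X) Z, c\<rangle>"
    using Tup_restrict(1)[of "zerom C (L X) Z" c] assms by simp
  then show ?thesis
    using DR2_zero[of f X "Cod C f" c Z] assms by (simp add: dv_def ze_def)
qed

text \<open>[DR.6] for elements with a common domain: the factor \<open>Rst C c\<close> is absorbed,
  and pairing with \<open>a\<close> turns the total zero of the axiom into
  \<open>ze e (L X)\<close>.\<close>

lemma dv_D_const:
  assumes "f \<in> Ar C" "Dom C f = X" "a \<in> El Z e (l X)" "c \<in> El Z e (l X)" "d \<in> El Z e X"
  shows "dv \<langle>a, ze e (L X)\<rangle> \<langle>c, d\<rangle> (D f) = dv a d f"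
proof -
  have [simp]: "X \<in> Ob C" "Z \<in> Ob C" using assms by auto
  have "ze e (L X) = Rst C a \<cdot> zerom C (L X) Z" using assms by (simp add: ze_def)
  then have "\<langle>a, ze e (L X)\<rangle> = \<langle>a, zerom C (L X) Z\<rangle>"
    using Tup_restrict(2)[of a "zerom C (L X) Z"] assms by simp
  then show ?thesis
    using DR6[of f X "Cod C f" a Z c d] assms by (simp add: dv_def Rst_absorb_eq)
qed

lemma dv_D_swap:
  assumes "f \<in> Ar C" "Dom C f = X" "b \<in> El Z e (l X)" "c \<in> El Z e (l X)" "d \<in> El Z e X"
  shows "dv \<langle>ze e (L X), b\<rangle> \<langle>c, d\<rangle> (D f) = dv \<langle>ze e (L X), c\<rangle> \<langle>b, d\<rangle> (D f)"
proof -
  have [simp]: "X \<in> Ob C" "Z \<in> Ob C" using assms by auto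
  have "\<langle>ze e (L X), h\<rangle> = \<langle>zerom C (L X) Z, h\<rangle>" if "h \<in> El Z e (l X)" for h
    using Tup_restrict(1)[of "zerom C (L X) Z" h] assms that by (simp add: ze_def)
  then show ?thesis
    using DR7[of f X "Cod C f" b Z c d] assms by (simp add: dv_def)
qed

end

lemma ball_list_update: "\<lbrakk>\<forall>z\<in>set zs. P z; P v\<rbrakk> \<Longrightarrow> \<forall>z\<in>set (zs[i := v]). P z"
  by (auto dest!: set_update_subset_insert[THEN subsetD])

lemma replicate_update_same [simp]: "(replicate n z)[i := z] = replicate n z"
  by (cases "i < n") (simp_all add: list_update_same_conv list_update_beyond)

lemma (in crc) addm_ze [simp]:
  assumes "tcm M" "f \<in> Ar C" "Cod C f = Crr M" "Rst C f = e"
  shows "addm C M f (ze e M) = f" "addm C M (ze e M) f = f"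
proof -
  have "Dom C e = Dom C f" using assms by auto
  then show "addm C M f (ze e M) = f" "addm C M (ze e M) f = f"
    using assms by (simp_all add: ze_def)
qed

context gen_diff_restriction_structure
begin

text \<open>Holds because \<open>L\<close> sends products to product monoids. It is used to split a
  direction in a power into directions concentrated in single slots.\<close>

lemma addm_ntup:
  assumes "A \<in> Ob C" "B \<in> Ob C" "length zs = n" "length ws = n"
    "\<forall>z\<in>set zs. z \<in> El Z e (l A)" "\<forall>z\<in>set ws. z \<in> El Z e (l A)" "x \<in> El Z e (l B)" "y \<in> El Z e (l B)"
  shows "addm C (L (npow C A n B)) (ntup C zs x) (ntup C ws y) =
    ntup C (map2 (addm C (L A)) zs ws) (addm C (L B) x y)"
  using assms
proof (induction n arbitrary: zs ws)
  case (Suc n)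
  obtain z zs' w ws' where eq: "zs = z # zs'" "ws = w # ws'"
    using Suc.prems by (metis length_Suc_conv)
  have "ntup C zs' x \<in> El Z e (npow C (l A) n (l B))" "ntup C ws' y \<in> El Z e (npow C (l A) n (l B))"
    using Suc.prems eq by (intro ntup_El; auto)+
  then have "addm C (L (npow C A (Suc n) B)) (ntup C zs x) (ntup C ws y) =
     \<langle>addm C (L A) z w, addm C (L (npow C A n B)) (ntup C zs' x) (ntup C ws' y)\<rangle>"
    using Suc.prems eq by (simp add: L_prod addm_prod[where Z=Z and e=e])
  then show ?case using Suc eq by simp
qed auto

section \<open>Iterated partial derivatives\<close>

text \<open>\<open>F f n\<close> is $f_n$; the variable added by a further differentiation is put in front.\<close>

primrec F :: "'m \<Rightarrow> nat \<Rightarrow> 'm" where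
  "F f 0 = f"
| "F f (Suc n) =
    (let X = Dom C f; A = l X; P = npow C A n X
     in \<langle>ntup C (replicate n (zerom C (L X) (A \<boxtimes> P))) (Pr0 C A P), Pr1 C A P\<rangle> \<cdot> D (F f n))"

lemma F_simps [simp]:
  assumes "f \<in> Ar C" "Dom C f = X"
  shows "F f n \<in> Ar C" "Dom C (F f n) = npow C (l X) n X"
    "Cod C (F f n) = (if n = 0 then Cod C f else l (Cod C f))"
    "Rst C (F f n) = Rst C (nproj C (l X) n X n \<cdot> f)"
proof -
  have [simp]: "X \<in> Ob C" using assms by auto
  have "F f n \<in> Ar C \<and> Dom C (F f n) = npow C (l X) n X \<and>
    Cod C (F f n) = (if n = 0 then Cod C f else l (Cod C f)) \<and>
    Rst C (F f n) = Rst C (nproj C (l X) n X n \<cdot> f)"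
  proof (induction n)
    case (Suc n)
    let ?P = "npow C (l X) n X"
    let ?W = "l X \<boxtimes> ?P"
    have t: "ntup C (replicate n (zerom C (L X) ?W)) (Pr0 C (l X) ?P)
        \<in> El ?W (Idn C ?W) (npow C (l X) n (l X))"
      by (intro ntup_El) auto
    have F: "F f (Suc n) = dv (ntup C (replicate n (zerom C (L X) ?W)) (Pr0 C (l X) ?P)) (Pr1 C (l X) ?P) (F f n)"
      using assms by (simp add: dv_def Let_def)
    have "Rst C (Pr1 C (l X) ?P \<cdot> F f n) = Rst C (Pr1 C (l X) ?P \<cdot> (nproj C (l X) n X n \<cdot> f))"
      using Suc assms by (intro Rst_cmp_eq) auto
    then show ?case unfolding F using Suc assms t by auto
  qed (use assms in auto)
  then show "F f n \<in> Ar C" "Dom C (F f n) = npow C (l X) n X"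
    "Cod C (F f n) = (if n = 0 then Cod C f else l (Cod C f))"
    "Rst C (F f n) = Rst C (nproj C (l X) n X n \<cdot> f)" by auto
qed

declare F.simps(2) [simp del]

lemma ntup_F_simps [simp]:
  assumes "f \<in> Ar C" "\<forall>z\<in>set as. z \<in> El Z e (l (Dom C f))" "x \<in> El Z e (Dom C f)" "length as = n"
  shows "ntup C as x \<cdot> F f n \<in> Ar C" "Dom C (ntup C as x \<cdot> F f n) = Z"
    "Cod C (ntup C as x \<cdot> F f n) = (if n = 0 then Cod C f else l (Cod C f))"
    "Rst C (ntup C as x \<cdot> F f n) = Rst C (x \<cdot> f)"
  using ntup_cmp_simps[OF _ _ _ _ refl assms(2-4), of "F f n"] assms(1) by simp_all

text \<open>The recursion read at generalized elements: the new argument \<open>w\<close> is the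
  direction in the \<open>X\<close> slot, while the slots of the old arguments \<open>as\<close> get
  direction zero.\<close>

lemma ntup_F_Suc:
  assumes f: "f \<in> Ar C" "Dom C f = X" and el: "w \<in> El Z e (l X)" "\<forall>z\<in>set as. z \<in> El Z e (l X)" "x \<in> El Z e X"
    "length as = n"
  shows "ntup C (w # as) x \<cdot> F f (Suc n) = dv (ntup C (replicate n (ze e (L X))) w) (ntup C as x) (F f n)"
proof -
  have [simp]: "X \<in> Ob C" using f by auto
  let ?P = "npow C (l X) n X"
  let ?W = "l X \<boxtimes> ?P"
  let ?T = "ntup C as x"
  have T: "?T \<in> El Z e ?P" using el by (intro ntup_El) auto
  have t: "ntup C (replicate n (zerom C (L X) ?W)) (Pr0 C (l X) ?P)
        \<in> El ?W (Idn C ?W) (npow C (l X) n (l X))"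
      by (intro ntup_El) auto
  have "\<langle>w, ?T\<rangle> \<cdot> ntup C (replicate n (zerom C (L X) ?W)) (Pr0 C (l X) ?P)
    = ntup C (map ((\<cdot>) \<langle>w, ?T\<rangle>) (replicate n (zerom C (L X) ?W))) (\<langle>w, ?T\<rangle> \<cdot> Pr0 C (l X) ?P)"
    by (rule cmp_ntup) (use el T in auto)
  also have "\<dots> = ntup C (replicate n (ze e (L X))) w"
    using el T cmp_zerom[of "L X" "\<langle>w, ?T\<rangle>" ?W] by (simp add: ze_def)
  finally have "(\<langle>w, ?T\<rangle> \<cdot> \<langle>ntup C (replicate n (zerom C (L X) ?W)) (Pr0 C (l X) ?P), Pr1 C (l X) ?P\<rangle>) \<cdot> D (F f n)
      = dv (ntup C (replicate n (ze e (L X))) w) (ntup C as x) (F f n)"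
    using el T t by (simp add: dv_def)
  then show ?thesis using f el T t by (simp add: F.simps(2) Let_def del: cmp_Tup)
qed

text \<open>The inner map in the definition of \<open>F f (Suc n)\<close> consists of projections
  and zeros and is easily differentiated. What remains is a derivative of \<open>D (F f n)\<close>,
  the form to which [DR.6] and [DR.7] apply.\<close>

lemma dv_F_Suc:
  assumes f: "f \<in> Ar C" "Dom C f = X" and el: "v \<in> El Z e (l X)" "V \<in> El Z e (npow C (l X) n (l X))"
    "a \<in> El Z e (l X)" "T \<in> El Z e (npow C (l X) n X)"
  shows "dv \<langle>v, V\<rangle> \<langle>a, T\<rangle> (F f (Suc n)) =
    dv \<langle>ntup C (replicate n (ze e (L X))) v, V\<rangle> \<langle>ntup C (replicate n (ze e (L X))) a, T\<rangle> (D (F f n))"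
proof -
  have [simp]: "X \<in> Ob C" using f by auto
  let ?P = "npow C (l X) n X"
  let ?W = "l X \<boxtimes> ?P"
  let ?z = "replicate n (zerom C (L X) ?W)"
  have t: "ntup C ?z (Pr0 C (l X) ?P) \<in> El ?W (Idn C ?W) (npow C (l X) n (l X))"
    by (intro ntup_El) auto
  have "dv \<langle>v, V\<rangle> \<langle>a, T\<rangle> (ntup C ?z (Pr0 C (l X) ?P)) =
     ntup C (map (dv \<langle>v, V\<rangle> \<langle>a, T\<rangle>) ?z) (dv \<langle>v, V\<rangle> \<langle>a, T\<rangle> (Pr0 C (l X) ?P))"
    by (rule dv_ntup) (use el in auto)
  then have 1: "dv \<langle>v, V\<rangle> \<langle>a, T\<rangle> (ntup C ?z (Pr0 C (l X) ?P)) = ntup C (replicate n (ze e (L X))) v"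
    using el by simp
  have "\<langle>a, T\<rangle> \<cdot> ntup C ?z (Pr0 C (l X) ?P) = ntup C (map ((\<cdot>) \<langle>a, T\<rangle>) ?z) (\<langle>a, T\<rangle> \<cdot> Pr0 C (l X) ?P)"
    by (rule cmp_ntup) (use el in auto)
  then have 2: "\<langle>a, T\<rangle> \<cdot> ntup C ?z (Pr0 C (l X) ?P) = ntup C (replicate n (ze e (L X))) a"
    using el cmp_zerom[of "L X" "\<langle>a, T\<rangle>" ?W] by (simp add: ze_def)
  have "F f (Suc n) = \<langle>ntup C ?z (Pr0 C (l X) ?P), Pr1 C (l X) ?P\<rangle> \<cdot> D (F f n)"
    using f by (simp add: F.simps(2) Let_def)
  moreover have "dv \<langle>v, V\<rangle> \<langle>a, T\<rangle> (\<langle>ntup C ?z (Pr0 C (l X) ?P), Pr1 C (l X) ?P\<rangle> \<cdot> D (F f n)) =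
     dv (dv \<langle>v, V\<rangle> \<langle>a, T\<rangle> \<langle>ntup C ?z (Pr0 C (l X) ?P), Pr1 C (l X) ?P\<rangle>)
       (\<langle>a, T\<rangle> \<cdot> \<langle>ntup C ?z (Pr0 C (l X) ?P), Pr1 C (l X) ?P\<rangle>) (D (F f n))"
    by (rule dv_Cmp) (use el f t in auto)
  ultimately show ?thesis using el f t 1 2 by simp
qed

text \<open>
  In the induction step the slot \<open>i = 0\<close> is [DR.6]; for \<open>i > 0\<close>, [DR.7] exchanges the two directions, and
  the claim becomes the derivative of the induction hypothesis, taken at the projections.
\<close>

lemma dv_F_single:
  assumes f: "f \<in> Ar C" "Dom C f = X"
    and el: "v \<in> El Z e (l X)" "\<forall>z\<in>set as. z \<in> El Z e (l X)" "x \<in> El Z e X" "length as = n" "i < n"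
  shows "dv (ntup C ((replicate n (ze e (L X)))[i := v]) (ze e (L X))) (ntup C as x) (F f n) =
    ntup C (as[i := v]) x \<cdot> F f n"
  using el
proof (induction n arbitrary: Z e v as x i)
  case (Suc n)
  have X [simp]: "X \<in> Ob C" using f by auto
  let ?z = "ze e (L X)" let ?P = "npow C (l X) n X" let ?PA = "npow C (l X) n (l X)"
  obtain a bs where as: "as = a # bs" using Suc.prems by (cases as) auto
  let ?T = "ntup C bs x"
  have z: "?z \<in> El Z e (l X)" using Suc.prems by auto
  have T: "?T \<in> El Z e ?P" using Suc.prems as by (intro ntup_El) auto
  have \<iota>: "ntup C (replicate n ?z) u \<in> El Z e ?PA" if "u \<in> El Z e (l X)" for u
    using z that by (intro ntup_El) auto
  have zz: "ntup C (replicate n ?z) ?z = ze e (L ?P)"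
    using Suc.prems ntup_ze[of "l X" X e n] by simp
  show ?case
  proof (cases i)
    case 0
    have "dv \<langle>v, ze e (L ?P)\<rangle> \<langle>a, ?T\<rangle> (F f (Suc n)) =
       dv \<langle>ntup C (replicate n ?z) v, ze e (L ?P)\<rangle> \<langle>ntup C (replicate n ?z) a, ?T\<rangle> (D (F f n))"
      using Suc.prems as T by (intro dv_F_Suc f) auto
    also have "\<dots> = dv (ntup C (replicate n ?z) v) ?T (F f n)"
      using Suc.prems as T \<iota>[of v] \<iota>[of a] f by (intro dv_D_const) auto
    also have "\<dots> = ntup C (v # bs) x \<cdot> F f (Suc n)"
      using Suc.prems as by (intro ntup_F_Suc[symmetric] f) auto
    finally show ?thesis using 0 as zz by simp
  next
    case i: (Suc j)
    let ?V = "ntup C ((replicate n ?z)[j := v]) ?z"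
    have V: "?V \<in> El Z e ?PA"
      using z Suc.prems by (intro ntup_El ball_list_update) auto
    let ?W = "l X \<boxtimes> ?P"
    let ?p = "\<lambda>i. Pr1 C (l X) ?P \<cdot> nproj C (l X) n X i"
    let ?\<zeta> = "zerom C (L X) ?W"
    \<comment> \<open>The induction hypothesis at the universal element of \<open>?W\<close>.
      \<open>\<Lambda>\<close> is the direction with the new variable in slot \<open>j\<close> and
      zeros elsewhere; \<open>\<psi>\<close> puts the new variable in place of the
      \<open>j\<close>-th argument.\<close>
    define \<Lambda> where "\<Lambda> = ntup C ((replicate n ?\<zeta>)[j := Pr0 C (l X) ?P]) ?\<zeta>"
    define \<psi> where "\<psi> = ntup C ((map ?p [0..<n])[j := Pr0 C (l X) ?P]) (?p n)"
    have pe: "ntup C (map ?p [0..<n]) (?p n) = Pr1 C (l X) ?P"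
      by (rule ntup_nproj_eta) auto
    have \<Lambda>: "\<Lambda> \<in> El ?W (Idn C ?W) ?PA"
      unfolding \<Lambda>_def by (intro ntup_El ball_list_update) auto
    have \<psi>: "\<psi> \<in> El ?W (Idn C ?W) ?P"
      unfolding \<psi>_def by (intro ntup_El ball_list_update) auto
    have IH: "\<langle>\<Lambda>, Pr1 C (l X) ?P\<rangle> \<cdot> D (F f n) = \<psi> \<cdot> F f n"
      using Suc.IH[of "Pr0 C (l X) ?P" ?W "Idn C ?W" "map ?p [0..<n]" "?p n" j] Suc.prems i
      by (simp add: \<Lambda>_def \<psi>_def pe dv_def)
    \<comment> \<open>At the point \<open>?u\<close> in the direction \<open>?u'\<close> the new
      variable is frozen at \<open>v\<close> and only the base point moves, along \<open>a\<close>.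
      Hence \<open>\<Lambda>\<close> has derivative zero, and \<open>\<psi>\<close> moves in its
      last slot only.\<close>
    let ?u' = "\<langle>?z, ntup C (replicate n ?z) a\<rangle>" and ?u = "\<langle>v, ?T\<rangle>"
    have u: "?u' \<in> El Z e (l X \<boxtimes> ?PA)" "?u \<in> El Z e ?W"
      using Suc.prems as T z \<iota>[of a] by auto
    have "dv ?u' ?u \<Lambda> = ntup C (map (dv ?u' ?u) ((replicate n ?\<zeta>)[j := Pr0 C (l X) ?P])) (dv ?u' ?u ?\<zeta>)"
      unfolding \<Lambda>_def using u
      by (intro dv_ntup[where Z="?W" and A="l X" and X="l X"] ball_list_update) auto
    also have "\<dots> = ntup C (replicate n ?z) ?z"
      using u Suc.prems as T z \<iota>[of a] by (simp add: map_update)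
    finally have d\<Lambda>: "dv ?u' ?u \<Lambda> = ze e (L ?P)" using zz by simp
    have "?u \<cdot> \<Lambda> = ntup C (map ((\<cdot>) ?u) ((replicate n ?\<zeta>)[j := Pr0 C (l X) ?P])) (?u \<cdot> ?\<zeta>)"
      unfolding \<Lambda>_def using u
      by (intro cmp_ntup[where Z="?W" and A="l X" and X="l X"] ball_list_update) auto
    then have c\<Lambda>: "?u \<cdot> \<Lambda> = ?V"
      using u Suc.prems as T cmp_zerom[of "L X" ?u ?W] by (simp add: map_update ze_def)
    have "dv ?u' ?u \<psi> = ntup C (map (dv ?u' ?u) ((map ?p [0..<n])[j := Pr0 C (l X) ?P])) (dv ?u' ?u (?p n))"
      unfolding \<psi>_def using u
      by (intro dv_ntup[where Z="?W" and A="l X" and X="X"] ball_list_update) auto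
    moreover have dp: "dv ?u' ?u (?p k) = (if k < n then ?z else a)" if "k \<le> n" for k
    proof -
      have "dv ?u' ?u (?p k) = ntup C (replicate n ?z) a \<cdot> nproj C (l X) n (l X) k"
        using u Suc.prems as T z \<iota>[of a] that by (subst dv_Cmp) auto
      then show ?thesis
        using Suc.prems as z that ntup_nproj[of "replicate n ?z" Z e "l X" a "l X" n k] by simp
    qed
    moreover have "map (dv ?u' ?u) ((map ?p [0..<n])[j := Pr0 C (l X) ?P]) = replicate n ?z"
    proof -
      have "dv ?u' ?u (Pr0 C (l X) ?P) = ?z"
        using u Suc.prems as T z \<iota>[of a] by simp
      moreover have "j < n" using Suc.prems i by simp
      ultimately show ?thesis using dp by (intro nth_equalityI) (auto simp: nth_list_update)
    qed
    ultimately have d\<psi>: "dv ?u' ?u \<psi> = ntup C (replicate n ?z) a" by simp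
    have "?u \<cdot> \<psi> = ntup C (map ((\<cdot>) ?u) ((map ?p [0..<n])[j := Pr0 C (l X) ?P])) (?u \<cdot> ?p n)"
      unfolding \<psi>_def using u
      by (intro cmp_ntup[where Z="?W" and A="l X" and X="X"] ball_list_update) auto
    moreover have cp: "?u \<cdot> ?p k = (if k < n then bs ! k else x)" if "k \<le> n" for k
      using Suc.prems as that T ntup_nproj[of bs Z e "l X" x X n k] by simp
    moreover have "map ((\<cdot>) ?u) ((map ?p [0..<n])[j := Pr0 C (l X) ?P]) = bs[j := v]"
    proof -
      have "?u \<cdot> Pr0 C (l X) ?P = v" "length bs = n" "j < n"
        using Suc.prems as T i by auto
      with cp show ?thesis by (intro nth_equalityI) (auto simp: nth_list_update)
    qed
    ultimately have c\<psi>: "?u \<cdot> \<psi> = ntup C (bs[j := v]) x" by simp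
    have "dv \<langle>?z, ?V\<rangle> \<langle>a, ?T\<rangle> (F f (Suc n)) =
       dv \<langle>ntup C (replicate n ?z) ?z, ?V\<rangle> \<langle>ntup C (replicate n ?z) a, ?T\<rangle> (D (F f n))"
      using Suc.prems as T z V by (intro dv_F_Suc[OF f]) auto
    also have "\<dots> = dv \<langle>ze e (L ?P), ?V\<rangle> \<langle>ntup C (replicate n ?z) a, ?T\<rangle> (D (F f n))"
      by (simp only: zz)
    \<comment> \<open>[DR.7] trades the two roles: \<open>?V\<close> becomes an argument of
      \<open>D (F f n)\<close> and the tuple of \<open>a\<close> a direction, so that what gets
      differentiated is the left side of \<open>IH\<close>.\<close>
    also have "\<dots> = dv \<langle>ze e (L ?P), ntup C (replicate n ?z) a\<rangle> \<langle>?V, ?T\<rangle> (D (F f n))"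
      using Suc.prems as T z V \<iota>[of a] f by (intro dv_D_swap) auto
    also have "\<dots> = dv ?u' ?u (\<langle>\<Lambda>, Pr1 C (l X) ?P\<rangle> \<cdot> D (F f n))"
      using u Suc.prems as T z \<iota>[of a] \<Lambda> f by (subst dv_Cmp) (auto simp: d\<Lambda> c\<Lambda>)
    also have "\<dots> = dv ?u' ?u (\<psi> \<cdot> F f n)" by (simp only: IH)
    also have "\<dots> = dv (ntup C (replicate n ?z) a) (ntup C (bs[j := v]) x) (F f n)"
      using u Suc.prems as T z \<iota>[of a] \<psi> f by (subst dv_Cmp) (auto simp: d\<psi> c\<psi>)
    also have "\<dots> = ntup C (a # bs[j := v]) x \<cdot> F f (Suc n)"
      using Suc.prems as by (intro ntup_F_Suc[symmetric] f ball_list_update) auto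
    finally show ?thesis using i as by simp
  qed
qed auto

text \<open>By \<open>dv_F_single\<close> a substitution in slot \<open>i\<close> is a derivative in
  a direction concentrated in that slot, and derivatives are additive in the direction by
  \<open>dv_add_dir\<close>.\<close>

lemma ntup_F_add:
  assumes f: "f \<in> Ar C" "Dom C f = X"
    and el: "a \<in> El Z e (l X)" "b \<in> El Z e (l X)" "\<forall>z\<in>set as. z \<in> El Z e (l X)" "x \<in> El Z e X"
      "length as = n" "i < n"
  shows "ntup C (as[i := addm C (L X) a b]) x \<cdot> F f n =
    addm C (L (Cod C f)) (ntup C (as[i := a]) x \<cdot> F f n) (ntup C (as[i := b]) x \<cdot> F f n)"
proof -
  have X [simp]: "X \<in> Ob C" using f by auto
  let ?z = "ze e (L X)"
  let ?\<iota> = "\<lambda>v. ntup C ((replicate n ?z)[i := v]) ?z"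
  have z: "?z \<in> El Z e (l X)" using el by auto
  have ab: "addm C (L X) a b \<in> El Z e (l X)" using el by auto
  have \<iota>: "?\<iota> v \<in> El Z e (npow C (l X) n (l X))" if "v \<in> El Z e (l X)" for v
    using that z by (intro ntup_El ball_list_update) auto
  have T: "ntup C as x \<in> El Z e (npow C (l X) n X)" using el by (intro ntup_El) auto
  have "addm C (L (npow C (l X) n X)) (?\<iota> a) (?\<iota> b) =
      ntup C (map2 (addm C (L (l X))) ((replicate n ?z)[i := a]) ((replicate n ?z)[i := b])) (addm C (L X) ?z ?z)"
    using el z by (intro addm_ntup ball_list_update) auto
  also have "map2 (addm C (L (l X))) ((replicate n ?z)[i := a]) ((replicate n ?z)[i := b]) =
      (replicate n ?z)[i := addm C (L X) a b]"
    using el by (intro nth_equalityI) (auto simp: nth_list_update)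
  finally have "?\<iota> (addm C (L X) a b) = addm C (L (npow C (l X) n X)) (?\<iota> a) (?\<iota> b)"
    using el by simp
  then have "dv (?\<iota> (addm C (L X) a b)) (ntup C as x) (F f n) =
    addm C (L (Cod C f)) (dv (?\<iota> a) (ntup C as x) (F f n)) (dv (?\<iota> b) (ntup C as x) (F f n))"
    using dv_add_dir[of "F f n" "npow C (l X) n X" "?\<iota> a" Z e "?\<iota> b" "ntup C as x"] f \<iota>[of a] \<iota>[of b] T el by auto
  then show ?thesis
    using dv_F_single[OF f ab el(3-6)] dv_F_single[OF f el(1,3-6)] dv_F_single[OF f el(2-6)] by simp
qed

text \<open>A direction with a zero in slot \<open>i\<close> and zeros elsewhere is the zero
  direction, to which \<open>dv_ze_dir\<close> applies.\<close>

lemma ntup_F_zero: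
  assumes f: "f \<in> Ar C" "Dom C f = X"
    and el: "\<forall>z\<in>set as. z \<in> El Z e (l X)" "x \<in> El Z e X" "length as = n" "i < n"
  shows "ntup C (as[i := ze e (L X)]) x \<cdot> F f n = ze (Rst C (x \<cdot> f)) (L (Cod C f))"
proof -
  have X [simp]: "X \<in> Ob C" using f by auto
  let ?z = "ze e (L X)"
  have z: "?z \<in> El Z e (l X)" using el by auto
  have T: "ntup C as x \<in> El Z e (npow C (l X) n X)" using el by (intro ntup_El) auto
  have "ntup C (as[i := ?z]) x \<cdot> F f n = dv (ntup C (replicate n ?z) ?z) (ntup C as x) (F f n)"
    using dv_F_single[OF f z el] by simp
  also have "\<dots> = dv (ze e (L (npow C (l X) n X))) (ntup C as x) (F f n)"
    using el ntup_ze[of "l X" X e n] by simp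
  also have "\<dots> = ze (Rst C (ntup C as x \<cdot> F f n)) (L (Cod C f))"
    using f T dv_ze_dir[of "F f n" "npow C (l X) n X" "ntup C as x" Z e] by simp
  finally show ?thesis using ntup_F_simps(4)[of f as Z e x n] f el by simp
qed

text \<open>The direction is a sum of one part in the \<open>X\<close> slot and \<open>n\<close>
  parts in single slots. The former gives the term with \<open>F f (Suc n)\<close> by
  \<open>ntup_F_Suc\<close>, each of the latter a term with \<open>F f n\<close> by
  \<open>dv_F_single\<close>.\<close>

lemma dv_F:
  assumes f: "f \<in> Ar C" "Dom C f = X"
    and el: "\<forall>z\<in>set vs. z \<in> El Z e (l X)" "w \<in> El Z e (l X)" "\<forall>z\<in>set as. z \<in> El Z e (l X)" "x \<in> El Z e X"
      "length vs = n" "length as = n"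
  shows "dv (ntup C vs w) (ntup C as x) (F f n) =
    addm C (L (Cod C f)) (ntup C (w # as) x \<cdot> F f (Suc n))
      (hom_sum C Z (L (Cod C f)) (\<lambda>i. ntup C (as[i := vs ! i]) x \<cdot> F f n) {..<n})"
proof -
  have X [simp]: "X \<in> Ob C" using f by auto
  have Z [simp]: "Z \<in> Ob C" using el by auto
  let ?z = "ze e (L X)" let ?Y = "Cod C f"
  let ?T = "ntup C as x"
  let ?h = "\<lambda>i. ntup C (as[i := vs ! i]) x \<cdot> F f n"
  \<comment> \<open>Only the first \<open>k\<close> linear slots carry their direction; the
    induction on \<open>k\<close> switches them on one at a time.\<close>
  let ?vs = "\<lambda>k. map (\<lambda>j. if j < k then vs ! j else ?z) [0..<n]"
  have z: "?z \<in> El Z e (l X)" using el by auto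
  have T: "?T \<in> El Z e (npow C (l X) n X)" using el by (intro ntup_El) auto
  have vs: "vs ! i \<in> El Z e (l X)" if "i < n" for i using el that by simp
  have h: "?h i \<in> Hom C Z (l ?Y)" if "i < n" for i
  proof -
    have "\<forall>z\<in>set (as[i := vs ! i]). z \<in> El Z e (l X)" using el vs[OF that] by (intro ball_list_update) auto
    then show ?thesis using ntup_F_simps[of f "as[i := vs ! i]" Z e x n] f el that by simp
  qed
  have s: "ntup C (w # as) x \<cdot> F f (Suc n) \<in> Hom C Z (l ?Y)"
    using ntup_F_simps[of f "w # as" Z e x "Suc n"] f el by simp
  have "dv (ntup C (?vs k) w) ?T (F f n) =
    addm C (L ?Y) (ntup C (w # as) x \<cdot> F f (Suc n)) (hom_sum C Z (L ?Y) ?h {..<k})" if "k \<le> n" for k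
    using that
  proof (induction k)
    case 0
    have "dv (ntup C (?vs 0) w) ?T (F f n) = ntup C (w # as) x \<cdot> F f (Suc n)"
      using ntup_F_Suc[OF f el(2-4,6)] by (simp add: map_replicate_const)
    then show ?case using s f by simp
  next
    case (Suc k)
    let ?\<iota> = "ntup C ((replicate n ?z)[k := vs ! k]) ?z"
    have \<iota>: "?\<iota> \<in> El Z e (npow C (l X) n (l X))"
      using vs[of k] z Suc.prems by (intro ntup_El ball_list_update) auto
    have V: "ntup C (?vs k) w \<in> El Z e (npow C (l X) n (l X))"
    proof (rule ntup_El)
      show "\<forall>z\<in>set (?vs k). z \<in> El Z e (l X)"
        using vs z by (auto simp del: El_iff)
    qed (use el in auto)
    have "addm C (L (npow C (l X) n X)) ?\<iota> (ntup C (?vs k) w) =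
      ntup C (map2 (addm C (L (l X))) ((replicate n ?z)[k := vs ! k]) (?vs k)) (addm C (L X) ?z w)"
      using el z vs Suc.prems by (intro addm_ntup ball_list_update) auto
    also have "map2 (addm C (L (l X))) ((replicate n ?z)[k := vs ! k]) (?vs k) = ?vs (Suc k)"
      using el z vs Suc.prems by (intro nth_equalityI) (auto simp: nth_list_update less_Suc_eq)
    finally have "ntup C (?vs (Suc k)) w = addm C (L (npow C (l X) n X)) ?\<iota> (ntup C (?vs k) w)"
      using el z by simp
    then have "dv (ntup C (?vs (Suc k)) w) ?T (F f n) =
       addm C (L ?Y) (dv ?\<iota> ?T (F f n)) (dv (ntup C (?vs k) w) ?T (F f n))"
      using dv_add_dir[of "F f n" "npow C (l X) n X" ?\<iota> Z e "ntup C (?vs k) w" ?T] f \<iota> V T by auto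
    also have "dv ?\<iota> ?T (F f n) = ?h k"
      using Suc.prems vs el by (intro dv_F_single f) auto
    also have "dv (ntup C (?vs k) w) ?T (F f n) =
      addm C (L ?Y) (ntup C (w # as) x \<cdot> F f (Suc n)) (hom_sum C Z (L ?Y) ?h {..<k})"
      using Suc by simp
    also have "addm C (L ?Y) (?h k) \<dots> = addm C (L ?Y) (ntup C (w # as) x \<cdot> F f (Suc n))
        (addm C (L ?Y) (?h k) (hom_sum C Z (L ?Y) ?h {..<k}))"
    proof -
      have hs: "hom_sum C Z (L ?Y) ?h {..<k} \<in> Hom C Z (l ?Y)"
        using f h Suc.prems by (intro hom_sum_Hom) auto
      interpret HM: comm_monoid "hom_monoid C Z (L ?Y)"
        using f by (intro hom_monoid_comm_monoid) auto
      show ?thesis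
        using HM.m_lcomm[of "?h k" "ntup C (w # as) x \<cdot> F f (Suc n)" "hom_sum C Z (L ?Y) ?h {..<k}"]
          hs s h[of k] Suc.prems by (simp only: hom_monoid_simps)
    qed
    also have "addm C (L ?Y) (?h k) (hom_sum C Z (L ?Y) ?h {..<k}) = hom_sum C Z (L ?Y) ?h {..<Suc k}"
      unfolding lessThan_Suc using f h Suc.prems by (intro hom_sum_insert[symmetric]) auto
    finally show ?case .
  qed
  from this[of n] have "dv (ntup C (?vs n) w) ?T (F f n) =
    addm C (L ?Y) (ntup C (w # as) x \<cdot> F f (Suc n)) (hom_sum C Z (L ?Y) ?h {..<n})" by simp
  moreover have "?vs n = vs" using el by (intro nth_equalityI) auto
  ultimately show ?thesis by simp
qed

text \<open>The two front arguments come from two successive derivatives in the \<open>X\<close>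
  slot. By \<open>dv_F_Suc\<close> they become the two entries around \<open>D (F f n)\<close> that
  [DR.7] exchanges.\<close>

lemma ntup_F_swap:
  assumes f: "f \<in> Ar C" "Dom C f = X"
    and el: "a \<in> El Z e (l X)" "b \<in> El Z e (l X)" "\<forall>z\<in>set cs. z \<in> El Z e (l X)" "x \<in> El Z e X" "length cs = n"
  shows "ntup C (a # b # cs) x \<cdot> F f (Suc (Suc n)) = ntup C (b # a # cs) x \<cdot> F f (Suc (Suc n))"
proof -
  have X [simp]: "X \<in> Ob C" using f by auto
  let ?z = "ze e (L X)" let ?T = "ntup C cs x" let ?P = "npow C (l X) n X"
  have z: "?z \<in> El Z e (l X)" using el by auto
  have \<iota>: "ntup C (replicate n ?z) u \<in> El Z e (npow C (l X) n (l X))" if "u \<in> El Z e (l X)" for u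
    using z that by (intro ntup_El) auto
  have T: "?T \<in> El Z e ?P" using el by (intro ntup_El) auto
  have zz: "ntup C (replicate n ?z) ?z = ze e (L ?P)"
    using el ntup_ze[of "l X" X e n] by simp
  have *: "ntup C (a # b # cs) x \<cdot> F f (Suc (Suc n)) =
      dv \<langle>ze e (L ?P), ntup C (replicate n ?z) a\<rangle> \<langle>ntup C (replicate n ?z) b, ?T\<rangle> (D (F f n))"
    if "a \<in> El Z e (l X)" "b \<in> El Z e (l X)" for a b
  proof -
    have "ntup C (a # b # cs) x \<cdot> F f (Suc (Suc n)) =
        dv (ntup C (replicate (Suc n) ?z) a) (ntup C (b # cs) x) (F f (Suc n))"
      using el that by (intro ntup_F_Suc f) auto
    also have "\<dots> = dv \<langle>?z, ntup C (replicate n ?z) a\<rangle> \<langle>b, ?T\<rangle> (F f (Suc n))" by simp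
    also have "\<dots> = dv \<langle>ntup C (replicate n ?z) ?z, ntup C (replicate n ?z) a\<rangle> \<langle>ntup C (replicate n ?z) b, ?T\<rangle> (D (F f n))"
      using z \<iota> T that by (intro dv_F_Suc f) auto
    finally show ?thesis by (simp only: zz)
  qed
  have "dv \<langle>ze e (L ?P), ntup C (replicate n ?z) a\<rangle> \<langle>ntup C (replicate n ?z) b, ?T\<rangle> (D (F f n)) =
    dv \<langle>ze e (L ?P), ntup C (replicate n ?z) b\<rangle> \<langle>ntup C (replicate n ?z) a, ?T\<rangle> (D (F f n))"
    using f \<iota>[of a] \<iota>[of b] T el by (intro dv_D_swap) auto
  then show ?thesis using *[of a b] *[of b a] el by simp
qed

text \<open>Equality of multisets stands for an arbitrary permutation. Rearranging the tail behind a
  fixed head is the derivative of the induction hypothesis, and \<open>ntup_F_swap\<close>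
  transposes the first two arguments; together these reach every order.\<close>

lemma ntup_F_perm:
  assumes f: "f \<in> Ar C" "Dom C f = X"
    and el: "mset as = mset bs" "\<forall>z\<in>set as. z \<in> El Z e (l X)" "x \<in> El Z e X" "length as = n"
  shows "ntup C as x \<cdot> F f n = ntup C bs x \<cdot> F f n"
  using el
proof (induction n arbitrary: Z e as bs x)
  case 0
  then have "as = []" "bs = []" by auto
  then show ?case by simp
next
  case (Suc n)
  have X [simp]: "X \<in> Ob C" using f by auto
  let ?z = "ze e (L X)" let ?P = "npow C (l X) n X"
  have z: "?z \<in> El Z e (l X)" using Suc.prems by auto
  have same_head: "ntup C (a # cs) x \<cdot> F f (Suc n) = ntup C (a # ds) x \<cdot> F f (Suc n)"
    if "a \<in> El Z e (l X)" "mset cs = mset ds" "\<forall>z\<in>set cs. z \<in> El Z e (l X)" "length cs = n" for a cs ds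
  proof -
    have ds: "\<forall>z\<in>set ds. z \<in> El Z e (l X)" "length ds = n"
      using that mset_eq_setD[OF that(2)] mset_eq_length[OF that(2)] by auto
    note prems = that
    obtain \<sigma> where \<sigma>: "\<sigma> permutes {..<n}" "permute_list \<sigma> cs = ds"
      using mset_eq_permutation[OF prems(2)[symmetric]] prems(4) by metis
    let ?\<iota> = "ntup C (replicate n ?z) a" and ?T = "ntup C cs x"
    let ?p = "nproj C (l X) n X"
    have \<iota>: "?\<iota> \<in> El Z e (npow C (l X) n (l X))" using z that by (intro ntup_El) auto
    have T: "?T \<in> El Z e ?P" using that Suc.prems by (intro ntup_El) auto
    have \<sigma>n: "\<sigma> i < n" if "i < n" for i using permutes_in_image[OF \<sigma>(1), of i] that by simp
    \<comment> \<open>The permutation of the linear slots as a map, which \<open>F f n\<close>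
      absorbs by the induction hypothesis. The direction \<open>?\<iota>\<close> is zero in the
      permuted slots, so \<open>\<psi>\<close> leaves it unchanged and acts on the arguments
      only.\<close>
    define \<psi> where "\<psi> = ntup C (map (\<lambda>i. ?p (\<sigma> i)) [0..<n]) (?p n)"
    have \<psi>: "\<psi> \<in> El ?P (Idn C ?P) ?P"
      unfolding \<psi>_def using \<sigma>n by (intro ntup_El) (auto simp: less_imp_le)
    have "map (\<lambda>i. ?p (\<sigma> i)) [0..<n] = permute_list \<sigma> (map ?p [0..<n])"
      using \<sigma>n by (auto simp: permute_list_def)
    then have "\<psi> \<cdot> F f n = ntup C (map ?p [0..<n]) (?p n) \<cdot> F f n"
      unfolding \<psi>_def using \<sigma>(1) \<sigma>n by (intro Suc.IH[where e="Idn C ?P" and Z="?P"]) (auto simp: less_imp_le)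
    then have \<psi>F: "\<psi> \<cdot> F f n = F f n" using f by simp
    have "dv ?\<iota> ?T \<psi> = ntup C (map (dv ?\<iota> ?T) (map (\<lambda>i. ?p (\<sigma> i)) [0..<n])) (dv ?\<iota> ?T (?p n))"
      unfolding \<psi>_def using \<iota> T \<sigma>n by (intro dv_ntup[where Z="?P" and A="l X" and X=X]) (auto simp: less_imp_le)
    moreover have dp: "dv ?\<iota> ?T (?p k) = (if k < n then ?z else a)" if "k \<le> n" for k
      using \<iota> T that \<open>a \<in> _\<close> z ntup_nproj[of "replicate n ?z" Z e "l X" a "l X" n k] by simp
    moreover have "map (dv ?\<iota> ?T) (map (\<lambda>i. ?p (\<sigma> i)) [0..<n]) = replicate n ?z"
      using \<iota> T dp \<sigma>n by (intro nth_equalityI) (auto simp: less_imp_le)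
    ultimately have d\<psi>: "dv ?\<iota> ?T \<psi> = ?\<iota>" by simp
    have "?T \<cdot> \<psi> = ntup C (map ((\<cdot>) ?T) (map (\<lambda>i. ?p (\<sigma> i)) [0..<n])) (?T \<cdot> ?p n)"
      unfolding \<psi>_def using T \<sigma>n by (intro cmp_ntup[where Z="?P" and A="l X" and X=X]) (auto simp: less_imp_le)
    moreover have cp: "?T \<cdot> ?p k = (if k < n then cs ! k else x)" if "k \<le> n" for k
      using \<open>\<forall>z\<in>set cs. _ z\<close> \<open>length cs = n\<close> Suc.prems that ntup_nproj[of cs Z e "l X" x X n k] by simp
    moreover have "map ((\<cdot>) ?T) (map (\<lambda>i. ?p (\<sigma> i)) [0..<n]) = ds"
      unfolding \<sigma>(2)[symmetric] permute_list_def \<open>length cs = n\<close>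
      using cp \<sigma>n by (intro nth_equalityI) (auto simp: less_imp_le)
    ultimately have c\<psi>: "?T \<cdot> \<psi> = ntup C ds x" by simp
    have "ntup C (a # cs) x \<cdot> F f (Suc n) = dv ?\<iota> ?T (F f n)"
      using that Suc.prems by (intro ntup_F_Suc f) auto
    also have "\<dots> = dv ?\<iota> ?T (\<psi> \<cdot> F f n)" by (simp only: \<psi>F)
    also have "\<dots> = dv ?\<iota> (ntup C ds x) (F f n)"
      using \<iota> T \<psi> f by (subst dv_Cmp) (auto simp: d\<psi> c\<psi>)
    also have "\<dots> = ntup C (a # ds) x \<cdot> F f (Suc n)"
      using that ds Suc.prems by (intro ntup_F_Suc[symmetric] f) auto
    finally show ?thesis .
  qed
  obtain a as' b bs' where eq: "as = a # as'" "bs = b # bs'"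
    using Suc.prems mset_eq_length[OF Suc.prems(1)] by (metis length_Suc_conv)
  show ?case
  proof (cases "a = b")
    case True
    then show ?thesis using same_head[of a as' bs'] Suc.prems eq by auto
  next
    case False
    then have b: "b \<in> set as'" and a: "a \<in> set bs'"
      using Suc.prems(1) eq by (metis insert_iff list.simps(15) mset_eq_setD set_ConsD)+
    \<comment> \<open>Each tail consists of \<open>cs\<close> and the head of the other list. It is
      enough to move \<open>b\<close> to the second place, swap, and rearrange the new tail.\<close>
    define cs where "cs = remove1 b as'"
    have m: "mset as' = mset (b # cs)" using b by (simp add: cs_def)
    have m': "mset bs' = mset (a # cs)"
      using Suc.prems(1) m False by (simp add: eq add_eq_conv_ex)
    have cs: "\<forall>z\<in>set cs. z \<in> El Z e (l X)" "Suc (length cs) = n"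
      using Suc.prems eq mset_eq_length[OF m] mset_eq_setD[OF m] by auto
    have el': "a \<in> El Z e (l X)" "b \<in> El Z e (l X)" using Suc.prems eq b by auto
    have "ntup C (a # as') x \<cdot> F f (Suc n) = ntup C (a # b # cs) x \<cdot> F f (Suc n)"
      using same_head[of a as' "b # cs"] m Suc.prems eq by auto
    also have "\<dots> = ntup C (b # a # cs) x \<cdot> F f (Suc n)"
      using ntup_F_swap[OF f el' cs(1) Suc.prems(3)] cs(2) by simp
    also have "\<dots> = ntup C (b # bs') x \<cdot> F f (Suc n)"
      using same_head[of b "a # cs" bs'] m' cs el' by auto
    finally show ?thesis using eq by simp
  qed
qed

end

section \<open>Partitions and partial injections\<close>

text \<open>For a partition \<open>P\<close> of a set without \<open>a\<close>, these are the
  partitions of the set enlarged by \<open>a\<close> whose trace on the old set is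
  \<open>P\<close>.\<close>

definition refine_with :: "'a \<Rightarrow> 'a set set \<Rightarrow> 'a set set set" where
  "refine_with a P = insert (insert {a} P) ((\<lambda>B. insert (insert a B) (P - {B})) ` P)"

text \<open>Deleting \<open>a\<close> recovers \<open>P\<close>; thus refinements of different
  partitions are different, which later makes a sum over partitions split into disjoint
  families.\<close>

lemma partition_refine_with:
  assumes P: "partition_on I P" and a: "a \<notin> I" and Q: "Q \<in> refine_with a P"
  shows "partition_on (insert a I) Q" "(\<lambda>B. B - {a}) ` Q - {{}} = P"
proof -
  have aP: "a \<notin> B" if "B \<in> P" for B using P a that by (auto simp: partition_on_def)
  have dj: "B \<inter> B' = {}" if "B \<in> P" "B' \<in> P" "B \<noteq> B'" for B B'
    using P that by (auto simp: partition_on_def disjoint_def)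
  have ne: "{} \<notin> P" and U: "\<Union>P = I" using P by (auto simp: partition_on_def)
  have id: "(\<lambda>B. B - {a}) ` R = R" if "R \<subseteq> P" for R
  proof -
    have "(\<lambda>B. B - {a}) ` R = (\<lambda>B. B) ` R"
      using aP that by (intro image_cong) auto
    then show ?thesis by simp
  qed
  have "partition_on (insert a I) Q \<and> (\<lambda>B. B - {a}) ` Q - {{}} = P"
  proof (cases "Q = insert {a} P")
    case True
    have "I - {a} = I" using a by auto
    then show ?thesis using True P id[of P] ne a
      by (auto simp: partition_on_def disjoint_def pairwise_insert disjnt_def)
  next
    case False
    then obtain B where B: "B \<in> P" "Q = insert (insert a B) (P - {B})" using Q by (auto simp: refine_with_def)
    have "partition_on (insert a I) Q"
      unfolding partition_on_def
    proof (intro conjI)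
      show "\<Union>Q = insert a I" using B U by auto
      show "{} \<notin> Q" using B ne by auto
      show "disjoint Q" unfolding disjoint_def
      proof (intro ballI impI)
        fix C D assume "C \<in> Q" "D \<in> Q" "C \<noteq> D"
        then show "C \<inter> D = {}" using B dj aP by (auto; blast)
      qed
    qed
    moreover have "(\<lambda>B. B - {a}) ` Q = insert (insert a B - {a}) (P - {B})"
      using B id[of "P - {B}"] by auto
    moreover have "insert a B - {a} = B" using aP[OF B(1)] by auto
    ultimately show ?thesis using B ne by auto
  qed
  then show "partition_on (insert a I) Q" "(\<lambda>B. B - {a}) ` Q - {{}} = P" by auto
qed

lemma partitions_insert:
  assumes a: "a \<notin> I"
  shows "{Q. partition_on (insert a I) Q} = (\<Union>P\<in>{P. partition_on I P}. refine_with a P)"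
proof (intro equalityI subsetI)
  fix Q assume "Q \<in> {Q. partition_on (insert a I) Q}"
  then have Q: "partition_on (insert a I) Q" by simp
  then obtain B where B: "B \<in> Q" "a \<in> B" by (auto simp: partition_on_def)
  have dj: "C \<inter> D = {}" if "C \<in> Q" "D \<in> Q" "C \<noteq> D" for C D
    using Q that by (auto simp: partition_on_def disjoint_def)
  have part: "partition_on (insert a I - B) (Q - {B})" "B \<subseteq> insert a I"
    using partition_on_insert[of B "Q - {B}" "insert a I"] B Q dj
    by (auto simp: insert_absorb disjnt_def)
  show "Q \<in> (\<Union>P\<in>{P. partition_on I P}. refine_with a P)"
  proof (cases "B = {a}")
    case True
    have "insert a I - {a} = I" using a by auto
    then have "partition_on I (Q - {{a}})" using part True by simp
    moreover have "Q \<in> refine_with a (Q - {{a}})" using B True by (auto simp: refine_with_def)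
    ultimately show ?thesis by blast
  next
    case False
    let ?P = "insert (B - {a}) (Q - {B})"
    \<comment> \<open>The shortened block is nonempty and lies inside \<open>B\<close>, hence meets
      \<open>B\<close> and cannot be another block of \<open>Q\<close>.\<close>
    have nin: "B - {a} \<notin> Q - {B}"
    proof
      assume "B - {a} \<in> Q - {B}"
      then have "(B - {a}) \<inter> B = {}" using dj B by blast
      then show False using False B by auto
    qed
    have "disjnt (B - {a}) (\<Union>(Q - {B}))"
      using dj[OF B(1)] by (auto simp: disjnt_def)
    moreover have "I - (B - {a}) = insert a I - B" using a B part by auto
    ultimately have "partition_on I ?P"
      using part a B False partition_on_insert[of "B - {a}" "Q - {B}" I] by auto
    moreover have "insert a (B - {a}) = B" using B by auto
    then have "Q = insert (insert a (B - {a})) (?P - {B - {a}})" using B nin by auto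
    then have "Q \<in> refine_with a ?P" unfolding refine_with_def by blast
    ultimately show ?thesis by blast
  qed
qed (use partition_refine_with a in auto)

lemma finite_partitions: "finite {P. partition_on {..<n::nat} P}"
  by (rule finitely_many_partition_on) simp

definition partial_injections :: "nat \<Rightarrow> nat \<Rightarrow> (nat set \<times> (nat \<Rightarrow> nat)) set" where
  "partial_injections r n = {(S, \<phi>). S \<subseteq> {..<r} \<and> \<phi> \<in> S \<rightarrow>\<^sub>E {..<n} \<and> inj_on \<phi> S}"

lemma partial_injections_0: "partial_injections 0 n = {({}, \<lambda>_. undefined)}"
  by (auto simp: partial_injections_def)

lemma finite_partial_injections: "finite (partial_injections r n)"
proof -
  have "partial_injections r n \<subseteq> (SIGMA S:Pow {..<r}. S \<rightarrow>\<^sub>E {..<n})"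
    by (auto simp: partial_injections_def)
  moreover have "finite (SIGMA S:Pow {..<r}. S \<rightarrow>\<^sub>E {..<n})"
    by (intro finite_SigmaI finite_PiE) (auto intro: finite_subset)
  ultimately show ?thesis by (rule finite_subset)
qed

lemma partial_injections_nonempty: "partial_injections r n \<noteq> {}"
proof -
  have "({}, \<lambda>_. undefined) \<in> partial_injections r n" by (auto simp: partial_injections_def)
  then show ?thesis by blast
qed

text \<open>Forgetting \<open>r\<close> maps the left side onto the smaller set; the fibre over a
  pair consists of the pair itself and of one extension for each value not yet taken.\<close>

lemma partial_injections_Suc:
  "partial_injections (Suc r) n = (\<Union>p\<in>partial_injections r n.
     insert p ((\<lambda>i. (insert r (fst p), (snd p)(r := i))) ` ({..<n} - snd p ` fst p)))" (is "?L = ?R")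
proof (intro equalityI subsetI)
  fix q assume "q \<in> ?L"
  then obtain S \<phi> where q: "q = (S, \<phi>)" "S \<subseteq> {..<Suc r}" "\<phi> \<in> S \<rightarrow>\<^sub>E {..<n}" "inj_on \<phi> S"
    by (auto simp: partial_injections_def)
  show "q \<in> ?R"
  proof (cases "r \<in> S")
    case False
    then have "q \<in> partial_injections r n" using q by (auto simp: partial_injections_def less_Suc_eq)
    then show ?thesis by blast
  next
    case True
    \<comment> \<open>Resetting the value at \<open>r\<close> to \<open>undefined\<close> keeps the
      restricted injection extensional.\<close>
    let ?S = "S - {r}" and ?\<phi> = "\<phi>(r := undefined)"
    have "?\<phi> ` ?S = \<phi> ` ?S" by auto
    moreover have "inj_on ?\<phi> ?S" using q(4) by (auto simp: inj_on_def)
    ultimately have "(?S, ?\<phi>) \<in> partial_injections r n"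
      using q by (auto simp: partial_injections_def less_Suc_eq PiE_iff extensional_def)
    moreover have "\<phi> r \<in> {..<n} - ?\<phi> ` ?S"
      using q True by (auto simp: inj_on_def PiE_iff)
    then have "(insert r ?S, ?\<phi>(r := \<phi> r)) \<in>
        (\<lambda>i. (insert r (fst (?S, ?\<phi>)), (snd (?S, ?\<phi>))(r := i))) ` ({..<n} - snd (?S, ?\<phi>) ` fst (?S, ?\<phi>))"
      unfolding fst_conv snd_conv by (rule imageI)
    moreover have "q = (insert r ?S, ?\<phi>(r := \<phi> r))" using q True by auto
    ultimately show ?thesis by blast
  qed
next
  fix q assume "q \<in> ?R"
  then obtain p where pq: "p \<in> partial_injections r n"
    "q \<in> insert p ((\<lambda>i. (insert r (fst p), (snd p)(r := i))) ` ({..<n} - snd p ` fst p))" by (rule UN_E)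
  obtain S \<phi> where S: "p = (S, \<phi>)" by (cases p)
  have p: "(S, \<phi>) \<in> partial_injections r n" using pq S by simp
  have q: "q = (S, \<phi>) \<or> (\<exists>i\<in>{..<n} - \<phi> ` S. q = (insert r S, \<phi>(r := i)))" using pq(2) S by auto
  have rS: "r \<notin> S" using p by (auto simp: partial_injections_def)
  from q show "q \<in> ?L"
  proof
    assume "q = (S, \<phi>)" then show ?thesis using p by (auto simp: partial_injections_def)
  next
    assume "\<exists>i\<in>{..<n} - \<phi> ` S. q = (insert r S, \<phi>(r := i))"
    then obtain i where i: "i < n" "i \<notin> \<phi> ` S" "q = (insert r S, \<phi>(r := i))" by auto
    have "(\<phi>(r := i)) ` S = \<phi> ` S" using rS by auto
    moreover have "inj_on (\<phi>(r := i)) S" using p rS by (auto simp: partial_injections_def inj_on_def)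
    ultimately have "inj_on (\<phi>(r := i)) (insert r S)" using i rS by (auto simp: inj_on_insert)
    then show ?thesis using p i by (auto simp: partial_injections_def PiE_iff extensional_def)
  qed
qed

context crc
begin

text \<open>Common form of the growth of both index sets. \<open>red\<close> forgets the new
  variable and so separates the fibres; \<open>c i\<close> is the extension in which the new
  variable stands alone, and \<open>d i k\<close> attaches it to \<open>k\<close>.\<close>

lemma hom_sum_extend:
  assumes M: "tcm M" "Z \<in> Ob C" and fin: "finite I" "\<And>i. i \<in> I \<Longrightarrow> finite (K i)"
    and J: "J = (\<Union>i\<in>I. insert (c i) (d i ` K i))"
    and red: "\<And>i x. i \<in> I \<Longrightarrow> x \<in> insert (c i) (d i ` K i) \<Longrightarrow> red x = i"
    and inj: "\<And>i. i \<in> I \<Longrightarrow> inj_on (d i) (K i)" "\<And>i. i \<in> I \<Longrightarrow> c i \<notin> d i ` K i"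
    and h: "\<And>x. x \<in> J \<Longrightarrow> h x \<in> Hom C Z (Crr M)"
  shows "hom_sum C Z M h J = hom_sum C Z M (\<lambda>i. addm C M (h (c i)) (hom_sum C Z M (\<lambda>k. h (d i k)) (K i))) I"
proof -
  have "hom_sum C Z M h J = hom_sum C Z M (\<lambda>i. hom_sum C Z M h (insert (c i) (d i ` K i))) I"
    unfolding J
  proof (rule hom_sum_UN_disjoint[OF M])
    fix i j assume ij: "i \<in> I" "j \<in> I" "i \<noteq> j"
    show "insert (c i) (d i ` K i) \<inter> insert (c j) (d j ` K j) = {}"
    proof (rule ccontr)
      assume "insert (c i) (d i ` K i) \<inter> insert (c j) (d j ` K j) \<noteq> {}"
      then obtain x where x: "x \<in> insert (c i) (d i ` K i)" "x \<in> insert (c j) (d j ` K j)" by blast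
      show False using red[OF ij(1) x(1)] red[OF ij(2) x(2)] ij(3) by simp
    qed
  next
    fix i x assume "i \<in> I" "x \<in> insert (c i) (d i ` K i)"
    then show "h x \<in> Hom C Z (Crr M)" using h J by blast
  qed (use fin in auto)
  also have "\<dots> = hom_sum C Z M (\<lambda>i. addm C M (h (c i)) (hom_sum C Z M (\<lambda>k. h (d i k)) (K i))) I"
  proof (rule hom_sum_cong[OF M refl])
    fix i assume i: "i \<in> I"
    have hc: "h (c i) \<in> Hom C Z (Crr M)" using h J i by blast
    have hd: "h (d i k) \<in> Hom C Z (Crr M)" if "k \<in> K i" for k using h J i that by blast
    have s: "hom_sum C Z M (\<lambda>k. h (d i k)) (K i) \<in> Hom C Z (Crr M)"
      by (rule hom_sum_Hom[OF M]) (rule hd)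
    show "addm C M (h (c i)) (hom_sum C Z M (\<lambda>k. h (d i k)) (K i)) \<in> Hom C Z (Crr M)"
      using hc s M by simp
    have "hom_sum C Z M h (insert (c i) (d i ` K i)) = addm C M (h (c i)) (hom_sum C Z M h (d i ` K i))"
      using fin i inj hc hd by (intro hom_sum_insert[OF M]) blast+
    also have "hom_sum C Z M h (d i ` K i) = hom_sum C Z M (\<lambda>k. h (d i k)) (K i)"
      using inj(1)[OF i] hd by (intro hom_sum_reindex[OF M])
    finally show "hom_sum C Z M h (insert (c i) (d i ` K i)) =
      addm C M (h (c i)) (hom_sum C Z M (\<lambda>k. h (d i k)) (K i))" .
  qed
  finally show ?thesis .
qed

lemma hom_sum_partitions_Suc:
  assumes M: "tcm M" "Z \<in> Ob C" and h: "\<And>Q. partition_on {..<Suc n} Q \<Longrightarrow> h Q \<in> Hom C Z (Crr M)"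
  shows "hom_sum C Z M h {Q. partition_on {..<Suc n} Q} =
    hom_sum C Z M (\<lambda>P. addm C M (h (insert {n} P))
        (hom_sum C Z M (\<lambda>B. h (insert (insert n B) (P - {B}))) P)) {P. partition_on {..<n} P}"
proof (rule hom_sum_extend[OF M, where red="\<lambda>Q. (\<lambda>B. B - {n}) ` Q - {{}}"])
  show "finite {P. partition_on {..<n} P}" by (rule finite_partitions)
  show "{Q. partition_on {..<Suc n} Q} = (\<Union>P\<in>{P. partition_on {..<n} P}.
     insert (insert {n} P) ((\<lambda>B. insert (insert n B) (P - {B})) ` P))"
    unfolding lessThan_Suc by (subst partitions_insert) (auto simp: refine_with_def)
  fix P assume "P \<in> {P. partition_on {..<n} P}"
  then have P: "partition_on {..<n} P" by simp
  show "finite P" using finite_elements[OF _ P] by simp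
  have nP: "n \<notin> B" if "B \<in> P" for B using P that by (auto simp: partition_on_def)
  show "(\<lambda>B. B - {n}) ` Q - {{}} = P" if "Q \<in> insert (insert {n} P) ((\<lambda>B. insert (insert n B) (P - {B})) ` P)" for Q
    using partition_refine_with(2)[OF P, of n Q] that by (auto simp: refine_with_def)
  show "inj_on (\<lambda>B. insert (insert n B) (P - {B})) P"
  proof (rule inj_onI)
    fix A B assume AB: "A \<in> P" "B \<in> P" "insert (insert n A) (P - {A}) = insert (insert n B) (P - {B})"
    then have "insert n A \<in> insert (insert n B) (P - {B})" by blast
    then have "insert n A = insert n B" using nP by blast
    then show "A = B" using nP AB by (metis insert_ident)
  qed
  show "insert {n} P \<notin> (\<lambda>B. insert (insert n B) (P - {B})) ` P"
  proof
    assume "insert {n} P \<in> (\<lambda>B. insert (insert n B) (P - {B})) ` P"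
    then obtain B where B: "B \<in> P" "insert {n} P = insert (insert n B) (P - {B})" by blast
    then have "{n} = insert n B" using nP by blast
    then have "B = {}" using nP[OF B(1)] by auto
    then show False using B P by (auto simp: partition_on_def)
  qed
qed (use h in auto)

lemma hom_sum_partial_injections_Suc:
  assumes M: "tcm M" "Z \<in> Ob C" and h: "\<And>q. q \<in> partial_injections (Suc r) n \<Longrightarrow> h q \<in> Hom C Z (Crr M)"
  shows "hom_sum C Z M h (partial_injections (Suc r) n) =
    hom_sum C Z M (\<lambda>p. addm C M (h p)
        (hom_sum C Z M (\<lambda>i. h (insert r (fst p), (snd p)(r := i))) ({..<n} - snd p ` fst p)))
      (partial_injections r n)"
proof (rule hom_sum_extend[OF M, where red="\<lambda>q. (fst q - {r}, (snd q)(r := undefined))"])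
  fix p assume "p \<in> partial_injections r n"
  then have p: "fst p \<subseteq> {..<r}" "r \<notin> fst p" "snd p r = undefined"
    by (auto simp: partial_injections_def PiE_iff extensional_def)
  show "(fst x - {r}, (snd x)(r := undefined)) = p"
    if "x \<in> insert p ((\<lambda>i. (insert r (fst p), (snd p)(r := i))) ` ({..<n} - snd p ` fst p))" for x
    using that p by (cases p) (auto simp: fun_upd_idem)
  show "inj_on (\<lambda>i. (insert r (fst p), (snd p)(r := i))) ({..<n} - snd p ` fst p)"
    by (auto simp: inj_on_def dest: fun_upd_eqD)
  show "p \<notin> (\<lambda>i. (insert r (fst p), (snd p)(r := i))) ` ({..<n} - snd p ` fst p)"
    using p by (cases p) auto
qed (use h finite_partial_injections partial_injections_Suc in auto)

text \<open>The leading summand \<open>a\<close> has domain \<open>e\<close> and absorbs every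
  \<open>ze e M\<close>. Without it the claim would fail for empty \<open>J\<close>, where the
  remaining sum is the total zero.\<close>

lemma addm_hom_sum_zeros:
  assumes M: "tcm M" "Z \<in> Ob C" and a: "a \<in> El Z e (Crr M)" and I: "finite I" "J \<subseteq> I"
    and h: "\<And>i. i \<in> I \<Longrightarrow> h i \<in> Hom C Z (Crr M)" "\<And>i. i \<in> I - J \<Longrightarrow> h i = ze e M"
  shows "addm C M a (hom_sum C Z M h I) = addm C M a (hom_sum C Z M h J)"
proof -
  interpret HM: comm_monoid "hom_monoid C Z M" by (rule hom_monoid_comm_monoid[OF M])
  have "addm C M a (hom_sum C Z M h K) = a" if "finite K" "K \<subseteq> I - J" for K
    using that
  proof (induction K rule: finite_induct)
    case empty then show ?case using M a by simp
  next
    case (insert k K)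
    have hk: "h k = ze e M" using insert h(2) by blast
    have s: "hom_sum C Z M h K \<in> Hom C Z (Crr M)"
      using insert.prems h(1) by (intro hom_sum_Hom[OF M]) blast
    have "hom_sum C Z M h (insert k K) = addm C M (h k) (hom_sum C Z M h K)"
      using insert h(1) by (intro hom_sum_insert[OF M]) blast+
    then have "addm C M a (hom_sum C Z M h (insert k K)) = addm C M (addm C M a (ze e M)) (hom_sum C Z M h K)"
      using hk a s M addm_assoc[of M a "ze e M" "hom_sum C Z M h K"] by simp
    then show ?case using a M insert by simp
  qed
  from this[of "I - J"] I have z: "addm C M a (hom_sum C Z M h (I - J)) = a" by simp
  have s: "hom_sum C Z M h J \<in> Hom C Z (Crr M)" "hom_sum C Z M h (I - J) \<in> Hom C Z (Crr M)"
    using I h(1) by (intro hom_sum_Hom[OF M]; blast)+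
  have "I = (I - J) \<union> J" using I by auto
  then have "hom_sum C Z M h I = hom_sum C Z M h ((I - J) \<union> J)" by simp
  also have "\<dots> = addm C M (hom_sum C Z M h (I - J)) (hom_sum C Z M h J)"
    using I h(1) by (intro hom_sum_Un_disjoint[OF M]) (auto intro: finite_subset)
  finally have "addm C M a (hom_sum C Z M h I) = addm C M (addm C M a (hom_sum C Z M h (I - J))) (hom_sum C Z M h J)"
    using a s M by (simp add: addm_assoc)
  then show ?thesis by (simp only: z)
qed

end

lemma (in linorder)
  assumes "inj_on f A" "finite A"
  shows set_sorted_key_list_of_set_inj: "set (sorted_key_list_of_set f A) = A"
    and distinct_sorted_key_list_of_set_inj: "distinct (sorted_key_list_of_set f A)"
proof -
  interpret folding_insort_key "(\<le>)" "(<)" A f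
    by unfold_locales (rule assms)
  show "set (sorted_key_list_of_set f A) = A"
    using set_sorted_key_list_of_set[OF subset_refl] assms by simp
  show "distinct (sorted_key_list_of_set f A)"
    using distinct_sorted_key_list_of_set[OF subset_refl] by (simp add: distinct_map)
qed

context gen_diff_restriction_structure
begin

lemma F_1 [simp]: "f \<in> Ar C \<Longrightarrow> F f (Suc 0) = D f"
  by (simp add: F.simps(2) Let_def)

lemma D_eq_dv: "\<lbrakk>f \<in> Ar C; Dom C f = X\<rbrakk> \<Longrightarrow> D f = dv (Pr0 C (l X) X) (Pr1 C (l X) X) f"
  by (auto simp: dv_def)

lemma dv_ntup_F:
  assumes f: "f \<in> Ar C" and u: "u' \<in> El Z e (l U)" "u \<in> El Z e U"
    and el: "\<forall>z\<in>set ls. z \<in> El U eU (l (Dom C f))" "y \<in> El U eU (Dom C f)" "length ls = n"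
  shows "dv u' u (ntup C ls y \<cdot> F f n) =
    dv (ntup C (map (dv u' u) ls) (dv u' u y)) (ntup C (map (\<lambda>z. u \<cdot> z) ls) (u \<cdot> y)) (F f n)"
proof -
  let ?X = "Dom C f"
  have t: "ntup C ls y \<in> El U eU (npow C (l ?X) n ?X)" using el by (intro ntup_El) auto
  have "dv u' u (ntup C ls y \<cdot> F f n) = dv (dv u' u (ntup C ls y)) (u \<cdot> ntup C ls y) (F f n)"
    using u t f by (intro dv_Cmp) auto
  also have "dv u' u (ntup C ls y) = ntup C (map (dv u' u) ls) (dv u' u y)"
    using u el f by (intro dv_ntup[where Z=U and A="l ?X" and X="?X"]) auto
  also have "u \<cdot> ntup C ls y = ntup C (map (\<lambda>z. u \<cdot> z) ls) (u \<cdot> y)"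
    using u el f by (intro cmp_ntup[where Z=U and A="l ?X" and X="?X"]) auto
  finally show ?thesis .
qed

text \<open>Chain rule followed by \<open>dv_F\<close>: in one term the derivative of the base point
  enters as an additional argument, in each of the others one argument is replaced by its
  derivative. Both the composition law and coassociativity rest on this. The further conclusions
  record the common domain \<open>e'\<close> of everything that occurs.\<close>

lemma dv_ntup_F_sum:
  assumes f: "f \<in> Ar C" and u: "u' \<in> El Z e (l U)" "u \<in> El Z e U"
    and el: "\<forall>z\<in>set ls. z \<in> El U eU (l (Dom C f))" "y \<in> El U eU (Dom C f)" "length ls = n"
    and e': "e' = Rst C (u \<cdot> y)"
  shows "dv u' u (ntup C ls y \<cdot> F f n) =
    addm C (L (Cod C f)) (ntup C (dv u' u y # map (\<lambda>z. u \<cdot> z) ls) (u \<cdot> y) \<cdot> F f (Suc n))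
      (hom_sum C Z (L (Cod C f))
        (\<lambda>i. ntup C ((map (\<lambda>z. u \<cdot> z) ls)[i := dv u' u (ls ! i)]) (u \<cdot> y) \<cdot> F f n) {..<n})"
    and "\<forall>z\<in>set ls. u \<cdot> z \<in> El Z e' (l (Dom C f))" "u \<cdot> y \<in> El Z e' (Dom C f)"
    "\<forall>z\<in>set ls. dv u' u z \<in> El Z e' (l (Dom C f))" "dv u' u y \<in> El Z e' (l (Dom C f))"
proof -
  have R: "Rst C (u \<cdot> z) = e'" if "z \<in> El U eU Y" for z Y
    unfolding e' using that u el by (intro Rst_cmp_eq) auto
  have zs: "z \<in> El U eU (l (Dom C f))" if "z \<in> set ls" for z using that el by blast
  have e'E: "e' \<in> El Z e' Z" unfolding e' using u el by auto
  show cz: "\<forall>z\<in>set ls. u \<cdot> z \<in> El Z e' (l (Dom C f))"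
  proof
    fix z assume "z \<in> set ls"
    from zs[OF this] show "u \<cdot> z \<in> El Z e' (l (Dom C f))" using R[OF zs[OF \<open>z \<in> set ls\<close>]] u e'E by auto
  qed
  show dz: "\<forall>z\<in>set ls. dv u' u z \<in> El Z e' (l (Dom C f))"
  proof
    fix z assume "z \<in> set ls"
    from zs[OF this] show "dv u' u z \<in> El Z e' (l (Dom C f))" using R[OF zs[OF \<open>z \<in> set ls\<close>]] u e'E f by auto
  qed
  show cy: "u \<cdot> y \<in> El Z e' (Dom C f)" using R[OF el(2)] u el e'E by auto
  show dy: "dv u' u y \<in> El Z e' (l (Dom C f))" using R[OF el(2)] u el e'E f by auto
  have "dv u' u (ntup C ls y \<cdot> F f n) =
    dv (ntup C (map (dv u' u) ls) (dv u' u y)) (ntup C (map (\<lambda>z. u \<cdot> z) ls) (u \<cdot> y)) (F f n)"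
    by (rule dv_ntup_F[OF f u el])
  also have "\<dots> = addm C (L (Cod C f)) (ntup C (dv u' u y # map (\<lambda>z. u \<cdot> z) ls) (u \<cdot> y) \<cdot> F f (Suc n))
      (hom_sum C Z (L (Cod C f))
        (\<lambda>i. ntup C ((map (\<lambda>z. u \<cdot> z) ls)[i := map (dv u' u) ls ! i]) (u \<cdot> y) \<cdot> F f n) {..<n})"
    using cz dz cy dy el(3) by (intro dv_F f refl) auto
  also have "hom_sum C Z (L (Cod C f))
        (\<lambda>i. ntup C ((map (\<lambda>z. u \<cdot> z) ls)[i := map (dv u' u) ls ! i]) (u \<cdot> y) \<cdot> F f n) {..<n} =
      hom_sum C Z (L (Cod C f))
        (\<lambda>i. ntup C ((map (\<lambda>z. u \<cdot> z) ls)[i := dv u' u (ls ! i)]) (u \<cdot> y) \<cdot> F f n) {..<n}"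
  proof (rule hom_sum_cong)
    fix i assume "i \<in> {..<n}"
    then have i: "i < n" by simp
    have di: "dv u' u (ls ! i) \<in> El Z e' (l (Dom C f))" using dz i el(3) nth_mem by blast
    have "\<forall>z\<in>set ((map (\<lambda>z. u \<cdot> z) ls)[i := dv u' u (ls ! i)]). z \<in> El Z e' (l (Dom C f))"
      using cz di by (intro ball_list_update) (simp_all del: El_iff)
    then show "ntup C ((map (\<lambda>z. u \<cdot> z) ls)[i := dv u' u (ls ! i)]) (u \<cdot> y) \<cdot> F f n \<in> Hom C Z (l (Cod C f))"
      using ntup_F_simps[OF f _ cy, of "(map (\<lambda>z. u \<cdot> z) ls)[i := dv u' u (ls ! i)]" n] el(3) i by simp
  qed (use f u el(3) in auto)
  finally show "dv u' u (ntup C ls y \<cdot> F f n) =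
    addm C (L (Cod C f)) (ntup C (dv u' u y # map (\<lambda>z. u \<cdot> z) ls) (u \<cdot> y) \<cdot> F f (Suc n))
      (hom_sum C Z (L (Cod C f))
        (\<lambda>i. ntup C ((map (\<lambda>z. u \<cdot> z) ls)[i := dv u' u (ls ! i)]) (u \<cdot> y) \<cdot> F f n) {..<n})" .
qed

text \<open>The recursion numbers the new variable 0 and shifts the others. Symmetry moves it to
  position \<open>n\<close>, so that the old variables keep their numbers, as needed for index sets
  that grow from \<open>{..<n}\<close> to \<open>{..<Suc n}\<close>. The effect on projections is
  all that is used of \<open>u'\<close> and \<open>u\<close>.\<close>

lemma F_Suc_last:
  fixes n :: nat
  assumes g: "g \<in> Ar C" "Dom C g = X"
  defines "q \<equiv> nproj C (l X) (Suc n) X" and "W \<equiv> npow C (l X) (Suc n) X" and "Wn \<equiv> npow C (l X) n X"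
  obtains u' u where "u' \<in> El W (Idn C W) (l Wn)" "u \<in> El W (Idn C W) Wn"
    "\<And>i. i \<le> n \<Longrightarrow> u \<cdot> nproj C (l X) n X i = (if i < n then q i else q (Suc n))"
    "\<And>i. i \<le> n \<Longrightarrow> dv u' u (nproj C (l X) n X i) = (if i < n then zerom C (L X) W else q n)"
    "F g (Suc n) = dv u' u (F g n)"
proof -
  have X [simp]: "X \<in> Ob C" using g by auto
  have WOb: "W \<in> Ob C" unfolding W_def by (intro npow_Ob) auto
  have qE: "q i \<in> El W (Idn C W) (l X)" if "i < Suc n" for i
    unfolding q_def W_def El_iff
    using that nproj_simps[of "l X" X i "Suc n"] npow_Ob[of "l X" X "Suc n"] by (simp del: npow.simps nproj.simps)
  have yE: "q (Suc n) \<in> El W (Idn C W) X"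
    unfolding q_def W_def El_iff
    using nproj_simps[of "l X" X "Suc n" "Suc n"] npow_Ob[of "l X" X "Suc n"] by (simp del: npow.simps nproj.simps)
  let ?e = "Idn C W" let ?z = "zerom C (L X) W"
  have ze: "ze ?e (L X) = ?z" using WOb by (intro ze_Idn) auto
  have zE: "?z \<in> El W ?e (l X)" using WOb by simp
  \<comment> \<open>\<open>u\<close> forgets variable \<open>n\<close>; \<open>u'\<close> has this
    variable as its direction in the \<open>X\<close> slot and zeros in the others.\<close>
  define u' where "u' = ntup C (replicate n ?z) (q n)"
  define u where "u = ntup C (map q [0..<n]) (q (Suc n))"
  have zs: "\<forall>z\<in>set (replicate n ?z). z \<in> El W ?e (l X)" using zE by (auto simp del: El_iff)
  have qs: "\<forall>z\<in>set (map q [0..<n]). z \<in> El W ?e (l X)" using qE by (auto simp del: El_iff)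
  have u'E: "u' \<in> El W ?e (npow C (l X) n (l X))"
    unfolding u'_def using qE[of n] by (intro ntup_El zs) auto
  have uE: "u \<in> El W ?e Wn"
    unfolding u_def Wn_def using yE by (intro ntup_El qs) auto
  show ?thesis
  proof (rule that[of u' u])
    show "u' \<in> El W (Idn C W) (l Wn)" using u'E by (simp add: Wn_def)
    show "u \<in> El W (Idn C W) Wn" by (rule uE)
    show "u \<cdot> nproj C (l X) n X i = (if i < n then q i else q (Suc n))" if "i \<le> n" for i
      unfolding u_def using ntup_nproj[OF qs yE, of n i] that by simp
    show "dv u' u (nproj C (l X) n X i) = (if i < n then zerom C (L X) W else q n)" if "i \<le> n" for i
    proof -
      have "dv u' u (nproj C (l X) n X i) = u' \<cdot> nproj C (l (l X)) n (l X) i"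
        using u'E uE that by (intro dv_nproj) (auto simp: Wn_def)
      then show ?thesis using ntup_nproj[OF zs qE[of n], of n i] that by (simp add: u'_def)
    qed
    have "F g (Suc n) = ntup C (map q [0..<Suc n]) (q (Suc n)) \<cdot> F g (Suc n)"
      using g unfolding q_def by (subst ntup_nproj_id) auto
    also have "\<dots> = ntup C (q n # map q [0..<n]) (q (Suc n)) \<cdot> F g (Suc n)"
      using qE yE by (intro ntup_F_perm[OF g]) (auto simp del: El_iff)
    also have "\<dots> = dv u' u (F g n)"
      unfolding u'_def u_def ze[symmetric] using qE yE qs by (intro ntup_F_Suc g) (auto simp del: El_iff)
    finally show "F g (Suc n) = dv u' u (F g n)" .
  qed
qed

section \<open>The higher-order chain rule\<close>

text \<open>With \<open>at_blocks\<close>, this isolates the two layers of a summand of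
  \<open>faa_comp\<close>, with iterated derivatives as the components.\<close>

definition at :: "'m \<Rightarrow> (nat \<Rightarrow> 'm) \<Rightarrow> 'm \<Rightarrow> nat set \<Rightarrow> 'm" where
  "at f a x B = ntup C (map a (sorted_list_of_set B)) x \<cdot> F f (card B)"

definition at_blocks :: "'m \<Rightarrow> (nat set \<Rightarrow> 'm) \<Rightarrow> 'm \<Rightarrow> nat set set \<Rightarrow> 'm" where
  "at_blocks g b y P = ntup C (map b (sorted_key_list_of_set Min P)) y \<cdot> F g (card P)"

lemma mset_map_distinct:
  assumes "distinct xs" "distinct ys" "set xs = set ys"
  shows "mset (map h xs) = mset (map h ys)"
  using assms by (metis mset_map set_eq_iff_mset_eq_distinct)

text \<open>By symmetry the sorted listing of a block may be replaced by any other, so a new element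
  can be put in front. \<open>at_blocks_eq\<close> does the same for the listing of the
  blocks.\<close>

lemma at_eq:
  assumes f: "f \<in> Ar C" "Dom C f = X" and a: "\<And>i. i \<in> B \<Longrightarrow> a i \<in> El Z e (l X)" "x \<in> El Z e X"
    and bs: "distinct bs" "set bs = B"
  shows "at f a x B = ntup C (map a bs) x \<cdot> F f (length bs)"
proof -
  have fin: "finite B" using bs by auto
  then have m: "mset (map a (sorted_list_of_set B)) = mset (map a bs)"
    using bs by (intro mset_map_distinct) auto
  have c: "card B = length bs" using bs distinct_card by blast
  show ?thesis unfolding at_def c
    using a c fin by (intro ntup_F_perm[OF f m]) (auto simp del: El_iff)
qed

lemma at_El:
  assumes f: "f \<in> Ar C" "Dom C f = X" and a: "\<And>i. i \<in> B \<Longrightarrow> a i \<in> El Z e (l X)" "x \<in> El Z e X"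
    and B: "finite B" "B \<noteq> {}"
  shows "at f a x B \<in> El Z (Rst C (x \<cdot> f)) (l (Cod C f))"
proof -
  have "\<forall>z\<in>set (map a (sorted_list_of_set B)). z \<in> El Z e (l (Dom C f))" using a f B by (auto simp del: El_iff)
  moreover have "x \<in> El Z e (Dom C f)" using a f by simp
  moreover have "card B \<noteq> 0" using B by simp
  ultimately show ?thesis
    using ntup_F_simps[of f "map a (sorted_list_of_set B)" Z e x "card B"] f a(2) by (auto simp: at_def)
qed

text \<open>A common minimum would lie in two blocks. Listing the blocks by their minima therefore
  neither loses nor repeats any of them.\<close>

lemma inj_on_Min_partition:
  assumes "partition_on {..<n::nat} P" shows "inj_on Min P" "finite P"
proof -
  show "finite P" using assms by (rule finite_elements[rotated]) simp
  have fin: "finite B" "B \<noteq> {}" if "B \<in> P" for B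
  proof -
    have "B \<subseteq> {..<n}" using assms that by (auto simp: partition_on_def)
    then show "finite B" by (rule finite_subset) simp
    show "B \<noteq> {}" using assms that by (auto simp: partition_on_def)
  qed
  show "inj_on Min P"
  proof (rule inj_onI)
    fix A B assume AB: "A \<in> P" "B \<in> P" "Min A = Min B"
    then have "Min A \<in> A" "Min A \<in> B" using fin Min_in by metis+
    then show "A = B" using AB assms by (auto simp: partition_on_def disjoint_def)
  qed
qed

lemma at_blocks_eq:
  assumes g: "g \<in> Ar C" "Dom C g = Y" and P: "partition_on {..<n} P"
    and b: "\<And>B. B \<in> P \<Longrightarrow> b B \<in> El Z e (l Y)" "y \<in> El Z e Y" and bs: "distinct bs" "set bs = P"
  shows "at_blocks g b y P = ntup C (map b bs) y \<cdot> F g (length bs)"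
proof -
  note inj = inj_on_Min_partition(1)[OF P] and fin = inj_on_Min_partition(2)[OF P]
  note s = set_sorted_key_list_of_set_inj[OF inj fin] and d = distinct_sorted_key_list_of_set_inj[OF inj fin]
  then have m: "mset (map b (sorted_key_list_of_set Min P)) = mset (map b bs)"
    using bs d by (intro mset_map_distinct) auto
  have c: "card P = length bs" using bs distinct_card by blast
  have "length (sorted_key_list_of_set Min P) = card P" using d s distinct_card by metis
  then show ?thesis unfolding at_blocks_def c
    using b c s by (intro ntup_F_perm[OF g m]) (auto simp del: El_iff)
qed

lemma at_blocks_El:
  assumes g: "g \<in> Ar C" "Dom C g = Y" and P: "partition_on {..<Suc n} P"
    and b: "\<And>B. B \<in> P \<Longrightarrow> b B \<in> El Z e (l Y)" "y \<in> El Z e Y"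
  shows "at_blocks g b y P \<in> El Z (Rst C (y \<cdot> g)) (l (Cod C g))"
proof -
  note fin = inj_on_Min_partition(2)[OF P]
  then obtain bs where bs: "distinct bs" "set bs = P" using finite_distinct_list by blast
  have "P \<noteq> {}" using P by (auto simp: partition_on_def)
  then have "bs \<noteq> []" using bs by auto
  have "at_blocks g b y P = ntup C (map b bs) y \<cdot> F g (length bs)"
    by (rule at_blocks_eq[OF g P b bs])
  moreover have "\<forall>z\<in>set (map b bs). z \<in> El Z e (l (Dom C g))" using b g bs by (auto simp del: El_iff)
  moreover have "y \<in> El Z e (Dom C g)" using b g by simp
  ultimately show ?thesis
    using ntup_F_simps[of g "map b bs" Z e y "length bs"] g b(2) \<open>bs \<noteq> []\<close> by auto
qed

text \<open>The arguments indexed by \<open>B\<close> have derivative zero and only the base point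
  moves. Of the terms of the derivative just the one with an additional argument remains, and
  \<open>k\<close> joins the block.\<close>

lemma dv_at:
  assumes f: "f \<in> Ar C" "Dom C f = X" and a: "\<And>i. i \<in> B \<Longrightarrow> a i \<in> El U eU (l X)" "x \<in> El U eU X"
    and u: "u' \<in> El Z e (l U)" "u \<in> El Z e U"
    and c: "\<And>i. i \<in> B \<Longrightarrow> u \<cdot> a i = c i" "u \<cdot> x = y" "y \<in> El Z e X" "\<And>i. i \<in> B \<Longrightarrow> c i \<in> El Z e (l X)"
    and d: "\<And>i. i \<in> B \<Longrightarrow> dv u' u (a i) = ze e (L X)" "dv u' u x = c k" "c k \<in> El Z e (l X)"
    and B: "finite B" "k \<notin> B"
  shows "dv u' u (at f a x B) = at f c y (insert k B)"
proof -
  obtain bs where bs: "distinct bs" "set bs = B" using finite_distinct_list B by blast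
  have "at f a x B = ntup C (map a bs) x \<cdot> F f (length bs)"
    by (rule at_eq[OF f a bs])
  then have "dv u' u (at f a x B) =
    dv (ntup C (map (dv u' u) (map a bs)) (dv u' u x)) (ntup C (map (\<lambda>z. u \<cdot> z) (map a bs)) (u \<cdot> x)) (F f (length bs))"
    using f a bs u by (simp only:) (rule dv_ntup_F; auto simp del: El_iff)
  also have "map (dv u' u) (map a bs) = replicate (length bs) (ze e (L X))"
    using d bs by (intro nth_equalityI) auto
  also have "map (\<lambda>z. u \<cdot> z) (map a bs) = map c bs" using c bs by auto
  finally have "dv u' u (at f a x B) =
    dv (ntup C (replicate (length bs) (ze e (L X))) (c k)) (ntup C (map c bs) y) (F f (length bs))"
    using c d by simp
  also have "\<dots> = ntup C (c k # map c bs) y \<cdot> F f (Suc (length bs))"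
    using c d bs by (intro ntup_F_Suc[OF f, symmetric]) (auto simp del: El_iff)
  also have "\<dots> = ntup C (map c (k # bs)) y \<cdot> F f (length (k # bs))" by simp
  also have "\<dots> = at f c y (insert k B)"
    using c d B bs by (intro at_eq[OF f, symmetric, of _ _ Z e]) (auto simp del: El_iff)
  finally show ?thesis .
qed

end

context gen_diff_restriction_structure
begin

text \<open>The last variable either forms a block of its own or joins an existing block.\<close>

lemma F_Cmp:
  assumes f: "f \<in> Ar C" "Dom C f = X" and g: "g \<in> Ar C" "Cod C f = Dom C g" and n: "n > 0"
  defines "p \<equiv> \<lambda>n i. nproj C (l X) n X i"
  shows "F (f \<cdot> g) n = hom_sum C (npow C (l X) n X) (L (Cod C g))
    (at_blocks g (at f (p n) (p n n)) (p n n \<cdot> f)) {P. partition_on {..<n} P}"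
  using n
proof (induction n rule: nat_induct_non_zero)
  case 1
  have X [simp]: "X \<in> Ob C" using f by auto
  let ?W = "l X \<boxtimes> X"
  let ?x = "Pr1 C (l X) X"
  have p: "p (Suc 0) 0 = Pr0 C (l X) X" "p (Suc 0) (Suc 0) = ?x" by (simp_all add: p_def)
  have at: "at f (p (Suc 0)) ?x {0} = D f"
    using f by (simp add: at_def p)
  have b: "at_blocks g (at f (p (Suc 0)) ?x) (?x \<cdot> f) {{0}} = \<langle>D f, ?x \<cdot> f\<rangle> \<cdot> D g"
  proof -
    have "partition_on {..<Suc 0} {{0}}" by (auto simp: partition_on_def disjoint_def)
    then have "at_blocks g (at f (p (Suc 0)) ?x) (?x \<cdot> f) {{0}} =
        ntup C (map (at f (p (Suc 0)) ?x) [{0}]) (?x \<cdot> f) \<cdot> F g (length [{0::nat}])"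
      using f g at by (intro at_blocks_eq[where e="Rst C (?x \<cdot> f)" and Z="?W", OF g(1) refl]) auto
    then show ?thesis using g at by simp
  qed
  have "F (f \<cdot> g) (Suc 0) = \<langle>D f, ?x \<cdot> f\<rangle> \<cdot> D g"
    using f g DR5[of f X "Dom C g" g "Cod C g"] by simp
  moreover have "{P. partition_on {..<Suc 0} P} = {{{0}}}"
    using partitions_insert[of 0 "{}"] by (auto simp: lessThan_Suc partition_on_empty refine_with_def)
  ultimately show ?case using f g by (simp add: p b)
next
  case (Suc n)
  have X [simp]: "X \<in> Ob C" using f by auto
  define Y where "Y = Dom C g"
  have Y [simp]: "Y \<in> Ob C" using g by (auto simp: Y_def)
  let ?Wn = "npow C (l X) n X" and ?W = "npow C (l X) (Suc n) X"
  let ?e = "Idn C ?W" and ?z = "zerom C (L X) ?W"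
  let ?p = "p n" and ?x = "p n n" and ?q = "p (Suc n)" and ?y = "p (Suc n) (Suc n)"
  have pE: "?p i \<in> El ?Wn (Idn C ?Wn) (l X)" if "i < n" for i using that by (simp add: p_def)
  have xE: "?x \<in> El ?Wn (Idn C ?Wn) X" by (simp add: p_def)
  have qE: "?q i \<in> El ?W ?e (l X)" if "i < Suc n" for i
    unfolding p_def El_iff using that nproj_simps[of "l X" X i "Suc n"] npow_Ob[of "l X" X "Suc n"] by (simp del: npow.simps nproj.simps)
  have yE: "?y \<in> El ?W ?e X"
    unfolding p_def El_iff using nproj_simps[of "l X" X "Suc n" "Suc n"] npow_Ob[of "l X" X "Suc n"] by (simp del: npow.simps nproj.simps)
  have WOb: "?W \<in> Ob C" by simp
  have ze: "ze ?e (L X) = ?z" using WOb by (intro ze_Idn) auto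
  have fg: "f \<cdot> g \<in> Ar C" "Dom C (f \<cdot> g) = X" using f g by auto
  obtain u' u where u'E': "u' \<in> El ?W ?e (l ?Wn)" and uE: "u \<in> El ?W ?e ?Wn"
    and up: "\<And>i. i \<le> n \<Longrightarrow> u \<cdot> ?p i = (if i < n then ?q i else ?y)"
    and dp: "\<And>i. i \<le> n \<Longrightarrow> dv u' u (?p i) = (if i < n then ?z else ?q n)"
    and FS: "F (f \<cdot> g) (Suc n) = dv u' u (F (f \<cdot> g) n)"
    using F_Suc_last[OF fg, of n] unfolding p_def by blast
  have u'E: "u' \<in> El ?W ?e (npow C (l X) n (l X))" using u'E' by simp
  have uf: "u \<cdot> (?x \<cdot> f) = ?y \<cdot> f"
    using up[of n] f uE xE by (subst assoc[symmetric]) auto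
  \<comment> \<open>Differentiating the base point of \<open>g\<close> creates the block that
    consists of the new variable alone.\<close>
  have df: "dv u' u (?x \<cdot> f) = at f ?q ?y {n}"
  proof -
    have "dv u' u (?x \<cdot> f) = dv (dv u' u ?x) (u \<cdot> ?x) f"
      using f u'E uE xE by (intro dv_Cmp) auto
    also have "\<dots> = dv (?q n) ?y f" using up[of n] dp[of n] by simp
    also have "\<dots> = at f ?q ?y {n}" using f by (simp add: at_def dv_def)
    finally show ?thesis .
  qed
  let ?a = "at f ?q ?y"
  let ?h = "at_blocks g ?a (?y \<cdot> f)"
  let ?e' = "Rst C (?y \<cdot> f)"
  have aE: "?a B \<in> El ?W ?e' (l Y)" if "B \<subseteq> {..<Suc n}" "B \<noteq> {}" for B
    using at_El[OF f, of B ?q ?W ?e ?y] qE yE that g finite_subset[OF that(1)]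
    by (simp add: subset_iff Y_def del: El_iff)
  have yfE: "?y \<cdot> f \<in> El ?W ?e' Y" using yE f g by (auto simp: Y_def)
  have hE: "?h P \<in> Hom C ?W (l (Cod C g))" if "partition_on {..<Suc n} P" for P
  proof -
    have "?a B \<in> El ?W ?e' (l Y)" if "B \<in> P" for B
      using \<open>partition_on _ P\<close> that by (intro aE) (auto simp: partition_on_def)
    then show ?thesis
      using at_blocks_El[OF g(1) Y_def[symmetric] that, of ?a ?W ?e' "?y \<cdot> f"] yfE El_Hom by blast
  qed
  \<comment> \<open>In the derivative of the term of \<open>P\<close>, the moving base point
    contributes the partition with the block \<open>{n}\<close> added, and the derivative of the
    argument of a block \<open>B\<close> contributes the partition in which \<open>n\<close> joins
    \<open>B\<close>.\<close>
  have step: "dv u' u (at_blocks g (at f ?p ?x) (?x \<cdot> f) P) =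
    addm C (L (Cod C g)) (?h (insert {n} P)) (hom_sum C ?W (L (Cod C g)) (\<lambda>B. ?h (insert (insert n B) (P - {B}))) P)"
    if P: "partition_on {..<n} P" for P
  proof -
    have Psub: "B \<subseteq> {..<n}" "B \<noteq> {}" "finite B" "n \<notin> B" if "B \<in> P" for B
    proof -
      show "B \<subseteq> {..<n}" "B \<noteq> {}" using P that by (auto simp: partition_on_def)
      then show "finite B" "n \<notin> B" by (auto intro: finite_subset)
    qed
    note Pfin = inj_on_Min_partition(2)[OF P]
    obtain bs where bs: "distinct bs" "set bs = P" using finite_distinct_list[OF Pfin] by blast
    let ?b = "at f ?p ?x"
    let ?eU = "Rst C (?x \<cdot> f)"
    have bE: "?b B \<in> El ?Wn ?eU (l Y)" if "B \<in> P" for B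
      using at_El[OF f, of B ?p ?Wn "Idn C ?Wn" ?x] pE xE Psub[OF that] g
      by (simp add: subset_iff Y_def del: El_iff)
    have xfE: "?x \<cdot> f \<in> El ?Wn ?eU Y" using xE f g by (auto simp: Y_def)
    have ub: "u \<cdot> ?b B = ?a B" if "B \<in> P" for B
    proof -
      let ?s = "sorted_list_of_set B"
      have s: "set ?s = B" using Psub[OF that] by simp
      have t: "ntup C (map ?p ?s) ?x \<in> Hom C ?Wn (npow C (l X) (card B) X)"
        using pE xE Psub[OF that] s by (intro ntup_Hom) (auto simp: subset_iff)
      have "u \<cdot> ?b B = (u \<cdot> ntup C (map ?p ?s) ?x) \<cdot> F f (card B)"
        unfolding at_def using t f uE by simp
      also have "u \<cdot> ntup C (map ?p ?s) ?x = ntup C (map (\<lambda>z. u \<cdot> z) (map ?p ?s)) (u \<cdot> ?x)"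
        using pE xE uE Psub[OF that] s by (intro cmp_ntup[where Z="?Wn" and A="l X" and X=X]) (auto simp: subset_iff)
      also have "map (\<lambda>z. u \<cdot> z) (map ?p ?s) = map ?q ?s"
        using up Psub[OF that] s by (auto simp: subset_iff)
      finally show ?thesis using up[of n] by (simp add: at_def)
    qed
    have db: "dv u' u (?b B) = ?a (insert n B)" if "B \<in> P" for B
    proof (rule dv_at[OF f, where U="?Wn" and eU="Idn C ?Wn" and Z="?W" and e="?e"])
      show "\<And>i. i \<in> B \<Longrightarrow> ?p i \<in> El ?Wn (Idn C ?Wn) (l X)" using pE Psub[OF that] by blast
      show "?x \<in> El ?Wn (Idn C ?Wn) X" by (rule xE)
      show "u' \<in> El ?W ?e (l ?Wn)" by (rule u'E')
      show "u \<in> El ?W ?e ?Wn" by (rule uE)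
      show "\<And>i. i \<in> B \<Longrightarrow> u \<cdot> ?p i = ?q i" using up Psub[OF that] by (auto simp: subset_iff)
      show "u \<cdot> ?x = ?y" using up[of n] by simp
      show "?y \<in> El ?W ?e X" by (rule yE)
      show "\<And>i. i \<in> B \<Longrightarrow> ?q i \<in> El ?W ?e (l X)" using qE Psub[OF that] by (meson lessThan_iff less_SucI subset_iff)
      show "\<And>i. i \<in> B \<Longrightarrow> dv u' u (?p i) = ze ?e (L X)" unfolding ze using dp Psub[OF that] by (auto simp: subset_iff)
      show "dv u' u ?x = ?q n" using dp[of n] by simp
      show "?q n \<in> El ?W ?e (l X)" by (rule qE) simp
    qed (use Psub[OF that] in auto)
    have "at_blocks g ?b (?x \<cdot> f) P = ntup C (map ?b bs) (?x \<cdot> f) \<cdot> F g (length bs)"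
      by (rule at_blocks_eq[OF g(1) Y_def[symmetric] P bE xfE bs])
    moreover have bsE: "\<forall>z\<in>set (map ?b bs). z \<in> El ?Wn ?eU (l (Dom C g))"
      using bE bs by (auto simp: Y_def simp del: El_iff)
    have "dv u' u (ntup C (map ?b bs) (?x \<cdot> f) \<cdot> F g (length bs)) =
      addm C (L (Cod C g)) (ntup C (dv u' u (?x \<cdot> f) # map (\<lambda>z. u \<cdot> z) (map ?b bs)) (u \<cdot> (?x \<cdot> f)) \<cdot> F g (Suc (length bs)))
      (hom_sum C ?W (L (Cod C g))
        (\<lambda>i. ntup C ((map (\<lambda>z. u \<cdot> z) (map ?b bs))[i := dv u' u (map ?b bs ! i)]) (u \<cdot> (?x \<cdot> f)) \<cdot> F g (length bs)) {..<length bs})"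
      using xfE by (intro dv_ntup_F_sum(1)[OF g(1) u'E' uE bsE]) (simp_all add: Y_def)
    moreover have mb: "map (\<lambda>z. u \<cdot> z) (map ?b bs) = map ?a bs" using ub bs by auto
    moreover have "ntup C (at f ?q ?y {n} # map ?a bs) (?y \<cdot> f) \<cdot> F g (Suc (length bs)) = ?h (insert {n} P)"
    proof -
      have "?h (insert {n} P) = ntup C (map ?a ({n} # bs)) (?y \<cdot> f) \<cdot> F g (length ({n} # bs))"
      proof (rule at_blocks_eq[OF g(1) Y_def[symmetric] _ _ yfE])
        have "insert {n} P \<in> refine_with n P" by (simp add: refine_with_def)
        then show pn: "partition_on {..<Suc n} (insert {n} P)"
          unfolding lessThan_Suc by (intro partition_refine_with(1)[OF P]) auto
        show "?a B \<in> El ?W ?e' (l Y)" if "B \<in> insert {n} P" for B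
          using pn that by (intro aE) (auto simp: partition_on_def)
        show "distinct ({n} # bs)" using bs Psub(4) by auto
      qed (use bs in simp)
      then show ?thesis by simp
    qed
    moreover have "hom_sum C ?W (L (Cod C g))
        (\<lambda>i. ntup C ((map ?a bs)[i := dv u' u (map ?b bs ! i)]) (?y \<cdot> f) \<cdot> F g (length bs)) {..<length bs} =
      hom_sum C ?W (L (Cod C g)) (\<lambda>B. ?h (insert (insert n B) (P - {B}))) P"
    proof -
      have pin: "partition_on {..<Suc n} (insert (insert n B) (P - {B}))" if "B \<in> P" for B
        unfolding lessThan_Suc using that
        by (intro partition_refine_with(1)[OF P]) (auto simp: refine_with_def)
      \<comment> \<open>The terms of the derivative are indexed by positions in the list
        \<open>bs\<close>, those of the partition sum by blocks.\<close>
      have bij: "bij_betw ((!) bs) {..<length bs} P" using bs by (intro bij_betw_nth) auto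
      have "hom_sum C ?W (L (Cod C g)) (\<lambda>B. ?h (insert (insert n B) (P - {B}))) P =
         hom_sum C ?W (L (Cod C g)) (\<lambda>B. ?h (insert (insert n B) (P - {B}))) ((!) bs ` {..<length bs})"
        using bij by (simp add: bij_betw_def)
      also have "\<dots> = hom_sum C ?W (L (Cod C g)) (\<lambda>i. ?h (insert (insert n (bs ! i)) (P - {bs ! i}))) {..<length bs}"
        using bij bs g WOb by (intro hom_sum_reindex hE pin) (auto simp: bij_betw_def simp del: npow.simps)
      also have "\<dots> = hom_sum C ?W (L (Cod C g))
        (\<lambda>i. ntup C ((map ?a bs)[i := dv u' u (map ?b bs ! i)]) (?y \<cdot> f) \<cdot> F g (length bs)) {..<length bs}"
      proof (rule hom_sum_cong[symmetric])
        fix i assume "i \<in> {..<length bs}"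
        then have i: "i < length bs" by simp
        then have iP: "bs ! i \<in> P" using bs by auto
        let ?bs = "bs[i := insert n (bs ! i)]"
        show "?h (insert (insert n (bs ! i)) (P - {bs ! i})) \<in> Hom C ?W (l (Cod C g))"
          by (rule hE[OF pin[OF iP]])
        have "?h (insert (insert n (bs ! i)) (P - {bs ! i})) = ntup C (map ?a ?bs) (?y \<cdot> f) \<cdot> F g (length ?bs)"
        proof (rule at_blocks_eq[OF g(1) Y_def[symmetric] pin[OF iP] _ yfE])
          show "?a B \<in> El ?W ?e' (l Y)" if "B \<in> insert (insert n (bs ! i)) (P - {bs ! i})" for B
            using pin[OF iP] that by (intro aE) (auto simp: partition_on_def)
          have "insert n (bs ! i) \<notin> set bs" using bs Psub(4) by auto
          then show "distinct ?bs" using bs by (intro distinct_list_update) auto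
          show "set ?bs = insert (insert n (bs ! i)) (P - {bs ! i})"
            using bs i by (simp add: set_update_distinct)
        qed
        then show "ntup C ((map ?a bs)[i := dv u' u (map ?b bs ! i)]) (?y \<cdot> f) \<cdot> F g (length bs) =
           ?h (insert (insert n (bs ! i)) (P - {bs ! i}))"
          using db[OF iP] i by (simp add: map_update)
      qed (use g WOb in auto)
      finally show ?thesis by simp
    qed
    ultimately show ?thesis by (simp only: df uf mb)
  qed
  have "F (f \<cdot> g) (Suc n) = dv u' u (hom_sum C ?Wn (L (Cod C g))
    (at_blocks g (at f ?p ?x) (?x \<cdot> f)) {P. partition_on {..<n} P})"
    by (simp only: FS Suc.IH)
  also have "\<dots> = hom_sum C (Dom C u) (L (Cod C g))
    (\<lambda>P. dv u' u (at_blocks g (at f ?p ?x) (?x \<cdot> f) P)) {P. partition_on {..<n} P}"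
  proof (rule dv_hom_sum)
    show "{P. partition_on {..<n} P} \<noteq> {}" using partition_on_singletons[of "{..<n}"] by blast
    fix P assume "P \<in> {P. partition_on {..<n} P}"
    then have P: "partition_on {..<n} P" by simp
    \<comment> \<open>Positivity of \<open>n\<close> makes \<open>P\<close> nonempty. For the empty
      partition the term would be a value of \<open>g\<close> itself, with codomain
      \<open>Cod C g\<close> instead of \<open>l (Cod C g)\<close>.\<close>
    obtain m where m: "n = Suc m" using Suc.hyps by (cases n) auto
    have "at f ?p ?x B \<in> El ?Wn (Rst C (?x \<cdot> f)) (l Y)" if "B \<in> P" for B
    proof -
      have "B \<subseteq> {..<n}" "B \<noteq> {}" using P that by (auto simp: partition_on_def)
      then show ?thesis
        using at_El[OF f, of B ?p ?Wn "Idn C ?Wn" ?x] pE xE g finite_subset[of B "{..<n}"]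
        by (simp add: subset_iff Y_def del: El_iff)
    qed
    moreover have "?x \<cdot> f \<in> El ?Wn (Rst C (?x \<cdot> f)) Y" using xE f g by (auto simp: Y_def)
    ultimately have "at_blocks g (at f ?p ?x) (?x \<cdot> f) P \<in> El ?Wn (Rst C ((?x \<cdot> f) \<cdot> g)) (l (Cod C g))"
      using P unfolding m by (intro at_blocks_El[OF g(1) Y_def[symmetric]])
    then show "at_blocks g (at f ?p ?x) (?x \<cdot> f) P \<in> Hom C ?Wn (l (Cod C g))" by (rule El_Hom)
  qed (use u'E uE g finite_partitions in auto)
  also have "\<dots> = hom_sum C ?W (L (Cod C g))
      (\<lambda>P. addm C (L (Cod C g)) (?h (insert {n} P))
        (hom_sum C ?W (L (Cod C g)) (\<lambda>B. ?h (insert (insert n B) (P - {B}))) P)) {P. partition_on {..<n} P}"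
  proof -
    have "addm C (L (Cod C g)) (?h (insert {n} P)) (hom_sum C ?W (L (Cod C g)) (\<lambda>B. ?h (insert (insert n B) (P - {B}))) P)
       \<in> Hom C ?W (l (Cod C g))" if P: "partition_on {..<n} P" for P
    proof -
      have pin: "partition_on {..<Suc n} Q" if "Q \<in> refine_with n P" for Q
        unfolding lessThan_Suc using that by (intro partition_refine_with(1)[OF P]) auto
      have "?h (insert {n} P) \<in> Hom C ?W (l (Cod C g))"
        by (intro hE pin) (auto simp: refine_with_def)
      moreover have "hom_sum C ?W (L (Cod C g)) (\<lambda>B. ?h (insert (insert n B) (P - {B}))) P \<in> Hom C ?W (l (Cod C g))"
        using g WOb by (intro hom_sum_Hom hE pin) (auto simp: refine_with_def)
      ultimately show ?thesis using g by simp
    qed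
    note H = this
    have Du: "Dom C u = ?W" using uE by simp
    have tY: "tcm (L (Cod C g))" using g by simp
    show ?thesis unfolding Du
      by (rule hom_sum_cong[OF tY WOb refl]) (unfold mem_Collect_eq; rule H step; assumption)+
  qed
  also have "\<dots> = hom_sum C ?W (L (Cod C g)) ?h {P. partition_on {..<Suc n} P}"
    using g WOb hE by (intro hom_sum_partitions_Suc[symmetric]) auto
  finally show ?case .
qed

end

section \<open>Argument lists of partial injections\<close>

text \<open>The argument list in a summand of \<open>delta_comp\<close>, with arbitrary entries in
  place of projections, so that substitution and differentiation can be carried out entry by
  entry.\<close>

definition inj_args :: "nat \<Rightarrow> nat \<Rightarrow> (nat \<Rightarrow> nat \<Rightarrow> 'm) \<Rightarrow> (nat \<Rightarrow> 'm) \<Rightarrow> (nat \<Rightarrow> 'm) \<Rightarrow> nat set \<Rightarrow> (nat \<Rightarrow> nat) \<Rightarrow> 'm list" where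
  "inj_args n r v w a S \<phi> =
    map (\<lambda>i. if i \<in> \<phi> ` S then v (the_inv_into S \<phi> i) i else a i) [0..<n] @ map w (filter (\<lambda>j. j \<notin> S) [0..<r])"

lemma length_inj_args:
  assumes "S \<subseteq> {..<r}"
  shows "length (inj_args n r v w a S \<phi>) = n + r - card S"
proof -
  have "length (filter (\<lambda>j. j \<notin> S) [0..<r]) = card ({..<r} - S)"
    by (subst distinct_card[symmetric]) (auto intro!: arg_cong[where f=card])
  also have "\<dots> = r - card S"
    using assms finite_subset[OF assms] by (simp add: card_Diff_subset)
  finally show ?thesis
    using card_mono[OF _ assms] by (simp add: inj_args_def)
qed

lemma set_inj_args:
  assumes p: "(S, \<phi>) \<in> partial_injections r n"
    and "\<And>j i. j < r \<Longrightarrow> i < n \<Longrightarrow> v j i \<in> E" "\<And>j. j < r \<Longrightarrow> w j \<in> E" "\<And>i. i < n \<Longrightarrow> a i \<in> E"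
  shows "\<forall>z\<in>set (inj_args n r v w a S \<phi>). z \<in> E"
proof -
  have "the_inv_into S \<phi> i < r" if "i \<in> \<phi> ` S" for i
    using the_inv_into_into[of \<phi> S i S] p that by (auto simp: partial_injections_def)
  then show ?thesis using assms by (auto simp: inj_args_def)
qed

lemma map_inj_args:
  assumes p: "(S, \<phi>) \<in> partial_injections r n"
    and "\<And>j i. j < r \<Longrightarrow> i < n \<Longrightarrow> h (v j i) = v' j i" "\<And>j. j < r \<Longrightarrow> h (w j) = w' j" "\<And>i. i < n \<Longrightarrow> h (a i) = a' i"
  shows "map h (inj_args n r v w a S \<phi>) = inj_args n r v' w' a' S \<phi>"
proof -
  have "the_inv_into S \<phi> i < r" if "i \<in> \<phi> ` S" for i
    using the_inv_into_into[of \<phi> S i S] p that by (auto simp: partial_injections_def)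
  then show ?thesis using assms by (auto simp: inj_args_def)
qed

text \<open>A further differentiation puts \<open>w r\<close> in front although its place is at the
  end; as multisets the lists agree, which suffices by symmetry.\<close>

lemma mset_inj_args_Suc:
  assumes p: "(S, \<phi>) \<in> partial_injections r n"
  shows "mset (w r # inj_args n r v w a S \<phi>) = mset (inj_args n (Suc r) v w a S \<phi>)"
proof -
  have "r \<notin> S" using p by (auto simp: partial_injections_def)
  then show ?thesis by (simp add: inj_args_def)
qed

text \<open>Replacing an untouched argument by \<open>v r i\<close> is the same as extending the
  injection by sending \<open>r\<close> to \<open>i\<close>.\<close>

lemma inj_args_update:
  assumes p: "(S, \<phi>) \<in> partial_injections r n" and i: "i < n" "i \<notin> \<phi> ` S"
  shows "(inj_args n r v w a S \<phi>)[i := v r i] = inj_args n (Suc r) v w a (insert r S) (\<phi>(r := i))"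
proof -
  have rS: "r \<notin> S" and inj: "inj_on \<phi> S" and S: "S \<subseteq> {..<r}" using p by (auto simp: partial_injections_def)
  let ?\<phi> = "\<phi>(r := i)"
  have im: "?\<phi> ` insert r S = insert i (\<phi> ` S)" using rS by auto
  have inj': "inj_on ?\<phi> (insert r S)" using inj i rS by (auto simp: inj_on_def)
  have 1: "the_inv_into (insert r S) ?\<phi> i = r"
    by (rule the_inv_into_f_eq[OF inj']) auto
  have 2: "the_inv_into (insert r S) ?\<phi> k = the_inv_into S \<phi> k" if "k \<in> \<phi> ` S" for k
  proof -
    note k = that
    obtain j where j: "j \<in> S" "k = \<phi> j" using k by blast
    have "the_inv_into (insert r S) ?\<phi> k = j"
      by (rule the_inv_into_f_eq[OF inj']) (use j rS in auto)
    moreover have "the_inv_into S \<phi> k = j"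
      by (rule the_inv_into_f_eq[OF inj]) (use j in auto)
    ultimately show ?thesis by simp
  qed
  have f: "filter (\<lambda>j. j \<notin> insert r S) [0..<Suc r] = filter (\<lambda>j. j \<notin> S) [0..<r]"
    by (auto intro: filter_cong)
  have m: "(map (\<lambda>k. if k \<in> \<phi> ` S then v (the_inv_into S \<phi> k) k else a k) [0..<n])[i := v r i] =
    map (\<lambda>k. if k \<in> insert i (\<phi> ` S) then v (the_inv_into (insert r S) ?\<phi> k) k else a k) [0..<n]"
    using 1 2 i by (intro nth_equalityI) (auto simp: nth_list_update)
  show ?thesis
    unfolding inj_args_def im f using m i by (simp add: list_update_append1)
qed

lemma (in crc) addm_Hom:
  "\<lbrakk>tcm M; a \<in> Hom C Z (Crr M); b \<in> Hom C Z (Crr M)\<rbrakk> \<Longrightarrow> addm C M a b \<in> Hom C Z (Crr M)"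
  by simp

context gen_diff_restriction_structure
begin

lemma zerom_nproj:
  assumes "A \<in> Ob C" "X \<in> Ob C" "W \<in> Ob C" "i \<le> n"
  shows "zerom C (L (npow C A n X)) W \<cdot> nproj C (l A) n (l X) i = zerom C (L (if i < n then A else X)) W"
proof -
  have "ntup C (replicate n (zerom C (L A) W)) (zerom C (L X) W) = zerom C (L (npow C A n X)) W"
    using ntup_ze[of A X "Idn C W" n] assms by simp
  moreover have "ntup C (replicate n (zerom C (L A) W)) (zerom C (L X) W) \<cdot> nproj C (l A) n (l X) i
     = (if i < n then replicate n (zerom C (L A) W) ! i else zerom C (L X) W)"
    using assms by (intro ntup_nproj[where Z=W and e="Idn C W"]) auto
  ultimately show ?thesis by auto
qed

section \<open>Derivatives of the iterated derivatives\<close>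

text \<open>
  Differentiating with respect to a new block \<open>(v\<^sup>r, w\<^sup>r)\<close> either adds the argument \<open>w\<^sup>r\<close> (\<open>r\<close> outside
  the domain of the injection) or replaces some \<open>a\<^sub>i\<close> by \<open>v\<^sup>r\<^sub>i\<close> (\<open>r\<close> is sent to \<open>i\<close>).
\<close>

lemma dv_inj_term:
  assumes f: "f \<in> Ar C" "Dom C f = X" and p: "(S, \<phi>) \<in> partial_injections r n" and n: "n > 0"
    and U: "\<And>j i. j < r \<Longrightarrow> i < n \<Longrightarrow> v j i \<in> El U eU (l X)" "\<And>j. j < r \<Longrightarrow> w j \<in> El U eU (l X)"
      "\<And>i. i < n \<Longrightarrow> a i \<in> El U eU (l X)" "x \<in> El U eU X"
    and u: "u' \<in> El Z e (l U)" "u \<in> El Z e U"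
    and c: "\<And>j i. j < r \<Longrightarrow> i < n \<Longrightarrow> u \<cdot> v j i = v' j i" "\<And>j. j < r \<Longrightarrow> u \<cdot> w j = w' j"
      "\<And>i. i < n \<Longrightarrow> u \<cdot> a i = a' i" "u \<cdot> x = x'"
    and d: "\<And>j i. j < r \<Longrightarrow> i < n \<Longrightarrow> dv u' u (v j i) = ze e (L X)" "\<And>j. j < r \<Longrightarrow> dv u' u (w j) = ze e (L X)"
      "\<And>i. i < n \<Longrightarrow> dv u' u (a i) = v' r i" "dv u' u x = w' r"
    and x': "x' \<in> El Z e X"
  shows "dv u' u (ntup C (inj_args n r v w a S \<phi>) x \<cdot> F f (n + r - card S)) =
    addm C (L (Cod C f)) (ntup C (inj_args n (Suc r) v' w' a' S \<phi>) x' \<cdot> F f (n + Suc r - card S))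
      (hom_sum C Z (L (Cod C f)) (\<lambda>i. ntup C (inj_args n (Suc r) v' w' a' (insert r S) (\<phi>(r := i))) x' \<cdot>
          F f (n + Suc r - card (insert r S))) ({..<n} - \<phi> ` S))"
proof -
  have S: "S \<subseteq> {..<r}" "r \<notin> S" "finite S" and \<phi>: "\<phi> ` S \<subseteq> {..<n}"
    using p by (auto simp: partial_injections_def PiE_iff finite_subset[of S "{..<r}"])
  let ?ls = "inj_args n r v w a S \<phi>" and ?ls' = "inj_args n r v' w' a' S \<phi>"
  define m where "m = n + r - card S"
  have card: "card S \<le> r" using card_mono[OF _ S(1)] by simp
  then have nm: "n \<le> m" "m \<noteq> 0" using n by (auto simp: m_def)
  have len: "length ?ls = m" "length ?ls' = m" using length_inj_args[OF S(1)] by (auto simp: m_def)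
  have els: "\<forall>z\<in>set ?ls. z \<in> El U eU (l (Dom C f))"
    unfolding f(2) using U by (intro set_inj_args[OF p])
  have xE: "x \<in> El U eU (Dom C f)" using U f by simp
  have mu: "map (\<lambda>z. u \<cdot> z) ?ls = ?ls'" using c by (intro map_inj_args[OF p])
  have e': "e = Rst C (u \<cdot> x)" using x' c by simp
  note sum = dv_ntup_F_sum[OF f(1) u els xE len(1) e', unfolded mu c(4) d(4) f(2)]
  have els': "\<forall>z\<in>set ?ls'. z \<in> El Z e (l X)" using sum(2) mu by (metis (no_types, lifting) imageE list.set_map)
  have wE: "w' r \<in> El Z e (l X)" by (rule sum(5))
  let ?t = "\<lambda>i. ntup C (?ls'[i := dv u' u (?ls ! i)]) x' \<cdot> F f m"
  let ?E = "Rst C (x' \<cdot> f)"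
  have xf: "x' \<in> El Z e (Dom C f)" using x' f by simp
  have tH: "?t i \<in> Hom C Z (l (Cod C f))" if "i < m" for i
  proof -
    have "dv u' u (?ls ! i) \<in> El Z e (l X)" using sum(4) that len by (meson nth_mem)
    then have "\<forall>z\<in>set (?ls'[i := dv u' u (?ls ! i)]). z \<in> El Z e (l (Dom C f))"
      unfolding f(2) by (intro ball_list_update els')
    then show ?thesis
      using ntup_F_simps[OF f(1) _ xf, of "?ls'[i := dv u' u (?ls ! i)]" m] len nm by simp
  qed
  have aE: "ntup C (w' r # ?ls') x' \<cdot> F f (Suc m) \<in> El Z ?E (l (Cod C f))"
    using ntup_F_simps[of f "w' r # ?ls'" Z e x' "Suc m"] wE els' xf f len by simp
  \<comment> \<open>Only the places that still hold some \<open>a i\<close> contribute: the entries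
    taken from \<open>v\<close> and \<open>w\<close> have derivative zero. The sum over all
    \<open>m\<close> places thus shrinks to the values not taken by the injection.\<close>
  have nth1: "?ls ! i = a i" if "i < n" "i \<notin> \<phi> ` S" for i
    using that by (simp add: inj_args_def nth_append)
  have nth2: "dv u' u (?ls ! i) = ze e (L X)" if "i < m" "\<not> i < n \<or> i \<in> \<phi> ` S" for i
  proof (cases "i < n")
    case True
    then have "i \<in> \<phi> ` S" using that by simp
    moreover from this have "the_inv_into S \<phi> i < r"
      using the_inv_into_into[of \<phi> S i S] p by (auto simp: partial_injections_def)
    ultimately show ?thesis using True d(1) by (simp add: inj_args_def nth_append)
  next
    case False
    then have "?ls ! i = map w (filter (\<lambda>j. j \<notin> S) [0..<r]) ! (i - n)"
      by (simp add: inj_args_def nth_append)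
    moreover have "i - n < length (filter (\<lambda>j. j \<notin> S) [0..<r])"
      using False that len by (simp add: inj_args_def)
    moreover from this have "filter (\<lambda>j. j \<notin> S) [0..<r] ! (i - n) < r"
      using nth_mem[of "i - n" "filter (\<lambda>j. j \<notin> S) [0..<r]"] by simp
    ultimately show ?thesis using d(2) by simp
  qed
  have "dv u' u (ntup C ?ls x \<cdot> F f m) =
    addm C (L (Cod C f)) (ntup C (w' r # ?ls') x' \<cdot> F f (Suc m)) (hom_sum C Z (L (Cod C f)) ?t {..<m})"
    by (rule sum(1))
  also have "\<dots> = addm C (L (Cod C f)) (ntup C (w' r # ?ls') x' \<cdot> F f (Suc m))
      (hom_sum C Z (L (Cod C f)) ?t ({..<n} - \<phi> ` S))"
  proof (rule addm_hom_sum_zeros[OF _ _ aE])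
    show "tcm (L (Cod C f))" "Z \<in> Ob C" using f u by auto
    show "{..<n} - \<phi> ` S \<subseteq> {..<m}" using nm by auto
    show "?t i \<in> Hom C Z (l (Cod C f))" if "i \<in> {..<m}" for i using tH that by simp
    show "?t i = ze ?E (L (Cod C f))" if "i \<in> {..<m} - ({..<n} - \<phi> ` S)" for i
    proof -
      have i: "i < m" "\<not> i < n \<or> i \<in> \<phi> ` S" using that by auto
      show ?thesis unfolding nth2[OF i] by (rule ntup_F_zero[OF f els' x' len(2) i(1)])
    qed
  qed simp
  also have "ntup C (w' r # ?ls') x' \<cdot> F f (Suc m) =
      ntup C (inj_args n (Suc r) v' w' a' S \<phi>) x' \<cdot> F f (n + Suc r - card S)"
  proof -
    have "Suc m = n + Suc r - card S" using card by (simp add: m_def)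
    moreover have "ntup C (w' r # ?ls') x' \<cdot> F f (Suc m) =
        ntup C (inj_args n (Suc r) v' w' a' S \<phi>) x' \<cdot> F f (Suc m)"
      using wE els' len by (intro ntup_F_perm[OF f mset_inj_args_Suc[OF p] _ x']) (auto simp del: El_iff)
    ultimately show ?thesis by simp
  qed
  also have "hom_sum C Z (L (Cod C f)) ?t ({..<n} - \<phi> ` S) =
    hom_sum C Z (L (Cod C f)) (\<lambda>i. ntup C (inj_args n (Suc r) v' w' a' (insert r S) (\<phi>(r := i))) x' \<cdot>
          F f (n + Suc r - card (insert r S))) ({..<n} - \<phi> ` S)"
  proof -
    have "?t i = ntup C (inj_args n (Suc r) v' w' a' (insert r S) (\<phi>(r := i))) x' \<cdot>
          F f (n + Suc r - card (insert r S))" if "i \<in> {..<n} - \<phi> ` S" for i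
    proof -
      have i: "i < n" "i \<notin> \<phi> ` S" using that by auto
      have "n + Suc r - card (insert r S) = m" using S by (simp add: m_def)
      then show ?thesis using inj_args_update[OF p i, of v' w' a'] nth1[OF i] d(3)[OF i(1)] by simp
    qed
    note eq = this
    show ?thesis
    proof (rule hom_sum_cong[symmetric])
      show "tcm (L (Cod C f))" "Z \<in> Ob C" using f u by auto
      fix i assume i: "i \<in> {..<n} - \<phi> ` S"
      then show "?t i \<in> Hom C Z (l (Cod C f))" using tH nm by auto
      show "ntup C (inj_args n (Suc r) v' w' a' (insert r S) (\<phi>(r := i))) x' \<cdot>
          F f (n + Suc r - card (insert r S)) = ?t i" by (rule eq[OF i, symmetric])
    qed simp
  qed
  finally show ?thesis unfolding m_def .
qed

text \<open>This is coassociativity in components. In the induction on \<open>r\<close> the new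
  block of variables is placed last by \<open>F_Suc_last\<close>, \<open>dv_inj_term\<close>
  differentiates each summand, and the result is regrouped as a sum over the larger set of partial
  injections.\<close>

lemma F_F:
  assumes f: "f \<in> Ar C" "Dom C f = X" and n: "n > 0"
  defines "A \<equiv> l X"
  defines "P \<equiv> npow C A n A" and "Q \<equiv> npow C A n X"
  defines "V \<equiv> \<lambda>r. nproj C P r Q"
  defines "v \<equiv> \<lambda>r j i. V r j \<cdot> nproj C A n A i" and "w \<equiv> \<lambda>r j. V r j \<cdot> nproj C A n A n"
    and "a \<equiv> \<lambda>r i. V r r \<cdot> nproj C A n X i" and "x \<equiv> \<lambda>r. V r r \<cdot> nproj C A n X n"
  shows "F (F f n) r = hom_sum C (npow C P r Q) (L (Cod C f))
    (\<lambda>(S, \<phi>). ntup C (inj_args n r (v r) (w r) (a r) S \<phi>) (x r) \<cdot> F f (n + r - card S)) (partial_injections r n)"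
proof (induction r)
  case 0
  have X [simp]: "X \<in> Ob C" using f by auto
  have A [simp]: "A \<in> Ob C" by (simp add: A_def)
  have a: "map (a 0) [0..<n] = map (nproj C A n X) [0..<n]"
    by (auto simp: a_def V_def Q_def)
  have x: "x 0 = nproj C A n X n" by (simp add: x_def V_def Q_def)
  have "inj_args n 0 (v 0) (w 0) (a 0) {} \<phi> = map (nproj C A n X) [0..<n]" for \<phi>
    by (simp add: inj_args_def a)
  then show ?case using f n by (simp add: partial_injections_0 x) (simp add: Q_def A_def)
next
  case (Suc r)
  have X [simp]: "X \<in> Ob C" using f by auto
  have A [simp]: "A \<in> Ob C" "l X = A" "L A = L X" by (simp_all add: A_def)
  have PQ [simp]: "P \<in> Ob C" "Q \<in> Ob C" "l Q = P" by (simp_all add: P_def Q_def)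
  have LY: "L (Cod C (F f n)) = L (Cod C f)" using f by simp
  let ?Y = "Cod C f" let ?W = "npow C P r Q" and ?W' = "npow C P (Suc r) Q"
  have W: "?W \<in> Ob C" "?W' \<in> Ob C" by simp_all
  have tY: "tcm (L ?Y)" using f by simp
  have VE: "V r j \<in> El (npow C P r Q) (Idn C (npow C P r Q)) (if j < r then P else Q)" if "j \<le> r" for r j
    unfolding V_def El_iff using that nproj_simps[of P Q j r] npow_Ob[of P Q r] by simp
  have FQ: "F f n \<in> Ar C" "Dom C (F f n) = Q" using f by (simp_all add: Q_def)
  have E: "j < r \<Longrightarrow> i < n \<Longrightarrow> v r j i \<in> El (npow C P r Q) (Idn C (npow C P r Q)) A"
    "j < r \<Longrightarrow> w r j \<in> El (npow C P r Q) (Idn C (npow C P r Q)) A"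
    "i < n \<Longrightarrow> a r i \<in> El (npow C P r Q) (Idn C (npow C P r Q)) A"
    "x r \<in> El (npow C P r Q) (Idn C (npow C P r Q)) X" for r j i
    using VE[of j r] VE[of r r] by (simp_all add: v_def w_def a_def x_def P_def Q_def)
  obtain u' u where u: "u' \<in> El ?W' (Idn C ?W') (l ?W)" "u \<in> El ?W' (Idn C ?W') ?W"
    and c: "\<And>i. i \<le> r \<Longrightarrow> u \<cdot> V r i = (if i < r then V (Suc r) i else V (Suc r) (Suc r))"
    and d: "\<And>i. i \<le> r \<Longrightarrow> dv u' u (V r i) = (if i < r then zerom C (L Q) ?W' else V (Suc r) r)"
    and FS: "F (F f n) (Suc r) = dv u' u (F (F f n) r)"
    using F_Suc_last[OF FQ, of r] unfolding V_def PQ(3) by blast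
  have cV: "u \<cdot> (V r j \<cdot> h) = (u \<cdot> V r j) \<cdot> h" if "j \<le> r" "h \<in> Ar C" "Dom C h = (if j < r then P else Q)" for j h
    using VE[OF that(1)] u that by simp
  have dV: "dv u' u (V r j \<cdot> h) = dv (dv u' u (V r j)) (u \<cdot> V r j) h"
    if "j \<le> r" "h \<in> Ar C" "Dom C h = (if j < r then P else Q)" for j h
    using VE[OF that(1)] u that by (intro dv_Cmp) auto
  have zn: "zerom C (L Q) ?W' \<cdot> nproj C A n A i = zerom C (L X) ?W'" if "i \<le> n" for i
    using zerom_nproj[of A X ?W' i n] that W by (simp add: Q_def[symmetric] del: npow.simps split: if_splits)
  have zn': "dv (zerom C (L P) ?W') (V (Suc r) j) (nproj C A n A i) = ze (Idn C ?W') (L X)"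
    if "i \<le> n" "j < r" for i j
  proof -
    have "dv (zerom C (L P) ?W') (V (Suc r) j) (nproj C A n A i) = zerom C (L P) ?W' \<cdot> nproj C (l A) n (l A) i"
      using VE[of j "Suc r"] that W by (intro dv_nproj) (auto simp: P_def simp del: npow.simps)
    also have "\<dots> = zerom C (L (if i < n then A else A)) ?W'"
      unfolding P_def[symmetric] using that W zerom_nproj[of A A ?W' i n]
      by (simp add: P_def[symmetric] del: npow.simps)
    finally show ?thesis using W by (simp del: npow.simps)
  qed
  \<comment> \<open>\<open>P\<close> is \<open>l Q\<close>, so both carry the same monoid by the
    axiom that \<open>L\<close> is unchanged on its carriers.\<close>
  have LQ: "L Q = L P" using L_L[of Q] by simp
  have step: "dv u' u (ntup C (inj_args n r (v r) (w r) (a r) S \<phi>) (x r) \<cdot> F f (n + r - card S)) =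
    addm C (L ?Y) (ntup C (inj_args n (Suc r) (v (Suc r)) (w (Suc r)) (a (Suc r)) S \<phi>) (x (Suc r)) \<cdot> F f (n + Suc r - card S))
      (hom_sum C ?W' (L ?Y) (\<lambda>i. ntup C (inj_args n (Suc r) (v (Suc r)) (w (Suc r)) (a (Suc r)) (insert r S) (\<phi>(r := i))) (x (Suc r)) \<cdot>
          F f (n + Suc r - card (insert r S))) ({..<n} - \<phi> ` S))"
    if p: "(S, \<phi>) \<in> partial_injections r n" for S \<phi>
  proof (rule dv_inj_term[OF f p n])
    show "u' \<in> El ?W' (Idn C ?W') (l ?W)" "u \<in> El ?W' (Idn C ?W') ?W" by (rule u)+
    show "u \<cdot> v r j i = v (Suc r) j i" if "j < r" "i < n" for j i
      using cV[of j "nproj C A n A i"] c[of j] that by (simp add: v_def P_def)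
    show "u \<cdot> w r j = w (Suc r) j" if "j < r" for j
      using cV[of j "nproj C A n A n"] c[of j] that by (simp add: w_def P_def)
    show "u \<cdot> a r i = a (Suc r) i" if "i < n" for i
      using cV[of r "nproj C A n X i"] c[of r] that by (simp add: a_def Q_def)
    show "u \<cdot> x r = x (Suc r)"
      using cV[of r "nproj C A n X n"] c[of r] by (simp add: x_def Q_def)
    show "dv u' u (v r j i) = ze (Idn C ?W') (L X)" if "j < r" "i < n" for j i
      using dV[of j "nproj C A n A i"] c[of j] d[of j] zn'[of i j] that LQ by (simp add: v_def P_def[symmetric] del: npow.simps)
    show "dv u' u (w r j) = ze (Idn C ?W') (L X)" if "j < r" for j
      using dV[of j "nproj C A n A n"] c[of j] d[of j] zn'[of n j] that LQ by (simp add: w_def P_def[symmetric] del: npow.simps)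
    have VS: "V (Suc r) r \<in> El ?W' (Idn C ?W') P" "V (Suc r) (Suc r) \<in> El ?W' (Idn C ?W') Q"
      using VE[of r "Suc r"] VE[of "Suc r" "Suc r"] by (simp_all del: npow.simps)
    \<comment> \<open>Projections are linear: differentiating the \<open>i\<close>-th entry of the
      point reads off the \<open>i\<close>-th entry of the direction, some \<open>v\<close> for
      \<open>i < n\<close> and \<open>w\<close> for \<open>i = n\<close>.\<close>
    have dn: "dv (V (Suc r) r) (V (Suc r) (Suc r)) (nproj C A n X i) = V (Suc r) r \<cdot> nproj C A n A i" if "i \<le> n" for i
      using dv_nproj[of "V (Suc r) r" "V (Suc r) (Suc r)" A X i n] VS that by (simp add: P_def Q_def del: npow.simps)
    show "dv u' u (a r i) = v (Suc r) r i" if "i < n" for i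
      using dV[of r "nproj C A n X i"] c[of r] d[of r] dn[of i] that by (simp add: a_def v_def Q_def[symmetric])
    show "dv u' u (x r) = w (Suc r) r"
      using dV[of r "nproj C A n X n"] c[of r] d[of r] dn[of n] by (simp add: x_def w_def Q_def[symmetric])
    show "x (Suc r) \<in> El ?W' (Idn C ?W') X" by (rule E)
  qed (use E in \<open>simp_all only: A(2)\<close>)
  let ?h = "\<lambda>r (S, \<phi>). ntup C (inj_args n r (v r) (w r) (a r) S \<phi>) (x r) \<cdot> F f (n + r - card S)"
  have hE: "?h r p \<in> Hom C (npow C P r Q) (l ?Y)" if p: "p \<in> partial_injections r n" for p r
  proof -
    obtain S \<phi> where p': "p = (S, \<phi>)" by (cases p)
    have S: "S \<subseteq> {..<r}" using p p' by (auto simp: partial_injections_def)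
    then have "card S \<le> r" using card_mono[OF _ S] by simp
    then have nz: "n + r - card S \<noteq> 0" using n by simp
    have el: "\<forall>z\<in>set (inj_args n r (v r) (w r) (a r) S \<phi>). z \<in> El (npow C P r Q) (Idn C (npow C P r Q)) (l (Dom C f))"
      unfolding f(2) A(2) using E by (intro set_inj_args[OF p[unfolded p']])
    have "x r \<in> El (npow C P r Q) (Idn C (npow C P r Q)) (Dom C f)" unfolding f(2) by (rule E)
    from ntup_F_simps[OF f(1) el this length_inj_args[OF S]] show ?thesis using nz p' by simp
  qed
  have "F (F f n) (Suc r) = dv u' u (hom_sum C ?W (L ?Y) (?h r) (partial_injections r n))"
    by (simp only: FS Suc.IH)
  also have "\<dots> = hom_sum C (Dom C u) (L ?Y) (\<lambda>p. dv u' u (?h r p)) (partial_injections r n)"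
    using u f hE finite_partial_injections partial_injections_nonempty
    by (intro dv_hom_sum) (auto simp del: npow.simps)
  also have "Dom C u = ?W'" using u by simp
  also have "hom_sum C ?W' (L ?Y) (\<lambda>p. dv u' u (?h r p)) (partial_injections r n) =
     hom_sum C ?W' (L ?Y) (\<lambda>p. addm C (L ?Y) (?h (Suc r) p)
        (hom_sum C ?W' (L ?Y) (\<lambda>i. ?h (Suc r) (insert r (fst p), (snd p)(r := i))) ({..<n} - snd p ` fst p)))
      (partial_injections r n)"
  proof (rule hom_sum_cong[OF tY W(2) refl])
    fix p assume p: "p \<in> partial_injections r n"
    obtain S \<phi> where p': "p = (S, \<phi>)" by (cases p)
    show "dv u' u (?h r p) = addm C (L ?Y) (?h (Suc r) p)
        (hom_sum C ?W' (L ?Y) (\<lambda>i. ?h (Suc r) (insert r (fst p), (snd p)(r := i))) ({..<n} - snd p ` fst p))"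
      using step[of S \<phi>] p unfolding p' by (simp only: case_prod_conv fst_conv snd_conv)
    have s: "p \<in> partial_injections (Suc r) n"
      "i \<in> {..<n} - snd p ` fst p \<Longrightarrow> (insert r (fst p), (snd p)(r := i)) \<in> partial_injections (Suc r) n" for i
      using p unfolding partial_injections_Suc by blast+
    have "hom_sum C ?W' (L ?Y) (\<lambda>i. ?h (Suc r) (insert r (fst p), (snd p)(r := i))) ({..<n} - snd p ` fst p)
      \<in> Hom C ?W' (l ?Y)"
      by (rule hom_sum_Hom[OF tY W(2)]) (rule hE[OF s(2)])
    from addm_Hom[OF tY hE[OF s(1)] this] show "addm C (L ?Y) (?h (Suc r) p)
        (hom_sum C ?W' (L ?Y) (\<lambda>i. ?h (Suc r) (insert r (fst p), (snd p)(r := i))) ({..<n} - snd p ` fst p))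
      \<in> Hom C ?W' (l ?Y)" .
  qed
  also have "\<dots> = hom_sum C ?W' (L ?Y) (?h (Suc r)) (partial_injections (Suc r) n)"
    by (rule hom_sum_partial_injections_Suc[OF tY W(2) hE, symmetric])
  finally show ?case .
qed

end

lemma Faa_simps [simp]:
  "Ob (Faa C) = faa_objs C" "Ar (Faa C) = faa_arrs C" "Dom (Faa C) = Fsrc" "Cod (Faa C) = Ftgt"
  "Idn (Faa C) = (\<lambda>S. faa_linear C S S (Idn C (snd S)) (Pr0 C (Crr (fst S)) (snd S)))"
  "Cmp (Faa C) = faa_comp C" "Rst (Faa C) = faa_restr C" "One (Faa C) = faa_one C"
  "Bang (Faa C) = faa_bang C" "Prd (Faa C) = faa_prod C" "Pr0 (Faa C) = faa_pr0 C"
  "Pr1 (Faa C) = faa_pr1 C" "Tup (Faa C) = faa_tup C"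
  by (simp_all add: Faa_def)

text \<open>\<open>e \<cdot> Rst C z = e\<close> expresses that \<open>e\<close> is below the domain
  of \<open>z\<close>; the domain of a tuple is the meet of the domains of its entries.\<close>

lemma (in crc) Rst_ntup_greatest:
  assumes "\<forall>z\<in>set zs. z \<in> Hom C Z A \<and> e \<cdot> Rst C z = e" "x \<in> Hom C Z X" "e \<cdot> Rst C x = e"
    "e \<in> Hom C Z Z"
  shows "e \<cdot> Rst C (ntup C zs x) = e"
  using assms
proof (induction zs)
  case (Cons z zs)
  have "ntup C zs x \<in> Hom C Z (npow C A (length zs) X)"
    using Cons by (intro ntup_Hom) auto
  then have "e \<cdot> Rst C (ntup C (z # zs) x) = e \<cdot> (Rst C z \<cdot> Rst C (ntup C zs x))"
    using Cons.prems by simp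
  also have "\<dots> = (e \<cdot> Rst C z) \<cdot> Rst C (ntup C zs x)"
    using Cons.prems \<open>ntup C zs x \<in> _\<close> by (intro assoc[symmetric]) auto
  also have "e \<cdot> Rst C z = e" using Cons.prems by simp
  finally show ?case using Cons by simp
qed simp

context gen_diff_restriction_structure
begin

section \<open>Higher derivatives of linear maps and of pairs\<close>

lemma dv_Rst_cmp:
  assumes s: "s \<in> Ar C" "t \<in> Ar C" "Dom C s = U" "Dom C t = U" and u: "u' \<in> El W e (l U)" "u \<in> El W e U"
  shows "dv u' u (Rst C s \<cdot> t) = dv (Rst C (u \<cdot> s) \<cdot> u') (Rst C (u \<cdot> s) \<cdot> u) t"
proof -
  have "dv u' u (Rst C s \<cdot> t) = dv (dv u' u (Rst C s)) (u \<cdot> Rst C s) t"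
    using s u by (intro dv_Cmp) auto
  also have "dv u' u (Rst C s) = Rst C (u \<cdot> s) \<cdot> u'" using s u by (intro dv_Rst) auto
  also have "u \<cdot> Rst C s = Rst C (u \<cdot> s) \<cdot> u" using s u by (intro cmp_Rst) auto
  finally show ?thesis .
qed

text \<open>Apart from its domain, \<open>D h\<close> does not depend on the base point, so
  differentiating once more in the \<open>X\<close> slot gives a restricted zero. The restriction in
  the assumption on \<open>D h\<close> is there to cover restriction idempotents along with
  identities, projections and monoid operations.\<close>

lemma F_linear:
  assumes h: "h \<in> Ar C" "Dom C h = X" "Cod C h = Y"
    and k: "k \<in> Ar C" "Dom C k = l X" "Cod C k = l Y" "Rst C k = Idn C (l X)" "D k = Pr0 C (l X) (l X) \<cdot> k"
    and Dh: "D h = Rst C (Pr1 C (l X) X \<cdot> h) \<cdot> (Pr0 C (l X) X \<cdot> k)" and n: "n \<ge> 2"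
  shows "F h n = Rst C (nproj C (l X) n X n \<cdot> h) \<cdot> zerom C (L Y) (npow C (l X) n X)"
  using n
proof (induction n rule: nat_induct_at_least)
  case base
  have X [simp]: "X \<in> Ob C" "Y \<in> Ob C" using h by auto
  let ?W = "npow C (l X) (Suc (Suc 0)) X" let ?q = "nproj C (l X) (Suc (Suc 0)) X"
  let ?e = "Idn C ?W" let ?Wn = "npow C (l X) (Suc 0) X"
  obtain u' u where u: "u' \<in> El ?W ?e (l ?Wn)" "u \<in> El ?W ?e ?Wn"
    and c: "\<And>i. i \<le> Suc 0 \<Longrightarrow> u \<cdot> nproj C (l X) (Suc 0) X i = (if i < Suc 0 then ?q i else ?q (Suc (Suc 0)))"
    and d: "\<And>i. i \<le> Suc 0 \<Longrightarrow> dv u' u (nproj C (l X) (Suc 0) X i) = (if i < Suc 0 then zerom C (L X) ?W else ?q (Suc 0))"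
    and F: "F h (Suc (Suc 0)) = dv u' u (F h (Suc 0))"
    using F_Suc_last[OF h(1,2), of "Suc 0"] by blast
  have c1: "u \<cdot> Pr1 C (l X) X = ?q (Suc (Suc 0))" using c[of "Suc 0"] by simp
  have Wn: "?Wn = l X \<boxtimes> X" and W: "?W \<in> Ob C" by simp_all
  have d0: "dv u' u (Pr0 C (l X) X) = zerom C (L X) ?W" using d[of 0] by simp
  have z: "u' \<cdot> Pr0 C (l X) (l X) = zerom C (L X) ?W"
  proof -
    have "dv u' u (Pr0 C (l X) X) = u' \<cdot> Pr0 C (l (l X)) (l X)" using u by (intro dv_Pr0) auto
    then show ?thesis using d0 by simp
  qed
  \<comment> \<open>\<open>k\<close> is its own derivative, so [DR.2] makes it preserve
    zero.\<close>
  have zk: "zerom C (L X) ?W \<cdot> k = zerom C (L Y) ?W"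
  proof -
    let ?z = "zerom C (L X) ?W"
    have zE: "?z \<in> El ?W ?e (l X)" using W by (simp del: npow.simps)
    have "dv (ze ?e (L (l X))) ?z k = ze (Rst C (?z \<cdot> k)) (L (Cod C k))"
      by (rule dv_ze_dir[OF k(1,2) zE])
    then have "dv ?z ?z k = zerom C (L Y) ?W" using k W by (simp del: npow.simps)
    moreover have "dv ?z ?z k = ?z \<cdot> k" using k W by (simp add: dv_def del: npow.simps)
    ultimately show ?thesis by simp
  qed
  let ?s = "Pr1 C (l X) X \<cdot> h"
  define R where "R = Rst C (u \<cdot> ?s)"
  define U' where "U' = R \<cdot> u'"
  define U where "U = R \<cdot> u"
  have us: "u \<cdot> ?s = ?q (Suc (Suc 0)) \<cdot> h"
  proof -
    have "u \<cdot> ?s = (u \<cdot> Pr1 C (l X) X) \<cdot> h" using u h by (intro assoc[symmetric]) auto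
    then show ?thesis by (simp only: c1)
  qed
  have R: "R \<in> El ?W R ?W" unfolding R_def using u h by (simp del: npow.simps add: Wn)
  have RR: "Rst C (R \<cdot> v) = R" if "v \<in> El ?W ?e V" for v V
    using R that Rst_Rst_cmp[of R v] by (simp del: npow.simps)
  have U': "U' \<in> El ?W R (l X \<boxtimes> l X)" unfolding U'_def using R u RR[OF u(1)] by (simp del: npow.simps add: Wn)
  have U: "U \<in> El ?W R (l X \<boxtimes> X)" unfolding U_def using R u RR[OF u(2)] by (simp del: npow.simps add: Wn)
  have zE: "zerom C (L X) ?W \<in> El ?W ?e (l X)" using W by (simp del: npow.simps)
  have RzE: "R \<cdot> zerom C (L X) ?W \<in> El ?W R (l X)" using zE R RR[OF zE] by (simp del: npow.simps)
  have "F h (Suc (Suc 0)) = dv u' u (Rst C ?s \<cdot> (Pr0 C (l X) X \<cdot> k))" using F h Dh by simp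
  also have "\<dots> = dv U' U (Pr0 C (l X) X \<cdot> k)"
    unfolding U'_def U_def R_def using u h k by (intro dv_Rst_cmp) (auto simp: Wn)
  also have "\<dots> = dv (dv U' U (Pr0 C (l X) X)) (U \<cdot> Pr0 C (l X) X) k"
    using U U' k by (intro dv_Cmp) auto
  also have "dv U' U (Pr0 C (l X) X) = U' \<cdot> Pr0 C (l (l X)) (l X)"
    using U U' by (intro dv_Pr0) auto
  also have "\<dots> = R \<cdot> (u' \<cdot> Pr0 C (l X) (l X))"
    unfolding U'_def L_l[OF X(1)] using u R by (intro assoc) (auto simp: Wn)
  also have "\<dots> = R \<cdot> zerom C (L X) ?W" by (simp only: z)
  also have "dv (R \<cdot> zerom C (L X) ?W) (U \<cdot> Pr0 C (l X) X) k = (R \<cdot> zerom C (L X) ?W) \<cdot> k"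
    unfolding dv_def k(2,5) by (rule Tup_Pr_assoc(1)) (use RzE U k in simp_all)
  also have "\<dots> = R \<cdot> (zerom C (L X) ?W \<cdot> k)"
    using R zE k by (intro assoc) auto
  also have "\<dots> = R \<cdot> zerom C (L Y) ?W" by (simp only: zk)
  finally have "F h (Suc (Suc 0)) = Rst C (?q (Suc (Suc 0)) \<cdot> h) \<cdot> zerom C (L Y) ?W"
    by (simp only: R_def us)
  then show ?case by (simp only: numeral_2_eq_2)
next
  case (Suc n)
  have X [simp]: "X \<in> Ob C" "Y \<in> Ob C" using h by auto
  let ?W = "npow C (l X) (Suc n) X" let ?q = "nproj C (l X) (Suc n) X"
  let ?e = "Idn C ?W" let ?Wn = "npow C (l X) n X" let ?x = "nproj C (l X) n X n"
  obtain u' u where u: "u' \<in> El ?W ?e (l ?Wn)" "u \<in> El ?W ?e ?Wn"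
    and c: "\<And>i. i \<le> n \<Longrightarrow> u \<cdot> nproj C (l X) n X i = (if i < n then ?q i else ?q (Suc n))"
    and "\<And>i. i \<le> n \<Longrightarrow> dv u' u (nproj C (l X) n X i) = (if i < n then zerom C (L X) ?W else ?q n)"
    and F: "F h (Suc n) = dv u' u (F h n)"
    using F_Suc_last[OF h(1,2), of n] by blast
  define R where "R = Rst C (u \<cdot> (?x \<cdot> h))"
  have W: "?Wn \<in> Ob C" "?W \<in> Ob C" by simp_all
  have us: "u \<cdot> (?x \<cdot> h) = ?q (Suc n) \<cdot> h"
  proof -
    have "u \<cdot> (?x \<cdot> h) = (u \<cdot> ?x) \<cdot> h" using u h by (intro assoc[symmetric]) auto
    then show ?thesis using c[of n] by simp
  qed
  have R: "R \<in> El ?W R ?W" unfolding R_def using u h by (simp del: npow.simps)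
  have RR: "Rst C (R \<cdot> v) = R" if "v \<in> El ?W ?e V" for v V
    using R that Rst_Rst_cmp[of R v] by (simp del: npow.simps)
  have "F h (Suc n) = dv u' u (Rst C (?x \<cdot> h) \<cdot> zerom C (L Y) ?Wn)"
    by (simp only: F Suc.IH)
  also have "\<dots> = dv (R \<cdot> u') (R \<cdot> u) (zerom C (L Y) ?Wn)"
    unfolding R_def using u h W by (intro dv_Rst_cmp) (auto simp del: npow.simps)
  also have "\<dots> = ze (Rst C (R \<cdot> u)) (L Y)"
    using u W R RR[OF u(1)] RR[OF u(2)] by (intro dv_zerom) (simp_all del: npow.simps)
  also have "\<dots> = R \<cdot> zerom C (L Y) ?W"
    using R RR[OF u(2)] by (simp add: ze_def del: npow.simps)
  finally show ?case by (simp only: R_def us)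
qed

lemma F_linear_total:
  assumes "h \<in> Ar C" "Dom C h = X" "Cod C h = Y" "Rst C h = Idn C X"
    and "k \<in> Ar C" "Dom C k = l X" "Cod C k = l Y" "Rst C k = Idn C (l X)" "D k = Pr0 C (l X) (l X) \<cdot> k"
    and "D h = Pr0 C (l X) X \<cdot> k"
  shows "F h n = Fseq (faa_linear C (L X, X) (L Y, Y) h (Pr0 C (l X) X \<cdot> k)) n"
proof -
  have [simp]: "X \<in> Ob C" "Y \<in> Ob C" using assms by auto
  consider "n = 0" | "n = 1" | "n \<ge> 2" by linarith
  then show ?thesis
  proof cases
    case 3
    then show ?thesis
      using F_linear[OF assms(1-3,5-9), of n] assms by (simp add: faa_linear_def)
  qed (use assms in \<open>simp_all add: faa_linear_def\<close>)
qed

lemma D_Idn [simp]: "X \<in> Ob C \<Longrightarrow> D (Idn C X) = Pr0 C (l X) X"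
  using D_eq_dv[of "Idn C X" X] by simp

lemma F_Tup:
  assumes "f \<in> Ar C" "g \<in> Ar C" "Dom C f = Dom C g"
  shows "F \<langle>f, g\<rangle> n = \<langle>F f n, F g n\<rangle>"
proof (induction n)
  case (Suc n)
  let ?X = "Dom C g" let ?P = "npow C (l ?X) n ?X" let ?W = "l ?X \<boxtimes> ?P"
  have t: "ntup C (replicate n (zerom C (L ?X) ?W)) (Pr0 C (l ?X) ?P) \<in> El ?W (Idn C ?W) (npow C (l ?X) n (l ?X))"
    using assms by (intro ntup_El) auto
  have "D \<langle>F f n, F g n\<rangle> = \<langle>D (F f n), D (F g n)\<rangle>"
    using assms by (intro DR4) (auto simp: Hom_iff)
  then show ?case
    unfolding F.simps(2) Suc Let_def using assms t by simp
qed simp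

section \<open>The coalgebra of a differential structure\<close>

definition coalg_ob :: "'o \<Rightarrow> ('o, 'm) fobj" where
  "coalg_ob X = (L X, X)"

definition coalg_ar :: "'m \<Rightarrow> ('o, 'm) farr" where
  "coalg_ar f = \<lparr>Fsrc = coalg_ob (Dom C f), Ftgt = coalg_ob (Cod C f), Fseq = F f\<rparr>"

lemma coalg_ob_in: "X \<in> Ob C \<Longrightarrow> coalg_ob X \<in> faa_objs C"
  by (simp add: coalg_ob_def faa_objs_def)

text \<open>Additivity in Faa is required for arguments with unrelated domains, while
  \<open>ntup_F_add\<close> and \<open>ntup_F_zero\<close> need a common one. Everything is
  restricted to a suitable \<open>e\<close>, and afterwards each side is shown to be unaffected by
  this restriction.\<close>

lemma F_additive:
  assumes f: "f \<in> Ar C" "Dom C f = X" "Cod C f = Y"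
  shows "additive_in C (L X) n X (L Y) (F f n)"
  unfolding additive_in_def
proof (intro ballI allI impI conjI)
  fix Z zs x i
  assume Z [simp]: "Z \<in> Ob C" and zs: "zs \<in> lists (Hom C Z (l X))" and x: "x \<in> Hom C Z X"
    and i: "i < n" and len: "length zs = n"
  have X [simp]: "X \<in> Ob C" "Y \<in> Ob C" using f by auto
  have zsH: "\<forall>z\<in>set zs. z \<in> Hom C Z (l X)" using zs by auto
  let ?t = "\<lambda>v. ntup C (zs[i := v]) x"
  have tH: "?t v \<in> Hom C Z (npow C (l X) n X)" if "v \<in> Hom C Z (l X)" for v
    using zsH x that len by (intro ntup_Hom ball_list_update) auto
  have cod: "Cod C (F f n) = l Y" using f i by simp
  have FH: "F f n \<in> Hom C (npow C (l X) n X) (l Y)" using f i by simp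
  show "?t (zerom C (L X) Z) \<cdot> F f n = Rst C (?t (zerom C (L X) Z) \<cdot> F f n) \<cdot> zerom C (L Y) Z"
  proof -
    let ?z = "zerom C (L X) Z"
    let ?as = "zs[i := ?z]"
    \<comment> \<open>Restricting the tuple to its own domain gives all arguments the domain
      \<open>e\<close> and turns the total zero in slot \<open>i\<close> into
      \<open>ze e (L X)\<close>.\<close>
    define e where "e = Rst C (?t ?z)"
    have asH: "\<forall>z\<in>set ?as. z \<in> Hom C Z (l X)" using zsH by (intro ball_list_update) auto
    note r = ntup_restrict[OF asH x e_def]
    let ?bs = "map (\<lambda>z. e \<cdot> z) ?as"
    have eE: "e \<in> El Z e Z" by (rule r(4))
    have eH: "e \<cdot> z \<in> El Z e W" if "z \<in> Hom C Z W" "e \<cdot> Rst C z = e" for z W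
      using that eE Rst_Rst_cmp[of e z] by auto
    have bsE: "\<forall>z\<in>set ?bs. z \<in> El Z e (l X)"
      using r(2) asH eH by (auto simp del: El_iff Hom_iff)
    have exE: "e \<cdot> x \<in> El Z e X" using r(3) x eH by blast
    have "?bs = ?bs[i := ze e (L X)]"
      using len i eE by (intro nth_equalityI) (auto simp: nth_list_update ze_def)
    then have "?t ?z \<cdot> F f n = ntup C (?bs[i := ze e (L X)]) (e \<cdot> x) \<cdot> F f n"
      using r(1) by simp
    also have "\<dots> = ze (Rst C ((e \<cdot> x) \<cdot> f)) (L Y)"
      using ntup_F_zero[OF f(1,2) bsE exE, of n i] len i f by simp
    also have "\<dots> = Rst C ((e \<cdot> x) \<cdot> f) \<cdot> zerom C (L Y) Z"
      using exE f by (simp add: ze_def)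
    also have "Rst C ((e \<cdot> x) \<cdot> f) = Rst C (ntup C ?bs (e \<cdot> x) \<cdot> F f n)"
      using bsE exE f len by (intro ntup_F_simps(4)[symmetric]) auto
    also have "ntup C ?bs (e \<cdot> x) = ?t ?z" by (rule r(1))
    finally show ?thesis .
  qed
  fix a b assume a: "a \<in> Hom C Z (l X)" and b: "b \<in> Hom C Z (l X)"
  let ?ab = "addm C (L X) a b"
  have ab: "?ab \<in> Hom C Z (l X)" using a b by simp
  \<comment> \<open>Both \<open>a\<close> and \<open>b\<close> have to contribute to the domain
    \<open>e\<close>, but the overwritten entry \<open>zs ! i\<close> must not; hence
    \<open>b\<close> is put in front of the list in which \<open>a\<close> has replaced it.\<close>
  let ?as = "b # zs[i := a]"
  define e where "e = Rst C (ntup C ?as x)"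
  have "\<forall>z\<in>set (zs[i := a]). z \<in> Hom C Z (l X)" by (rule ball_list_update[OF zsH a])
  then have asH: "\<forall>z\<in>set ?as. z \<in> Hom C Z (l X)" using b by (simp del: Hom_iff)
  note r = ntup_restrict[OF asH x e_def]
  have eE: "e \<in> El Z e Z" by (rule r(4))
  have eH: "e \<cdot> z \<in> El Z e W" if "z \<in> Hom C Z W" "e \<cdot> Rst C z = e" for z W
    using that eE Rst_Rst_cmp[of e z] by auto
  let ?bs = "map (\<lambda>z. e \<cdot> z) (zs[i := a])"
  have a_in: "a \<in> set (zs[i := a])" using i len by (simp add: set_update_memI)
  have aE: "e \<cdot> a \<in> El Z e (l X)" and bE: "e \<cdot> b \<in> El Z e (l X)"
    using r(2) a_in by (auto intro!: eH a b simp del: El_iff Hom_iff)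
  have bsE: "\<forall>z\<in>set ?bs. z \<in> El Z e (l X)"
    using r(2) asH eH by (auto simp del: El_iff Hom_iff)
  have exE: "e \<cdot> x \<in> El Z e X" using r(3) x eH by blast
  have et: "e \<cdot> ?t v = ntup C (?bs[i := e \<cdot> v]) (e \<cdot> x)" if v: "v \<in> Hom C Z (l X)" for v
  proof -
    have "e \<cdot> ?t v = ntup C (map (\<lambda>z. e \<cdot> z) (zs[i := v])) (e \<cdot> x)"
      using zsH x v eE by (intro cmp_ntup[where Z=Z and A="l X" and X=X] ball_list_update) auto
    then show ?thesis by (simp add: map_update)
  qed
  have key: "e \<cdot> (?t ?ab \<cdot> F f n) = e \<cdot> addm C (L Y) (?t a \<cdot> F f n) (?t b \<cdot> F f n)"
  proof -
    have "e \<cdot> (?t ?ab \<cdot> F f n) = ntup C (?bs[i := e \<cdot> ?ab]) (e \<cdot> x) \<cdot> F f n"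
      using et[OF ab] tH[OF ab] FH eE assoc[of e "?t ?ab" "F f n"] by (simp del: assoc)
    also have "e \<cdot> ?ab = addm C (L X) (e \<cdot> a) (e \<cdot> b)"
      using a b eE by (intro cmp_addm) auto
    also have "ntup C (?bs[i := addm C (L X) (e \<cdot> a) (e \<cdot> b)]) (e \<cdot> x) \<cdot> F f n =
      addm C (L Y) (ntup C (?bs[i := e \<cdot> a]) (e \<cdot> x) \<cdot> F f n) (ntup C (?bs[i := e \<cdot> b]) (e \<cdot> x) \<cdot> F f n)"
      using ntup_F_add[OF f(1,2) aE bE bsE exE, of n i] len i f by simp
    also have "\<dots> = addm C (L Y) (e \<cdot> (?t a \<cdot> F f n)) (e \<cdot> (?t b \<cdot> F f n))"
      using et[OF a] et[OF b] tH[OF a] tH[OF b] FH eE assoc[of e "?t a" "F f n"] assoc[of e "?t b" "F f n"]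
      by (simp del: assoc)
    also have "\<dots> = e \<cdot> addm C (L Y) (?t a \<cdot> F f n) (?t b \<cdot> F f n)"
      using tH[OF a] tH[OF b] FH eE by (intro cmp_addm[symmetric]) auto
    finally show ?thesis .
  qed
  have ta: "ntup C ?as x = \<langle>b, ?t a\<rangle>" by simp
  have e_eq: "e = Rst C b \<cdot> Rst C (?t a)"
    unfolding e_def ta using b tH[OF a] by simp
  have below: "Rst C (?t v) \<cdot> Rst C w = Rst C (?t v)" if v: "v \<in> Hom C Z (l X)" and w: "w \<in> set (zs[i := v])" for v w
    using ntup_restrict(2)[OF ball_list_update[of zs "\<lambda>z. z \<in> Hom C Z (l X)", OF zsH v] x refl] w by blast
  \<comment> \<open>\<open>a + b\<close> is defined only where both \<open>a\<close> and
    \<open>b\<close> are, so the domain of the tuple on the left is below \<open>e\<close>.\<close>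
  have 1: "e \<cdot> (?t ?ab \<cdot> F f n) = ?t ?ab \<cdot> F f n"
  proof -
    let ?r = "Rst C (?t ?ab)"
    have rH: "?r \<in> Hom C Z Z" using tH[OF ab] by simp
    have "?r \<cdot> Rst C ?ab = ?r" using below[OF ab] i len by (simp add: set_update_memI)
    then have rab: "?r \<cdot> (Rst C a \<cdot> Rst C b) = ?r" using a b by simp
    have ra: "?r \<cdot> Rst C a = ?r"
    proof -
      have "?r \<cdot> Rst C a = (?r \<cdot> (Rst C a \<cdot> Rst C b)) \<cdot> Rst C a" by (simp only: rab)
      also have "\<dots> = ?r \<cdot> (Rst C a \<cdot> Rst C b)"
        using a b rH tH[OF ab] by (simp add: Rst_commute[of b a])
      finally show ?thesis by (simp only: rab)
    qed
    have rb: "?r \<cdot> Rst C b = ?r"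
    proof -
      have "?r \<cdot> Rst C b = (?r \<cdot> (Rst C a \<cdot> Rst C b)) \<cdot> Rst C b" by (simp only: rab)
      also have "\<dots> = ?r \<cdot> (Rst C a \<cdot> Rst C b)"
        using a b rH tH[OF ab] by simp
      finally show ?thesis by (simp only: rab)
    qed
    have "z \<in> Hom C Z (l X) \<and> ?r \<cdot> Rst C z = ?r" if z: "z \<in> set ?as" for z
    proof -
      consider "z = a" | "z = b" | j where "j < n" "j \<noteq> i" "z = zs ! j"
      proof -
        from z consider "z = b" | k where "k < length (zs[i := a])" "z = zs[i := a] ! k"
          by (auto simp: in_set_conv_nth simp del: length_list_update)
        then show ?thesis
        proof cases
          case (2 k)
          then show ?thesis using that(1,3) len i by (cases "k = i") auto
        qed (rule that(2))
      qed
      then show ?thesis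
      proof cases
        case 3
        then have "z \<in> set (zs[i := ?ab])" using len by (metis length_list_update nth_list_update_neq nth_mem)
        then show ?thesis using below[OF ab] asH z by blast
      qed (use ra rb a b in simp_all)
    qed
    then have "?r \<cdot> e = ?r"
      unfolding e_def using x rH ntup_restrict(3)[OF ball_list_update[of zs "\<lambda>z. z \<in> Hom C Z (l X)", OF zsH ab] x refl]
      by (intro Rst_ntup_greatest[of _ Z "l X"]) blast+
    then have "e \<cdot> ?r = ?r"
      using Rst_commute[of e "?t ?ab"] eE tH[OF ab] by simp
    then have "e \<cdot> (?r \<cdot> ?t ?ab) = ?r \<cdot> ?t ?ab"
      using assoc[of e ?r "?t ?ab"] eE rH tH[OF ab] by (simp del: assoc Rst_absorb)
    then have "e \<cdot> ?t ?ab = ?t ?ab" using tH[OF ab] by simp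
    then show ?thesis using assoc[of e "?t ?ab" "F f n"] eE tH[OF ab] FH by (simp del: assoc)
  qed
  \<comment> \<open>The sum on the right is defined only where both summands are. The first forces
    the domain of the tuple with \<open>a\<close>, the second that of \<open>b\<close>, and
    \<open>e\<close> is their meet.\<close>
  have 2: "e \<cdot> addm C (L Y) (?t a \<cdot> F f n) (?t b \<cdot> F f n) = addm C (L Y) (?t a \<cdot> F f n) (?t b \<cdot> F f n)"
  proof -
    let ?ra = "Rst C (?t a \<cdot> F f n)" and ?rb = "Rst C (?t b \<cdot> F f n)"
    have A: "Rst C (?t a) \<cdot> ?ra = ?ra" using tH[OF a] FH by simp
    have ty: "Rst C b \<in> Hom C Z Z" "Rst C (?t a) \<in> Hom C Z Z" "Rst C (?t b) \<in> Hom C Z Z"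
      "?ra \<in> Hom C Z Z" "?rb \<in> Hom C Z Z" "?t a \<cdot> F f n \<in> Hom C Z (l Y)"
      using b tH[OF a] tH[OF b] FH by simp_all
    have "Rst C (?t b) \<cdot> Rst C b = Rst C (?t b)" using below[OF b] i len by (simp add: set_update_memI)
    then have H: "Rst C b \<cdot> Rst C (?t b) = Rst C (?t b)"
      using Rst_commute[of b "?t b"] b tH[OF b] by simp
    have tb: "Rst C (?t b) \<cdot> ?rb = ?rb" using tH[OF b] FH by simp
    have "Rst C b \<cdot> ?rb = Rst C b \<cdot> (Rst C (?t b) \<cdot> ?rb)" by (simp only: tb)
    also have "\<dots> = (Rst C b \<cdot> Rst C (?t b)) \<cdot> ?rb"
      by (intro assoc[symmetric]) (use ty in simp_all)
    finally have B: "Rst C b \<cdot> ?rb = ?rb" by (simp only: H tb)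
    have "e \<cdot> (?ra \<cdot> ?rb) = Rst C b \<cdot> (Rst C (?t a) \<cdot> (?ra \<cdot> ?rb))"
      unfolding e_eq by (intro assoc) (use ty in simp_all)
    also have "Rst C (?t a) \<cdot> (?ra \<cdot> ?rb) = (Rst C (?t a) \<cdot> ?ra) \<cdot> ?rb"
      by (intro assoc[symmetric]) (use ty in simp_all)
    also have "\<dots> = ?ra \<cdot> ?rb" by (simp only: A)
    also have "Rst C b \<cdot> (?ra \<cdot> ?rb) = ?ra \<cdot> (Rst C b \<cdot> ?rb)"
      by (intro Rst_left_commute) (use ty b in simp_all)
    finally have E: "e \<cdot> (?ra \<cdot> ?rb) = ?ra \<cdot> ?rb" by (simp only: B)
    let ?s = "addm C (L Y) (?t a \<cdot> F f n) (?t b \<cdot> F f n)"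
    have s: "?s \<in> Ar C" "Dom C ?s = Z" "Rst C ?s = ?ra \<cdot> ?rb"
      using tH[OF a] tH[OF b] FH by simp_all
    have "e \<cdot> ?s = e \<cdot> (Rst C ?s \<cdot> ?s)" by (simp only: Rst_absorb[OF s(1)])
    also have "\<dots> = (e \<cdot> Rst C ?s) \<cdot> ?s"
      by (rule assoc[symmetric]) (use s(1,2) eE in simp_all)
    also have "e \<cdot> Rst C ?s = Rst C ?s" using E by (simp only: s(3))
    finally show ?thesis by (simp only: Rst_absorb[OF s(1)])
  qed
  show "?t ?ab \<cdot> F f n = addm C (L Y) (?t a \<cdot> F f n) (?t b \<cdot> F f n)" using key 1 2 by simp
qed

lemma F_symmetric:
  assumes f: "f \<in> Ar C" "Dom C f = X"
  shows "symmetric_in C (l X) n X (F f n)"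
  unfolding symmetric_in_def
proof (intro allI impI)
  fix \<sigma> assume \<sigma>: "\<sigma> permutes {..<n}"
  have [simp]: "X \<in> Ob C" using f by auto
  let ?p = "nproj C (l X) n X"
  have \<sigma>n: "\<sigma> i < n" if "i < n" for i using permutes_in_image[OF \<sigma>, of i] that by simp
  have "map (\<lambda>i. ?p (\<sigma> i)) [0..<n] = permute_list \<sigma> (map ?p [0..<n])"
    using \<sigma>n by (auto simp: permute_list_def)
  then have "ntup C (map (\<lambda>i. ?p (\<sigma> i)) [0..<n]) (?p n) \<cdot> F f n = ntup C (map ?p [0..<n]) (?p n) \<cdot> F f n"
    using \<sigma> \<sigma>n f by (intro ntup_F_perm[where e="Idn C (npow C (l X) n X)" and Z="npow C (l X) n X"]) (auto simp: less_imp_le)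
  then show "ntup C (map (\<lambda>i. ?p (\<sigma> i)) [0..<n]) (?p n) \<cdot> F f n = F f n" using f by simp
qed

lemma coalg_ar_in: "f \<in> Ar C \<Longrightarrow> coalg_ar f \<in> faa_arrs C"
  using coalg_ob_in[of "Dom C f"] coalg_ob_in[of "Cod C f"] F_symmetric[of f] F_additive[of f]
  by (auto simp: faa_arrs_def coalg_ar_def coalg_ob_def)

end

context gen_diff_restriction_structure
begin

lemma faa_linear_simps [simp]:
  "Fsrc (faa_linear C S T h k) = S" "Ftgt (faa_linear C S T h k) = T"
  by (simp_all add: faa_linear_def)

lemma coalg_ar_linear:
  assumes "h \<in> Ar C" "Dom C h = X" "Cod C h = Y" "Rst C h = Idn C X"
    and "k \<in> Ar C" "Dom C k = l X" "Cod C k = l Y" "Rst C k = Idn C (l X)" "D k = Pr0 C (l X) (l X) \<cdot> k"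
    and "D h = Pr0 C (l X) X \<cdot> k"
  shows "coalg_ar h = faa_linear C (coalg_ob X) (coalg_ob Y) h (Pr0 C (l X) X \<cdot> k)"
proof (rule farr.equality)
  show "Fseq (coalg_ar h) = Fseq (faa_linear C (coalg_ob X) (coalg_ob Y) h (Pr0 C (l X) X \<cdot> k))"
    using F_linear_total[OF assms] by (auto simp: coalg_ar_def coalg_ob_def)
qed (use assms in \<open>simp_all add: coalg_ar_def\<close>)

lemma coalg_Idn: "X \<in> Ob C \<Longrightarrow> coalg_ar (Idn C X) = Idn (Faa C) (coalg_ob X)"
  using coalg_ar_linear[of "Idn C X" X X "Idn C (l X)"] by (simp add: coalg_ob_def)

lemma coalg_Pr0:
  "\<lbrakk>X \<in> Ob C; Y \<in> Ob C\<rbrakk> \<Longrightarrow> coalg_ar (Pr0 C X Y) = Pr0 (Faa C) (coalg_ob X) (coalg_ob Y)"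
  using coalg_ar_linear[of "Pr0 C X Y" "X \<boxtimes> Y" X "Pr0 C (l X) (l Y)"]
  by (simp add: coalg_ob_def faa_pr0_def faa_prod_def Let_def L_prod DR3_0)

lemma coalg_Pr1:
  "\<lbrakk>X \<in> Ob C; Y \<in> Ob C\<rbrakk> \<Longrightarrow> coalg_ar (Pr1 C X Y) = Pr1 (Faa C) (coalg_ob X) (coalg_ob Y)"
  using coalg_ar_linear[of "Pr1 C X Y" "X \<boxtimes> Y" Y "Pr1 C (l X) (l Y)"]
  by (simp add: coalg_ob_def faa_pr1_def faa_prod_def Let_def L_prod DR3_1)

lemma coalg_Bang: "X \<in> Ob C \<Longrightarrow> coalg_ar (Bang C X) = Bang (Faa C) (coalg_ob X)"
proof -
  assume X [simp]: "X \<in> Ob C"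
  have "F (Bang C X) n = Bang C (npow C (l X) n X)" for n
    by (rule to_One_eq) auto
  then show ?thesis by (auto simp: coalg_ar_def coalg_ob_def faa_bang_def faa_one_def L_one)
qed

lemma coalg_Tup:
  assumes "f \<in> Ar C" "g \<in> Ar C" "Dom C f = Dom C g"
  shows "coalg_ar \<langle>f, g\<rangle> = Tup (Faa C) (coalg_ar f) (coalg_ar g)"
  using assms F_Tup[OF assms]
  by (auto simp: coalg_ar_def faa_tup_def faa_prod_def coalg_ob_def L_prod)

lemma coalg_Rst:
  assumes f: "f \<in> Ar C"
  shows "coalg_ar (Rst C f) = Rst (Faa C) (coalg_ar f)"
proof -
  let ?X = "Dom C f"
  have D: "D (Rst C f) = Rst C (Pr1 C (l ?X) ?X \<cdot> f) \<cdot> Pr0 C (l ?X) ?X"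
    using conjunct2[OF DR8[of f ?X "Cod C f"]] f by simp
  have R: "Rst C (Pr1 C (l ?X) ?X \<cdot> Rst C f) = Rst C (Pr1 C (l ?X) ?X \<cdot> f)"
    using f by (intro Rst_cmp_Rst) auto
  have "F (Rst C f) n = Rst C (nproj C (l ?X) n ?X n \<cdot> f) \<cdot> zerom C (L ?X) (npow C (l ?X) n ?X)" if "n \<ge> 2" for n
  proof -
    have "Rst C (nproj C (l ?X) n ?X n \<cdot> Rst C f) = Rst C (nproj C (l ?X) n ?X n \<cdot> f)"
      using f by (intro Rst_cmp_Rst) auto
    moreover have "F (Rst C f) n = Rst C (nproj C (l ?X) n ?X n \<cdot> Rst C f) \<cdot> zerom C (L ?X) (npow C (l ?X) n ?X)"
    \<comment> \<open>By [DR.8] a restriction idempotent has, up to its domain, the derivative of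
      the identity.\<close>
    proof (rule F_linear[where k="Idn C (l ?X)"])
      show "D (Rst C f) = Rst C (Pr1 C (l ?X) ?X \<cdot> Rst C f) \<cdot> (Pr0 C (l ?X) ?X \<cdot> Idn C (l ?X))"
        unfolding D R using f by simp
    qed (use f that in simp_all)
    ultimately show ?thesis by simp
  qed
  then have "F (Rst C f) n = Fseq (faa_restr C (coalg_ar f)) n" for n
  proof -
    consider "n = 0" | "n = 1" | "n \<ge> 2" by linarith
    then show ?thesis
    proof cases
      case 3
      then show ?thesis using \<open>\<And>n. 2 \<le> n \<Longrightarrow> _ n\<close>[of n] by (simp add: faa_restr_def coalg_ar_def coalg_ob_def Let_def)
    qed (use f D in \<open>simp_all add: faa_restr_def coalg_ar_def coalg_ob_def Let_def\<close>)
  qed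
  then show ?thesis using f
    by (intro farr.equality) (auto simp: coalg_ar_def faa_restr_def coalg_ob_def Let_def)
qed

lemma coalg_Cmp:
  assumes f: "f \<in> Ar C" and g: "g \<in> Ar C" "Cod C f = Dom C g"
  shows "coalg_ar (f \<cdot> g) = Cmp (Faa C) (coalg_ar f) (coalg_ar g)"
proof (rule farr.equality)
  show "Fseq (coalg_ar (f \<cdot> g)) = Fseq (Cmp (Faa C) (coalg_ar f) (coalg_ar g))"
  proof
    fix n
    show "Fseq (coalg_ar (f \<cdot> g)) n = Fseq (Cmp (Faa C) (coalg_ar f) (coalg_ar g)) n"
    proof (cases "n = 0")
      case False
      then show ?thesis
        using F_Cmp[OF f refl g, of n] unfolding at_def at_blocks_def
        by (simp add: coalg_ar_def coalg_ob_def faa_comp_def Let_def)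
    qed (simp add: coalg_ar_def faa_comp_def Let_def)
  qed
qed (use f g in \<open>simp_all add: coalg_ar_def faa_comp_def Let_def\<close>)

lemma coalg_functor: "crc_functor C (Faa C) (restrict coalg_ob (Ob C)) (restrict coalg_ar (Ar C))"
proof
  show "restrict coalg_ob (Ob C) \<in> Ob C \<rightarrow>\<^sub>E Ob (Faa C)" by (simp add: coalg_ob_in)
  show "restrict coalg_ar (Ar C) \<in> Ar C \<rightarrow>\<^sub>E Ar (Faa C)" by (simp add: coalg_ar_in)
qed (simp_all add: coalg_Idn coalg_Pr0 coalg_Pr1 coalg_Bang coalg_Tup coalg_Rst coalg_Cmp
    del: Faa_simps(5-7,9,11-13),
  simp_all add: coalg_ar_def coalg_ob_def faa_one_def L_one faa_prod_def L_prod)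

lemma npow_coalg_ob:
  assumes "A \<in> Ob C" "X \<in> Ob C"
  shows "npow (Faa C) (coalg_ob A) n (coalg_ob X) = coalg_ob (npow C A n X)"
  using assms by (induction n) (auto simp: coalg_ob_def faa_prod_def L_prod)

lemma coalg_coassoc_ob:
  assumes X [simp]: "X \<in> Ob C"
  shows "delta_ob C (coalg_ob X) = Faa_ob coalg_ob coalg_ar (coalg_ob X)"
proof -
  have "coalg_ar (Add (L X)) = faa_linear C (coalg_ob (l X \<boxtimes> l X)) (coalg_ob (l X)) (Add (L X))
      (Pr0 C (l X \<boxtimes> l X) (l X \<boxtimes> l X) \<cdot> Add (L X))"
    using coalg_ar_linear[of "Add (L X)" "l X \<boxtimes> l X" "l X" "Add (L X)"] DR1_add[of X] by simp
  moreover have "coalg_ar (Zro (L X)) = faa_linear C (coalg_ob (One C)) (coalg_ob (l X)) (Zro (L X))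
      (Pr0 C (One C) (One C) \<cdot> Zro (L X))"
    using coalg_ar_linear[of "Zro (L X)" "One C" "l X" "Zro (L X)"] DR1_zero[of X] by simp
  ultimately show ?thesis
    by (simp add: delta_ob_def Faa_ob_def coalg_ob_def Let_def faa_prod_def faa_one_def L_one L_prod)
qed

text \<open>The components of the \<open>n\<close>-th entry are \<open>F (F f n) r\<close> on one
  side and the sums of \<open>delta_comp\<close> on the other; \<open>F_F\<close> equates them once
  its index set and argument lists are unfolded.\<close>

lemma coalg_coassoc_ar:
  assumes f: "f \<in> Ar C"
  shows "delta_ar C (coalg_ar f) = Faa_ar coalg_ob coalg_ar (coalg_ar f)"
proof (rule farr.equality)
  let ?X = "Dom C f" and ?Y = "Cod C f"
  have "delta_comp C (coalg_ar f) n = coalg_ar (F f n)" if n: "n > 0" for n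
  proof (rule farr.equality)
    have "npow (Faa C) (L ?X, l ?X) n (L ?X, ?X) = coalg_ob (npow C (l ?X) n ?X)"
      using npow_coalg_ob[of "l ?X" ?X n] f by (simp add: coalg_ob_def)
    then show "Fsrc (delta_comp C (coalg_ar f) n) = Fsrc (coalg_ar (F f n))"
      using f by (simp add: delta_comp_def coalg_ar_def Let_def) (simp add: coalg_ob_def)
    show "Ftgt (delta_comp C (coalg_ar f) n) = Ftgt (coalg_ar (F f n))"
      using f n by (simp add: delta_comp_def coalg_ar_def coalg_ob_def Let_def)
    show "Fseq (delta_comp C (coalg_ar f) n) = Fseq (coalg_ar (F f n))"
    proof
      fix r
      show "Fseq (delta_comp C (coalg_ar f) n) r = Fseq (coalg_ar (F f n)) r"
      proof (cases "r = 0")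
        case False
        then show ?thesis
          using F_F[OF f refl n, of r] unfolding inj_args_def partial_injections_def
          by (simp add: delta_comp_def coalg_ar_def coalg_ob_def Let_def)
      qed (simp add: delta_comp_def coalg_ar_def Let_def)
    qed
  qed simp
  then show "Fseq (delta_ar C (coalg_ar f)) = Fseq (Faa_ar coalg_ob coalg_ar (coalg_ar f))"
    by (auto simp: delta_ar_def Faa_ar_def coalg_ar_def[of f])
qed (use f in \<open>simp_all add: delta_ar_def Faa_ar_def coalg_coassoc_ob coalg_ar_def\<close>)

lemma coalg_coalgebra: "faa_coalgebra C (restrict coalg_ob (Ob C)) (restrict coalg_ar (Ar C))"
proof (intro faa_coalgebra.intro coalg_functor faa_coalgebra_axioms.intro)
  fix X assume X: "X \<in> Ob C"
  then show "eps_ob (restrict coalg_ob (Ob C) X) = X" by (simp add: eps_ob_def coalg_ob_def)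
  show "delta_ob C (restrict coalg_ob (Ob C) X) =
    Faa_ob (restrict coalg_ob (Ob C)) (restrict coalg_ar (Ar C)) (restrict coalg_ob (Ob C) X)"
    using X coalg_coassoc_ob[OF X] by (simp add: Faa_ob_def coalg_ob_def)
next
  fix f assume f: "f \<in> Ar C"
  then show "eps_ar (restrict coalg_ar (Ar C) f) = f" by (simp add: eps_ar_def coalg_ar_def)
  have "(restrict coalg_ar (Ar C)) (F f n) = coalg_ar (F f n)" for n using f by simp
  moreover have "Faa_ob (restrict coalg_ob (Ob C)) (restrict coalg_ar (Ar C)) (coalg_ob X) =
      Faa_ob coalg_ob coalg_ar (coalg_ob X)" if "X \<in> Ob C" for X
    using that by (simp add: Faa_ob_def coalg_ob_def)
  ultimately show "delta_ar C (restrict coalg_ar (Ar C) f) =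
    Faa_ar (restrict coalg_ob (Ob C)) (restrict coalg_ar (Ar C)) (restrict coalg_ar (Ar C) f)"
    using f coalg_coassoc_ar[OF f] by (simp add: Faa_ar_def coalg_ar_def[of f])
qed

end

context crc
begin

lemma symmetric_perm:
  assumes h: "symmetric_in C A n X h" "h \<in> Hom C (npow C A n X) B" and Ob: "A \<in> Ob C" "X \<in> Ob C"
    and el: "mset as = mset bs" "\<forall>z\<in>set as. z \<in> El Z e A" "x \<in> El Z e X" "length as = n"
  shows "ntup C as x \<cdot> h = ntup C bs x \<cdot> h"
proof -
  obtain \<sigma> where \<sigma>: "\<sigma> permutes {..<n}" "permute_list \<sigma> as = bs"
    using mset_eq_permutation[OF el(1)[symmetric]] el(4) by metis
  have \<sigma>n: "\<sigma> i < n" if "i < n" for i using permutes_in_image[OF \<sigma>(1), of i] that by simp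
  let ?p = "nproj C A n X" and ?P = "npow C A n X"
  define s where "s = ntup C (map (\<lambda>i. ?p (\<sigma> i)) [0..<n]) (?p n)"
  have s: "s \<in> El ?P (Idn C ?P) ?P"
    unfolding s_def using \<sigma>n Ob by (intro ntup_El) (auto simp: less_imp_le)
  have T: "ntup C as x \<in> El Z e ?P" using el by (intro ntup_El) auto
  have "ntup C as x \<cdot> s = ntup C (map (\<lambda>z. ntup C as x \<cdot> z) (map (\<lambda>i. ?p (\<sigma> i)) [0..<n])) (ntup C as x \<cdot> ?p n)"
    unfolding s_def using T \<sigma>n Ob by (intro cmp_ntup[where Z="?P" and A=A and X=X]) (auto simp: less_imp_le)
  also have "ntup C as x \<cdot> ?p n = x" using ntup_nproj[OF el(2-4), of n] Ob by simp
  also have "map (\<lambda>z. ntup C as x \<cdot> z) (map (\<lambda>i. ?p (\<sigma> i)) [0..<n]) = bs"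
    unfolding \<sigma>(2)[symmetric] permute_list_def el(4)
    using ntup_nproj[OF el(2-4)] \<sigma>n Ob by (intro nth_equalityI) (auto simp: less_imp_le)
  finally have "ntup C bs x \<cdot> h = (ntup C as x \<cdot> s) \<cdot> h" by simp
  also have "\<dots> = ntup C as x \<cdot> (s \<cdot> h)" using T s h by (intro assoc) auto
  also have "s \<cdot> h = h" using h(1) \<sigma>(1) by (simp add: symmetric_in_def s_def)
  finally show ?thesis by simp
qed

text \<open>The additivity condition is phrased with a total zero. Since \<open>x\<close> has domain
  \<open>e\<close>, so has the tuple, and restricting to \<open>e\<close> changes the total zero
  into \<open>ze e M\<close> and nothing else.\<close>

lemma ntup_update_zerom:
  assumes M: "tcm M" and el: "\<forall>z\<in>set zs. z \<in> El Z e (Crr M)" "x \<in> El Z e X"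
  shows "ntup C (zs[i := zerom C M Z]) x = ntup C (zs[i := ze e M]) x"
proof -
  let ?z = "zerom C M Z"
  have Z: "Z \<in> Ob C" using el by auto
  have zs: "\<forall>z\<in>set (zs[i := ?z]). z \<in> Hom C Z (Crr M) \<and> e \<cdot> Rst C z = e"
    using el M Z by (intro ball_list_update) auto
  then have zsH: "\<forall>z\<in>set (zs[i := ?z]). z \<in> Hom C Z (Crr M)" by blast
  have xH: "x \<in> Hom C Z X" and eH: "e \<in> Hom C Z Z" and ex: "e \<cdot> Rst C x = e" using el by auto
  let ?r = "Rst C (ntup C (zs[i := ?z]) x)"
  have tH: "ntup C (zs[i := ?z]) x \<in> Hom C Z (npow C (Crr M) (length zs) X)"
    using zsH xH by (intro ntup_Hom) auto
  have "e \<cdot> ?r = e" by (rule Rst_ntup_greatest[OF zs xH ex eH])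
  moreover have "?r \<cdot> e = ?r" using ntup_restrict(3)[OF zsH xH refl] el by simp
  moreover have "Rst C e \<cdot> ?r = ?r \<cdot> Rst C e" using Rst_commute[of e "ntup C (zs[i := ?z]) x"] tH eH by simp
  ultimately have "?r = e" using el by simp
  then have "e \<cdot> ntup C (zs[i := ?z]) x = ntup C (zs[i := ?z]) x"
    using tH by (intro Rst_absorb_eq) auto
  moreover have "e \<cdot> ntup C (zs[i := ?z]) x = ntup C (map (\<lambda>z. e \<cdot> z) (zs[i := ?z])) (e \<cdot> x)"
    using zsH xH eH by (intro cmp_ntup[where Z=Z and A="Crr M" and X=X]) auto
  moreover have "e \<cdot> x = x" using el by (intro Rst_absorb_eq) auto
  moreover have "map (\<lambda>z. e \<cdot> z) zs = zs"
    using el by (intro map_idI Rst_absorb_eq) auto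
  moreover have "e \<cdot> ?z = ze e M" using eH by (simp add: ze_def)
  ultimately show ?thesis by (simp add: map_update)
qed

end

section \<open>The differential structure of a coalgebra\<close>

locale coalg = faa_coalgebra C Do Da + crc C
  for C :: "('o, 'm) crcat" (structure) and Do Da
begin

abbreviation L where "L X \<equiv> fst (Do X)"
abbreviation l where "l X \<equiv> Crr (L X)"
abbreviation S where "S f n \<equiv> Fseq (Da f) n"

lemma Do_eq: "X \<in> Ob C \<Longrightarrow> Do X = (L X, X)"
  using counit_ob[of X] by (simp add: eps_ob_def prod_eq_iff)

lemma L_tcm [simp]: "X \<in> Ob C \<Longrightarrow> tcm (L X)"
  using Fo_Ob Do_eq[of X] by (auto simp: faa_objs_def PiE_iff)

lemma Da_src_tgt:
  "f \<in> Ar C \<Longrightarrow> Fsrc (Da f) = (L (Dom C f), Dom C f)" "f \<in> Ar C \<Longrightarrow> Ftgt (Da f) = (L (Cod C f), Cod C f)"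
  using Fa_Dom[of f] Fa_Cod[of f] Do_eq[of "Dom C f"] Do_eq[of "Cod C f"] by simp_all

lemma S_0 [simp]: "f \<in> Ar C \<Longrightarrow> S f 0 = f"
  using counit_ar[of f] by (simp add: eps_ar_def)

lemma S_props:
  assumes f: "f \<in> Ar C" "Dom C f = X" "Cod C f = Y" and n: "n > 0"
  shows "S f n \<in> Hom C (npow C (l X) n X) (l Y)" "Rst C (S f n) = Rst C (nproj C (l X) n X n \<cdot> f)"
    "symmetric_in C (l X) n X (S f n)" "additive_in C (L X) n X (L Y) (S f n)"
proof -
  have "Da f \<in> faa_arrs C" using Fa_Ar f by auto
  then show "S f n \<in> Hom C (npow C (l X) n X) (l Y)" "Rst C (S f n) = Rst C (nproj C (l X) n X n \<cdot> f)"
    "symmetric_in C (l X) n X (S f n)" "additive_in C (L X) n X (L Y) (S f n)"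
    using f n Da_src_tgt[of f] by (auto simp: faa_arrs_def Let_def)
qed

lemma S_simps [simp]:
  assumes "f \<in> Ar C"
  shows "S f n \<in> Ar C" "Dom C (S f n) = npow C (l (Dom C f)) n (Dom C f)"
    "Cod C (S f n) = (if n = 0 then Cod C f else l (Cod C f))"
    "Rst C (S f n) = Rst C (nproj C (l (Dom C f)) n (Dom C f) n \<cdot> f)"
  using S_props[of f "Dom C f" "Cod C f" n] assms by (cases "n = 0"; simp)+

lemma coassoc_ob_components:
  assumes X: "X \<in> Ob C"
  shows "L (l X) = L X" "S (Add (L X)) 1 = Pr0 C (l X \<boxtimes> l X) (l X \<boxtimes> l X) \<cdot> Add (L X)"
    "S (Zro (L X)) 1 = Pr0 C (One C) (One C) \<cdot> Zro (L X)"
proof -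
  note eq = coassoc_ob[OF X]
  have "Do (l X) = Crr (fst (delta_ob C (Do X)))" unfolding eq by (simp add: Faa_ob_def)
  then show "L (l X) = L X" by (simp add: delta_ob_def Let_def)
  have "Da (Add (L X)) = Add (fst (delta_ob C (Do X)))" unfolding eq by (simp add: Faa_ob_def)
  then show "S (Add (L X)) 1 = Pr0 C (l X \<boxtimes> l X) (l X \<boxtimes> l X) \<cdot> Add (L X)"
    by (simp add: delta_ob_def Let_def faa_linear_def)
  have "Da (Zro (L X)) = Zro (fst (delta_ob C (Do X)))" unfolding eq by (simp add: Faa_ob_def)
  then show "S (Zro (L X)) 1 = Pr0 C (One C) (One C) \<cdot> Zro (L X)"
    by (simp add: delta_ob_def Let_def faa_linear_def)
qed

lemma L_l [simp]: "X \<in> Ob C \<Longrightarrow> L (l X) = L X" by (rule coassoc_ob_components)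

lemma L_Prd: "\<lbrakk>X \<in> Ob C; Y \<in> Ob C\<rbrakk> \<Longrightarrow> L (X \<boxtimes> Y) = prod_imonoid C (L X) (L Y)"
  using Fo_Prd[of X Y] by (simp add: faa_prod_def)

lemma L_One: "L (One C) = one_imonoid C"
  using Fo_One by (simp add: faa_one_def)

lemma l_Prd [simp]: "\<lbrakk>X \<in> Ob C; Y \<in> Ob C\<rbrakk> \<Longrightarrow> l (X \<boxtimes> Y) = l X \<boxtimes> l Y"
  by (simp add: L_Prd)

lemma l_One [simp]: "l (One C) = One C" by (simp add: L_One one_imonoid_def)

lemma l_npow [simp]: "\<lbrakk>A \<in> Ob C; X \<in> Ob C\<rbrakk> \<Longrightarrow> l (npow C A n X) = npow C (l A) n (l X)"
  by (induction n) auto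

lemma ntup_S_simps [simp]:
  assumes f: "f \<in> Ar C" and el: "\<forall>z\<in>set as. z \<in> El Z e (l (Dom C f))" "x \<in> El Z e (Dom C f)" "length as = n"
  shows "ntup C as x \<cdot> S f n \<in> Ar C" "Dom C (ntup C as x \<cdot> S f n) = Z"
    "Cod C (ntup C as x \<cdot> S f n) = (if n = 0 then Cod C f else l (Cod C f))"
    "Rst C (ntup C as x \<cdot> S f n) = Rst C (x \<cdot> f)"
  using ntup_cmp_simps[OF _ _ _ _ refl el, of "S f n"] f by simp_all

lemma ntup_S_zero:
  assumes f: "f \<in> Ar C" "Dom C f = X" and n: "i < n"
    and el: "\<forall>z\<in>set as. z \<in> El Z e (l X)" "x \<in> El Z e X" "length as = n"
  shows "ntup C (as[i := ze e (L X)]) x \<cdot> S f n = ze (Rst C (x \<cdot> f)) (L (Cod C f))"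
proof -
  have X [simp]: "X \<in> Ob C" "Z \<in> Ob C" using f el by auto
  let ?t = "ntup C (as[i := ze e (L X)]) x"
  have "ntup C (as[i := zerom C (L X) Z]) x \<cdot> S f n =
      Rst C (ntup C (as[i := zerom C (L X) Z]) x \<cdot> S f n) \<cdot> zerom C (L (Cod C f)) Z"
  proof -
    have "as \<in> lists (Hom C Z (l X))" using el by auto
    then show ?thesis
      using S_props(4)[OF f refl, of n] n el unfolding additive_in_def by (auto simp del: in_lists_conv_set)
  qed
  also have "ntup C (as[i := zerom C (L X) Z]) x = ?t"
    by (rule ntup_update_zerom) (use el in auto)
  finally have *: "?t \<cdot> S f n = Rst C (?t \<cdot> S f n) \<cdot> zerom C (L (Cod C f)) Z" .
  have "\<forall>z\<in>set (as[i := ze e (L X)]). z \<in> El Z e (l (Dom C f))"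
    using el f by (intro ball_list_update) auto
  then have R: "Rst C (?t \<cdot> S f n) = Rst C (x \<cdot> f)"
    using ntup_S_simps(4)[OF f(1), of "as[i := ze e (L X)]" Z e x n] el f by simp
  have "Rst C (x \<cdot> f) \<cdot> zerom C (L (Cod C f)) Z = ze (Rst C (x \<cdot> f)) (L (Cod C f))"
    using el f by (simp add: ze_def)
  then show ?thesis using * unfolding R by simp
qed

lemma ntup_S_perm:
  assumes "f \<in> Ar C" "Dom C f = X" "mset as = mset bs" "\<forall>z\<in>set as. z \<in> El Z e (l X)" "x \<in> El Z e X"
    "length as = n" "n > 0"
  shows "ntup C as x \<cdot> S f n = ntup C bs x \<cdot> S f n"
  using assms S_props[OF assms(1,2) refl assms(7)]
  by (intro symmetric_perm[of "l X" n X "S f n" "l (Cod C f)"]) auto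

text \<open>Coassociativity at \<open>r = 1\<close>.\<close>

lemma S_S_1:
  assumes f: "f \<in> Ar C" "Dom C f = X" and n: "n > 0"
    and el: "\<forall>z\<in>set vs. z \<in> El Z e (l X)" "w \<in> El Z e (l X)" "\<forall>z\<in>set as. z \<in> El Z e (l X)" "x \<in> El Z e X"
      "length vs = n" "length as = n"
  shows "\<langle>ntup C vs w, ntup C as x\<rangle> \<cdot> S (S f n) 1 =
    addm C (L (Cod C f)) (ntup C (w # as) x \<cdot> S f (Suc n))
      (hom_sum C Z (L (Cod C f)) (\<lambda>i. ntup C (as[i := vs ! i]) x \<cdot> S f n) {..<n})"
proof -
  have X [simp]: "X \<in> Ob C" "Z \<in> Ob C" using f el by auto
  define A where "A = l X"
  have A [simp]: "A \<in> Ob C" "l X = A" by (simp_all add: A_def)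
  define P where "P = npow C A n A"
  define Q where "Q = npow C A n X"
  have PQ [simp]: "P \<in> Ob C" "Q \<in> Ob C" by (simp_all add: P_def Q_def)
  let ?Y = "Cod C f" let ?W = "P \<boxtimes> Q"
  have tY: "tcm (L ?Y)" using f by simp
  let ?v = "\<lambda>(j::nat) i. Pr0 C P Q \<cdot> nproj C A n A i" and ?w = "\<lambda>j::nat. Pr0 C P Q \<cdot> nproj C A n A n"
    and ?a = "\<lambda>i. Pr1 C P Q \<cdot> nproj C A n X i" and ?x = "Pr1 C P Q \<cdot> nproj C A n X n"
  let ?h = "\<lambda>(S', \<phi>). ntup C (inj_args n 1 ?v ?w ?a S' \<phi>) ?x \<cdot> S f (n + 1 - card S')"
  have hH: "?h p \<in> Hom C ?W (l ?Y)" if p: "p \<in> partial_injections 1 n" for p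
  proof -
    obtain S' \<phi> where p': "p = (S', \<phi>)" by (cases p)
    have S': "S' \<subseteq> {..<1}" using p p' by (auto simp: partial_injections_def)
    have "\<forall>z\<in>set (inj_args n 1 ?v ?w ?a S' \<phi>). z \<in> El ?W (Idn C ?W) (l (Dom C f))"
      unfolding f(2) A(2) using p unfolding p' by (intro set_inj_args) (auto simp: P_def Q_def)
    moreover have "?x \<in> El ?W (Idn C ?W) (Dom C f)" using f by (auto simp: Q_def)
    moreover have "n + 1 - card S' \<noteq> 0"
    proof -
      have "card S' \<le> 1" using card_mono[OF _ S'] by simp
      then show ?thesis using n by simp
    qed
    ultimately show "?h p \<in> Hom C ?W (l ?Y)"
      using ntup_S_simps[of f "inj_args n 1 ?v ?w ?a S' \<phi>" ?W "Idn C ?W" ?x "n + 1 - card S'"]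
        length_inj_args[OF S', of n ?v ?w ?a \<phi>] f p' by simp
  qed
  have "delta_comp C (Da f) n = Da (S f n)"
  proof -
    have "Fseq (delta_ar C (Da f)) n = Fseq (Faa_ar Do Da (Da f)) n" using coassoc_ar[OF f(1)] by simp
    then show ?thesis using n by (simp add: delta_ar_def Faa_ar_def)
  qed
  then have "S (S f n) 1 = Fseq (delta_comp C (Da f) n) 1" by simp
  also have "\<dots> = hom_sum C ?W (L ?Y)
     (\<lambda>(S', \<phi>). ntup C (inj_args n 1 (\<lambda>j i. nproj C P 1 Q j \<cdot> nproj C A n A i) (\<lambda>j. nproj C P 1 Q j \<cdot> nproj C A n A n)
        (\<lambda>i. nproj C P 1 Q 1 \<cdot> nproj C A n X i) S' \<phi>) (nproj C P 1 Q 1 \<cdot> nproj C A n X n) \<cdot> S f (n + 1 - card S')) (partial_injections 1 n)"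
    using Da_src_tgt[OF f(1)] f(2)
    by (simp add: delta_comp_def Let_def inj_args_def partial_injections_def P_def Q_def)
  also have "\<dots> = hom_sum C ?W (L ?Y) ?h (partial_injections 1 n)"
  proof (rule hom_sum_cong[OF tY _ refl])
    show "?W \<in> Ob C" by simp
    fix p assume p: "p \<in> partial_injections 1 n"
    obtain S' \<phi> where p': "p = (S', \<phi>)" by (cases p)
    have S': "S' \<subseteq> {..<1}" using p p' by (auto simp: partial_injections_def)
    \<comment> \<open>\<open>map_inj_args\<close> with \<open>id\<close> rewrites the entries: for a
      single block, \<open>nproj C P 1 Q\<close> at 0 and at 1 amounts to the two binary
      projections.\<close>
    have eq: "inj_args n 1 (\<lambda>j i. nproj C P 1 Q j \<cdot> nproj C A n A i) (\<lambda>j. nproj C P 1 Q j \<cdot> nproj C A n A n)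
        (\<lambda>i. nproj C P 1 Q 1 \<cdot> nproj C A n X i) S' \<phi> = map id (inj_args n 1 ?v ?w ?a S' \<phi>)"
      using p unfolding p' by (intro map_inj_args[symmetric]) auto
    show "(case p of (S', \<phi>) \<Rightarrow> ntup C (inj_args n 1 (\<lambda>j i. nproj C P 1 Q j \<cdot> nproj C A n A i) (\<lambda>j. nproj C P 1 Q j \<cdot> nproj C A n A n)
        (\<lambda>i. nproj C P 1 Q 1 \<cdot> nproj C A n X i) S' \<phi>) (nproj C P 1 Q 1 \<cdot> nproj C A n X n) \<cdot> S f (n + 1 - card S')) = ?h p"
      unfolding p' case_prod_conv eq by simp
    show "?h p \<in> Hom C ?W (l ?Y)" by (rule hH[OF p])
  qed
  finally have SS: "S (S f n) 1 = hom_sum C ?W (L ?Y) ?h (partial_injections 1 n)" .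
  let ?as = "map ?a [0..<n]"
  have asE: "\<forall>z\<in>set ?as. z \<in> El ?W (Idn C ?W) (l X)" by (auto simp: Q_def)
  have xE: "?x \<in> El ?W (Idn C ?W) X" by (auto simp: Q_def)
  have wE: "?w 0 \<in> El ?W (Idn C ?W) (l X)" by (auto simp: P_def)
  have vE: "?v 0 i \<in> El ?W (Idn C ?W) (l X)" if "i < n" for i using that by (auto simp: P_def)
  have p0: "({}, \<lambda>_. undefined) \<in> partial_injections 0 n" by (simp add: partial_injections_0)
  let ?t1 = "ntup C (?w 0 # ?as) ?x \<cdot> S f (Suc n)" and ?t2 = "\<lambda>i. ntup C (?as[i := ?v 0 i]) ?x \<cdot> S f n"
  have ia: "inj_args n 0 ?v ?w ?a {} \<phi> = ?as" for \<phi> by (simp add: inj_args_def)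
  have h1: "?h ({}, \<lambda>_. undefined) = ?t1"
  proof -
    have "mset (?w 0 # ?as) = mset (inj_args n (Suc 0) ?v ?w ?a {} (\<lambda>_. undefined))"
      using mset_inj_args_Suc[OF p0, of ?w ?v ?a] unfolding ia .
    then have "?t1 = ntup C (inj_args n (Suc 0) ?v ?w ?a {} (\<lambda>_. undefined)) ?x \<cdot> S f (Suc n)"
      using asE wE xE by (intro ntup_S_perm[OF f _ _ xE]) auto
    then show ?thesis by simp
  qed
  have h2: "?h (insert 0 {}, (\<lambda>_. undefined)(0 := i)) = ?t2 i" if "i < n" for i
    using inj_args_update[OF p0 that, of ?v ?w ?a] unfolding ia by simp
  have t1H: "?t1 \<in> Hom C ?W (l ?Y)"
    using ntup_S_simps[of f "?w 0 # ?as" ?W "Idn C ?W" ?x "Suc n"] asE wE xE f by simp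
  have t2H: "?t2 i \<in> Hom C ?W (l ?Y)" if "i < n" for i
  proof -
    have "\<forall>z\<in>set (?as[i := ?v 0 i]). z \<in> El ?W (Idn C ?W) (l (Dom C f))"
      unfolding f(2) by (intro ball_list_update asE vE that)
    moreover have "?x \<in> El ?W (Idn C ?W) (Dom C f)" unfolding f(2) by (rule xE)
    ultimately show ?thesis
      using ntup_S_simps[of f "?as[i := ?v 0 i]" ?W "Idn C ?W" ?x n] f n by simp
  qed
  have sH: "hom_sum C ?W (L ?Y) ?t2 {..<n} \<in> Hom C ?W (l ?Y)"
    using t2H tY by (intro hom_sum_Hom) auto
  have S1: "S (S f n) 1 = addm C (L ?Y) ?t1 (hom_sum C ?W (L ?Y) ?t2 {..<n})"
  proof -
    have W: "?W \<in> Ob C" by simp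
    have s2: "hom_sum C ?W (L ?Y) (\<lambda>i. ?h (insert 0 {}, (\<lambda>_. undefined)(0 := i))) {..<n} =
      hom_sum C ?W (L ?Y) ?t2 {..<n}"
    proof (rule hom_sum_cong[OF tY W refl])
      fix i assume "i \<in> {..<n}"
      then have i: "i < n" by simp
      show "?t2 i \<in> Hom C ?W (l ?Y)" by (rule t2H[OF i])
      show "?h (insert 0 {}, (\<lambda>_. undefined)(0 := i)) = ?t2 i" by (rule h2[OF i])
    qed
    \<comment> \<open>For \<open>r = 0\<close> the empty injection is the only one. One growth step
      thus yields the empty injection, where \<open>w\<close> is appended, and the injections of 0
      to some \<open>i\<close>, where \<open>a i\<close> is replaced.\<close>
    have "S (S f n) 1 = hom_sum C ?W (L ?Y) (\<lambda>p. addm C (L ?Y) (?h p)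
        (hom_sum C ?W (L ?Y) (\<lambda>i. ?h (insert 0 (fst p), (snd p)(0 := i))) ({..<n} - snd p ` fst p)))
        (partial_injections 0 n)"
      unfolding SS using hom_sum_partial_injections_Suc[OF tY W, of 0 n ?h] hH by (simp only: One_nat_def)
    also have "\<dots> = addm C (L ?Y) (?h ({}, \<lambda>_. undefined))
        (hom_sum C ?W (L ?Y) (\<lambda>i. ?h (insert 0 {}, (\<lambda>_. undefined)(0 := i))) {..<n})"
      unfolding partial_injections_0
      using addm_Hom[OF tY t1H sH] unfolding h1[symmetric] s2[symmetric]
      by (subst hom_sum_singleton[OF tY W]) simp_all
    finally show ?thesis unfolding h1 s2 .
  qed
  \<comment> \<open>The identity holds for the universal arguments; composing with \<open>?t\<close>
    evaluates it at the given ones.\<close>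
  let ?t = "\<langle>ntup C vs w, ntup C as x\<rangle>"
  have vsE: "ntup C vs w \<in> El Z e P" unfolding P_def using el by (intro ntup_El) auto
  have asxE: "ntup C as x \<in> El Z e Q" unfolding Q_def using el by (intro ntup_El) auto
  have t: "?t \<in> El Z e ?W" using vsE asxE by simp
  have tv: "?t \<cdot> ?v 0 i = vs ! i" if "i < n" for i
    using ntup_nproj[of vs Z e A w A n i] el that vsE asxE by (simp add: P_def[symmetric]; simp add: P_def)
  have tw: "?t \<cdot> ?w 0 = w"
    using ntup_nproj[of vs Z e A w A n n] el vsE asxE by (simp add: P_def[symmetric]; simp add: P_def)
  have ta: "?t \<cdot> ?a i = as ! i" if "i < n" for i
    using ntup_nproj[of as Z e A x X n i] el that vsE asxE by (simp add: Q_def[symmetric]; simp add: Q_def)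
  have tx: "?t \<cdot> ?x = x"
    using ntup_nproj[of as Z e A x X n n] el vsE asxE by (simp add: Q_def[symmetric]; simp add: Q_def)
  have mas: "map (\<lambda>z. ?t \<cdot> z) ?as = as" using ta el by (intro nth_equalityI) auto
  have cn: "?t \<cdot> (ntup C zs ?x \<cdot> S f m) = ntup C (map (\<lambda>z. ?t \<cdot> z) zs) x \<cdot> S f m"
    if "\<forall>z\<in>set zs. z \<in> El ?W (Idn C ?W) (l X)" "length zs = m" for zs m
  proof -
    have "ntup C zs ?x \<in> El ?W (Idn C ?W) (npow C (l X) m X)" using that xE by (intro ntup_El) auto
    then have "?t \<cdot> (ntup C zs ?x \<cdot> S f m) = (?t \<cdot> ntup C zs ?x) \<cdot> S f m"
      using t f by (intro assoc[symmetric]) auto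
    also have "?t \<cdot> ntup C zs ?x = ntup C (map (\<lambda>z. ?t \<cdot> z) zs) (?t \<cdot> ?x)"
      using that t xE by (intro cmp_ntup[where Z="?W" and A="l X" and X=X]) auto
    finally show ?thesis unfolding tx .
  qed
  have "?t \<cdot> S (S f n) 1 = ?t \<cdot> addm C (L ?Y) ?t1 (hom_sum C ?W (L ?Y) ?t2 {..<n})"
    by (simp only: S1)
  also have "\<dots> = addm C (L ?Y) (?t \<cdot> ?t1) (?t \<cdot> hom_sum C ?W (L ?Y) ?t2 {..<n})"
    by (rule cmp_addm[OF tY]) (use t t1H sH in auto)
  also have "?t \<cdot> ?t1 = ntup C (w # as) x \<cdot> S f (Suc n)"
    using cn[of "?w 0 # ?as" "Suc n"] asE wE unfolding list.map tw mas by simp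
  also have "?t \<cdot> hom_sum C ?W (L ?Y) ?t2 {..<n} = hom_sum C (Dom C ?t) (L ?Y) (\<lambda>i. ?t \<cdot> ?t2 i) {..<n}"
  proof (rule cmp_hom_sum[OF tY])
    show "?t \<in> Ar C" "Cod C ?t = ?W" using t unfolding El_iff by blast+
    show "{..<n} \<noteq> {}" using n by auto
    show "?t2 i \<in> Hom C ?W (l ?Y)" if "i \<in> {..<n}" for i using t2H that by simp
  qed simp
  also have "Dom C ?t = Z" using t by simp
  also have "hom_sum C Z (L ?Y) (\<lambda>i. ?t \<cdot> ?t2 i) {..<n} =
    hom_sum C Z (L ?Y) (\<lambda>i. ntup C (as[i := vs ! i]) x \<cdot> S f n) {..<n}"
  proof (rule hom_sum_cong[OF tY X(2) refl])
    fix i assume "i \<in> {..<n}"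
    then have i: "i < n" by simp
    have "\<forall>z\<in>set (?as[i := ?v 0 i]). z \<in> El ?W (Idn C ?W) (l X)"
      by (intro ball_list_update asE vE i)
    then have eq: "?t \<cdot> ?t2 i = ntup C (as[i := vs ! i]) x \<cdot> S f n"
      using cn[of "?as[i := ?v 0 i]" n] unfolding map_update mas tv[OF i] by simp
    then show "?t \<cdot> ?t2 i = ntup C (as[i := vs ! i]) x \<cdot> S f n" .
    show "ntup C (as[i := vs ! i]) x \<cdot> S f n \<in> Hom C Z (l ?Y)"
      using Cmp_Hom[OF El_Hom[OF t] t2H[OF i]] unfolding eq .
  qed
  finally show ?thesis .
qed

end

section \<open>The differential axioms for a coalgebra\<close>

context coalg
begin

definition Lo where "Lo = (\<lambda>X\<in>Ob C. L X)"
definition Dm where "Dm = (\<lambda>f\<in>Ar C. S f 1)"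

lemma Lo_eq [simp]: "X \<in> Ob C \<Longrightarrow> Lo X = L X" by (simp add: Lo_def)
lemma Dm_eq [simp]: "f \<in> Ar C \<Longrightarrow> Dm f = S f (Suc 0)" by (simp add: Dm_def)

lemma snd_Do [simp]: "X \<in> Ob C \<Longrightarrow> snd (Do X) = X"
  using Do_eq[of X] by (metis snd_conv)

text \<open>For \<open>w\<close> zero the first summand vanishes, which is [DR.6]. With the same
  zero \<open>v\<close> on both sides, symmetry of the second component in \<open>w\<close> and
  \<open>a\<close> gives [DR.7].\<close>

lemma S_S_1_1:
  assumes f: "f \<in> Ar C" "Dom C f = X"
    and el: "v \<in> El Z e (l X)" "w \<in> El Z e (l X)" "a \<in> El Z e (l X)" "x \<in> El Z e X"
  shows "\<langle>\<langle>v, w\<rangle>, \<langle>a, x\<rangle>\<rangle> \<cdot> S (S f (Suc 0)) (Suc 0) =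
    addm C (L (Cod C f)) (ntup C [w, a] x \<cdot> S f (Suc (Suc 0))) (\<langle>v, x\<rangle> \<cdot> S f (Suc 0))"
proof -
  have vx: "\<langle>v, x\<rangle> \<cdot> S f (Suc 0) \<in> Hom C Z (l (Cod C f))" using f el by simp
  have "\<langle>\<langle>v, w\<rangle>, \<langle>a, x\<rangle>\<rangle> \<cdot> S (S f (Suc 0)) (Suc 0) = \<langle>ntup C [v] w, ntup C [a] x\<rangle> \<cdot> S (S f (Suc 0)) 1"
    by simp
  also have "\<dots> = addm C (L (Cod C f)) (ntup C (w # [a]) x \<cdot> S f (Suc (Suc 0)))
      (hom_sum C Z (L (Cod C f)) (\<lambda>i. ntup C ([a][i := [v] ! i]) x \<cdot> S f (Suc 0)) {..<Suc 0})"
    using el by (intro S_S_1[OF f]) auto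
  also have "hom_sum C Z (L (Cod C f)) (\<lambda>i. ntup C ([a][i := [v] ! i]) x \<cdot> S f (Suc 0)) {..<Suc 0} =
    \<langle>v, x\<rangle> \<cdot> S f (Suc 0)"
  proof -
    have "{..<Suc 0} = {0}" by auto
    moreover have "tcm (L (Cod C f))" "Z \<in> Ob C" using f el by auto
    ultimately show ?thesis using hom_sum_singleton[of "L (Cod C f)" Z _ 0] vx by simp
  qed
  finally show ?thesis .
qed

lemma S_1_zero_dir:
  assumes f: "f \<in> Ar C" "Dom C f = X" and x: "x \<in> El Z e X"
  shows "\<langle>ze e (L X), x\<rangle> \<cdot> S f (Suc 0) = ze (Rst C (x \<cdot> f)) (L (Cod C f))"
proof -
  have X: "X \<in> Ob C" using f by auto
  have "\<forall>z\<in>set [ze e (L X)]. z \<in> El Z e (l X)" using x X by auto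
  from ntup_S_zero[OF f, of 0 "Suc 0", OF _ this x] show ?thesis by simp
qed

text \<open>Reduces [DR.6] and [DR.7] to arguments with a common domain \<open>e\<close>.\<close>

lemma quad_restrict:
  assumes "a \<in> Hom C Z A" "b \<in> Hom C Z B" "c \<in> Hom C Z A'" "d \<in> Hom C Z B'"
  defines "e \<equiv> Rst C a \<cdot> (Rst C b \<cdot> (Rst C c \<cdot> Rst C d))"
  shows "\<langle>\<langle>a, b\<rangle>, \<langle>c, d\<rangle>\<rangle> = \<langle>\<langle>e \<cdot> a, e \<cdot> b\<rangle>, \<langle>e \<cdot> c, e \<cdot> d\<rangle>\<rangle>"
    "e \<cdot> a \<in> El Z e A" "e \<cdot> b \<in> El Z e B" "e \<cdot> c \<in> El Z e A'" "e \<cdot> d \<in> El Z e B'" "e \<in> El Z e Z"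
proof -
  let ?t = "\<langle>\<langle>a, b\<rangle>, \<langle>c, d\<rangle>\<rangle>"
  have e: "e = Rst C ?t" using assms(1-4) by (simp add: e_def)
  have tA: "?t \<in> Ar C" "Dom C ?t = Z" using assms(1-4) by auto
  show eE: "e \<in> El Z e Z" unfolding e El_iff
    using Rst_simps[OF tA(1)] Rst_idem[OF tA(1)] Rst_Rst_absorb[OF tA(1)] tA(2) by simp
  then have eA: "e \<in> Ar C" "Dom C e = Z" "Cod C e = Z" "Rst C e = e" by auto
  have "e \<cdot> ?t = ?t" by (rule Rst_absorb_eq[OF tA(1) e[symmetric]])
  then show "?t = \<langle>\<langle>e \<cdot> a, e \<cdot> b\<rangle>, \<langle>e \<cdot> c, e \<cdot> d\<rangle>\<rangle>" using eA assms(1-4) by simp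
  have absorb: "Rst C (e \<cdot> h) = e" if "h \<in> Hom C Z W" "h = a \<or> h = b \<or> h = c \<or> h = d" for h W
  proof -
    have ab: "\<langle>a, b\<rangle> \<in> Hom C Z (A \<boxtimes> B)" "\<langle>c, d\<rangle> \<in> Hom C Z (A' \<boxtimes> B')" using assms(1-4) by auto
    have s: "Rst C p \<cdot> (Rst C p \<cdot> q) = Rst C p \<cdot> q" if "p \<in> Hom C Z P" "q \<in> Hom C Z Q" for p q P Q
      using that by simp
    have lc: "Rst C p \<cdot> (Rst C q \<cdot> r) = Rst C q \<cdot> (Rst C p \<cdot> r)"
      if "p \<in> Hom C Z P" "q \<in> Hom C Z Q" "r \<in> Hom C Z R" for p q r P Q R
      using that by (intro Rst_left_commute) auto
    have "Rst C h \<cdot> e = e"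
      using that assms(1-4)
        lc[OF assms(2,1)] lc[OF assms(3,1)] lc[OF assms(3,2)] lc[OF assms(4,1)] lc[OF assms(4,2)] lc[OF assms(4,3)]
        Rst_commute[of d c]
      by (elim disjE) (simp_all add: e_def)
    moreover have "Rst C h \<cdot> Rst C ?t = Rst C ?t \<cdot> Rst C h" using that tA by (intro Rst_commute) auto
    ultimately have "e \<cdot> Rst C h = e" by (simp only: e)
    then show ?thesis using Rst_Rst_cmp[of e h] that eA by simp
  qed
  show "e \<cdot> a \<in> El Z e A" "e \<cdot> b \<in> El Z e B" "e \<cdot> c \<in> El Z e A'" "e \<cdot> d \<in> El Z e B'"
    using assms(1-4) eE eA absorb[OF assms(1)] absorb[OF assms(2)] absorb[OF assms(3)] absorb[OF assms(4)] by simp_all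
qed

lemma S_S_swap:
  assumes f: "f \<in> Ar C" "Dom C f = X"
    and el: "b \<in> Hom C Z (l X)" "c \<in> Hom C Z (l X)" "d \<in> Hom C Z X"
  shows "\<langle>\<langle>zerom C (L X) Z, b\<rangle>, \<langle>c, d\<rangle>\<rangle> \<cdot> S (S f (Suc 0)) (Suc 0) =
    \<langle>\<langle>zerom C (L X) Z, c\<rangle>, \<langle>b, d\<rangle>\<rangle> \<cdot> S (S f (Suc 0)) (Suc 0)"
proof -
  have X [simp]: "X \<in> Ob C" "Z \<in> Ob C" using f el by auto
  have z: "zerom C (L X) Z \<in> Hom C Z (l X)" by simp
  let ?z = "zerom C (L X) Z"
  define e where "e = Rst C ?z \<cdot> (Rst C b \<cdot> (Rst C c \<cdot> Rst C d))"
  \<comment> \<open>The common domain is the same for both orders of \<open>b\<close> and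
    \<open>c\<close>, so the two quadruples can be compared over one \<open>e\<close>.\<close>
  have e': "e = Rst C ?z \<cdot> (Rst C c \<cdot> (Rst C b \<cdot> Rst C d))"
    unfolding e_def using el Rst_left_commute[of b c "Rst C d"] by simp
  note q = quad_restrict[OF z el, folded e_def] and q' = quad_restrict[OF z el(2,1,3), folded e']
  have ez: "e \<cdot> ?z = ze e (L X)" using q(6) by (simp add: ze_def)
  have xE: "e \<cdot> d \<in> El Z e X" and bE: "e \<cdot> b \<in> El Z e (l X)" and cE: "e \<cdot> c \<in> El Z e (l X)" by (rule q)+
  have "ntup C [e \<cdot> b, e \<cdot> c] (e \<cdot> d) \<cdot> S f (Suc (Suc 0)) = ntup C [e \<cdot> c, e \<cdot> b] (e \<cdot> d) \<cdot> S f (Suc (Suc 0))"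
    using bE cE by (intro ntup_S_perm[OF f _ _ xE]) auto
  then show ?thesis
    unfolding q(1) q'(1) using S_S_1_1[OF f q(2) bE cE xE] S_S_1_1[OF f q(2) cE bE xE] by simp
qed

lemma S_S_const:
  assumes f: "f \<in> Ar C" "Dom C f = X"
    and el: "a \<in> Hom C Z (l X)" "c \<in> Hom C Z (l X)" "d \<in> Hom C Z X"
  shows "\<langle>\<langle>a, zerom C (L X) Z\<rangle>, \<langle>c, d\<rangle>\<rangle> \<cdot> S (S f (Suc 0)) (Suc 0) = Rst C c \<cdot> \<langle>a, d\<rangle> \<cdot> S f (Suc 0)"
proof -
  have X [simp]: "X \<in> Ob C" "Z \<in> Ob C" using f el by auto
  let ?z = "zerom C (L X) Z"
  have z: "?z \<in> Hom C Z (l X)" by simp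
  define e where "e = Rst C a \<cdot> (Rst C ?z \<cdot> (Rst C c \<cdot> Rst C d))"
  note q = quad_restrict[OF el(1) z el(2,3), folded e_def]
  have ez: "e \<cdot> ?z = ze e (L X)" using q(6) by (simp add: ze_def)
  have zE: "ze e (L X) \<in> El Z e (l X)" using q(3) ez by simp
  have aE: "e \<cdot> a \<in> El Z e (l X)" and cE: "e \<cdot> c \<in> El Z e (l X)" and xE: "e \<cdot> d \<in> El Z e X" by (rule q)+
  have "ntup C ([ze e (L X), e \<cdot> c][0 := ze e (L X)]) (e \<cdot> d) \<cdot> S f (Suc (Suc 0)) =
      ze (Rst C ((e \<cdot> d) \<cdot> f)) (L (Cod C f))"
    using zE cE by (intro ntup_S_zero[OF f _ _ xE]) auto
  then have zero: "ntup C [ze e (L X), e \<cdot> c] (e \<cdot> d) \<cdot> S f (Suc (Suc 0)) = ze (Rst C ((e \<cdot> d) \<cdot> f)) (L (Cod C f))"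
    by simp
  have t: "\<langle>e \<cdot> a, e \<cdot> d\<rangle> \<cdot> S f (Suc 0) \<in> Hom C Z (l (Cod C f))"
    "Rst C (\<langle>e \<cdot> a, e \<cdot> d\<rangle> \<cdot> S f (Suc 0)) = Rst C ((e \<cdot> d) \<cdot> f)"
  proof -
    have "\<forall>z\<in>set [e \<cdot> a]. z \<in> El Z e (l (Dom C f))" "e \<cdot> d \<in> El Z e (Dom C f)"
      using aE xE f by simp_all
    from ntup_S_simps[OF f(1) this, of "Suc 0"] show
      "\<langle>e \<cdot> a, e \<cdot> d\<rangle> \<cdot> S f (Suc 0) \<in> Hom C Z (l (Cod C f))"
      "Rst C (\<langle>e \<cdot> a, e \<cdot> d\<rangle> \<cdot> S f (Suc 0)) = Rst C ((e \<cdot> d) \<cdot> f)" by simp_all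
  qed
  have "\<langle>\<langle>a, ?z\<rangle>, \<langle>c, d\<rangle>\<rangle> \<cdot> S (S f (Suc 0)) (Suc 0) = \<langle>e \<cdot> a, e \<cdot> d\<rangle> \<cdot> S f (Suc 0)"
    unfolding q(1) ez S_S_1_1[OF f aE zE cE xE] zero using t f by (intro addm_ze) auto
  \<comment> \<open>The argument \<open>c\<close> has dropped out of the value but its domain is
    still part of \<open>e\<close>. This is where the factor \<open>Rst C c\<close> of [DR.6] comes
    from.\<close>
  also have "\<langle>e \<cdot> a, e \<cdot> d\<rangle> = Rst C c \<cdot> \<langle>a, d\<rangle>"
  proof -
    have ad: "\<langle>a, d\<rangle> \<in> Hom C Z (l X \<boxtimes> X)" "Rst C \<langle>a, d\<rangle> = Rst C a \<cdot> Rst C d" using el by auto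
    have "e = Rst C c \<cdot> Rst C \<langle>a, d\<rangle>"
      unfolding e_def ad(2) using el Rst_left_commute[of a c "Rst C d"] by simp
    then have "e \<cdot> \<langle>a, d\<rangle> = Rst C c \<cdot> (Rst C \<langle>a, d\<rangle> \<cdot> \<langle>a, d\<rangle>)"
      using ad(1) el by (simp only:) (intro assoc; simp)
    also have "Rst C \<langle>a, d\<rangle> \<cdot> \<langle>a, d\<rangle> = \<langle>a, d\<rangle>" using ad(1) by (intro Rst_absorb) simp
    finally have "e \<cdot> \<langle>a, d\<rangle> = Rst C c \<cdot> \<langle>a, d\<rangle>" .
    moreover have "e \<cdot> \<langle>a, d\<rangle> = \<langle>e \<cdot> a, e \<cdot> d\<rangle>" using q(6) el by (intro cmp_Tup) auto
    ultimately show ?thesis by simp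
  qed
  finally show ?thesis .
qed

text \<open>A one-element set has a single partition, so the composition formula of Faa reduces to
  one term, the chain rule.\<close>

lemma S_1_Cmp:
  assumes f: "f \<in> Ar C" "Dom C f = X" and g: "g \<in> Ar C" "Cod C f = Dom C g"
  shows "S (f \<cdot> g) (Suc 0) = \<langle>S f (Suc 0), Pr1 C (l X) X \<cdot> f\<rangle> \<cdot> S g (Suc 0)"
proof -
  have X [simp]: "X \<in> Ob C" using f by auto
  have "{P. partition_on {..<Suc 0} P} = {{{0}}}"
    using partitions_insert[of 0 "{}"] by (auto simp: lessThan_Suc partition_on_empty refine_with_def)
  moreover have sk: "sorted_key_list_of_set Min {{0::nat}} = [{0}]"
  proof -
    let ?s = "sorted_key_list_of_set Min {{0::nat}}"
    have "set ?s = {{0}}" "distinct ?s"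
      by (intro set_sorted_key_list_of_set_inj distinct_sorted_key_list_of_set_inj; simp)+
    then show ?thesis by (cases ?s; cases "tl ?s") auto
  qed
  moreover have "Da (f \<cdot> g) = faa_comp C (Da f) (Da g)"
    using Fa_Cmp[of f X "Dom C g" g "Cod C g"] f g by simp
  moreover have "\<langle>S f (Suc 0), Pr1 C (l X) X \<cdot> f\<rangle> \<cdot> S g (Suc 0) \<in> Hom C (l X \<boxtimes> X) (l (Cod C g))"
    using f g by simp
  ultimately show ?thesis
    using f g Da_src_tgt[of f] Da_src_tgt[of g] by (simp add: faa_comp_def Let_def)
qed

text \<open>Besides the two laws for second derivatives, [DR.1] and the invariance of
  \<open>L\<close> on its carriers come from coassociativity on objects. [DR.2] and [DR.9] hold
  because first components of Faa maps are additive with a prescribed restriction.\<close>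

lemma gen_diff: "gen_diff_restriction_structure C Lo Dm"
proof (intro gen_diff_restriction_structure.intro gen_diff_restriction_structure_axioms.intro)
  show "cartesian_restriction_category C" by unfold_locales
  show "Lo \<in> Ob C \<rightarrow>\<^sub>E {M. tcm M}" by (auto simp: Lo_def)
  show "Dm \<in> extensional (Ar C)" by (simp add: Dm_def)
  show "Lo (One C) = one_imonoid C" by (simp add: L_One)
next
  fix X assume X: "X \<in> Ob C"
  then show "Lo (Crr (Lo X)) = Lo X" by simp
  show "Dm (Add (Lo X)) = Pr0 C (Crr (Lo X) \<boxtimes> Crr (Lo X)) (Crr (Lo X) \<boxtimes> Crr (Lo X)) \<cdot> Add (Lo X)"
    "Dm (Zro (Lo X)) = Pr0 C (One C) (One C) \<cdot> Zro (Lo X)"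
    using coassoc_ob_components[OF X] X by simp_all
next
  fix X Y assume XY: "X \<in> Ob C" "Y \<in> Ob C"
  then show "Lo (X \<boxtimes> Y) = prod_imonoid C (Lo X) (Lo Y)" by (simp add: L_Prd)
  show "Dm (Pr0 C X Y) = Pr0 C (Crr (Lo X) \<boxtimes> Crr (Lo Y)) (X \<boxtimes> Y) \<cdot> Pr0 C (Crr (Lo X)) (Crr (Lo Y))"
    "Dm (Pr1 C X Y) = Pr0 C (Crr (Lo X) \<boxtimes> Crr (Lo Y)) (X \<boxtimes> Y) \<cdot> Pr1 C (Crr (Lo X)) (Crr (Lo Y))"
    using XY Fa_Pr0[OF XY] Fa_Pr1[OF XY]
    by (simp_all add: faa_pr0_def faa_pr1_def faa_linear_def Let_def)
next
  fix f X Y assume f: "f \<in> Hom C X Y"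
  then have X: "X \<in> Ob C" "Y \<in> Ob C" by auto
  show "Dm f \<in> Hom C (Crr (Lo X) \<boxtimes> X) (Crr (Lo Y))" using f X by auto
  have Da: "Da (Rst C f) = faa_restr C (Da f)" using Fa_Rst[of f] f by simp
  have "Dm (Rst C f) = Rst C (Pr1 C (Crr (Lo X)) X \<cdot> f) \<cdot> Pr0 C (Crr (Lo X)) X"
    using f X Da Da_src_tgt[of f] by (simp add: faa_restr_def Let_def)
  then show "Dm (Rst C f) = cross C (Idn C (Crr (Lo X))) (Rst C f) \<cdot> Pr0 C (Crr (Lo X)) X \<and>
        Dm (Rst C f) = Rst C (Pr1 C (Crr (Lo X)) X \<cdot> f) \<cdot> Pr0 C (Crr (Lo X)) X"
    using cross_Idn_Rst[of "l X" f X] f X by simp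
  have "Rst C (Dm f) = Rst C (Pr1 C (Crr (Lo X)) X \<cdot> f)" using f X by auto
  then show "Rst C (Dm f) = cross C (Idn C (Crr (Lo X))) (Rst C f) \<and>
        Rst C (Dm f) = Rst C (Pr1 C (Crr (Lo X)) X \<cdot> f)"
    using cross_Idn_Rst[of "l X" f X] f X by simp
next
  fix f X Y a Z b c
  assume f: "f \<in> Hom C X Y" and abc: "a \<in> Hom C Z (Crr (Lo X))" "b \<in> Hom C Z (Crr (Lo X))" "c \<in> Hom C Z X"
  have X: "X \<in> Ob C" "Y \<in> Ob C" "Z \<in> Ob C" using f abc by auto
  have "\<forall>zs\<in>lists (Hom C Z (l X)). \<forall>x\<in>Hom C Z X. \<forall>i<Suc 0. length zs = Suc 0 \<longrightarrow>
      (\<forall>a\<in>Hom C Z (l X). \<forall>b\<in>Hom C Z (l X).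
        ntup C (zs[i := addm C (L X) a b]) x \<cdot> S f (Suc 0) =
          addm C (L Y) (ntup C (zs[i := a]) x \<cdot> S f (Suc 0)) (ntup C (zs[i := b]) x \<cdot> S f (Suc 0)))"
    using S_props(4)[of f X Y "Suc 0"] f X by (simp add: additive_in_def)
  from this[rule_format, of "[a]" c 0 a b]
  show "\<langle>addm C (Lo X) a b, c\<rangle> \<cdot> Dm f = addm C (Lo Y) (\<langle>a, c\<rangle> \<cdot> Dm f) (\<langle>b, c\<rangle> \<cdot> Dm f)"
    using f abc X by simp
next
  fix f X Y a Z assume f: "f \<in> Hom C X Y" and a: "a \<in> Hom C Z X"
  have X: "X \<in> Ob C" "Y \<in> Ob C" "Z \<in> Ob C" using f a by auto
  have aE: "a \<in> El Z (Rst C a) X" using a by auto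
  have "\<langle>zerom C (L X) Z, a\<rangle> = \<langle>ze (Rst C a) (L X), a\<rangle>"
    using Tup_restrict(1)[of "zerom C (L X) Z" a] a X by (simp add: ze_def)
  then show "\<langle>zerom C (Lo X) Z, a\<rangle> \<cdot> Dm f = Rst C (a \<cdot> f) \<cdot> zerom C (Lo Y) Z"
    using S_1_zero_dir[of f X a Z "Rst C a", OF _ _ aE] f a X by (simp add: ze_def)
next
  fix f X Y g Z assume f: "f \<in> Hom C X Y" and g: "g \<in> Hom C X Z"
  have "Da \<langle>f, g\<rangle> = faa_tup C (Da f) (Da g)" using Fa_Tup[OF f g] by simp
  then show "Dm \<langle>f, g\<rangle> = \<langle>Dm f, Dm g\<rangle>" using f g by (simp add: faa_tup_def)
next
  fix f X Y g Z assume f: "f \<in> Hom C X Y" and g: "g \<in> Hom C Y Z"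
  then show "Dm (f \<cdot> g) = \<langle>Dm f, Pr1 C (Crr (Lo X)) X \<cdot> f\<rangle> \<cdot> Dm g"
    using S_1_Cmp[of f X g] by auto
next
  fix f X Y a Z c d
  assume f: "f \<in> Hom C X Y" and el: "a \<in> Hom C Z (Crr (Lo X))" "c \<in> Hom C Z (Crr (Lo X))" "d \<in> Hom C Z X"
  then show "\<langle>\<langle>a, zerom C (Lo X) Z\<rangle>, \<langle>c, d\<rangle>\<rangle> \<cdot> Dm (Dm f) = Rst C c \<cdot> \<langle>a, d\<rangle> \<cdot> Dm f"
    using S_S_const[of f X a Z c d] by auto
next
  fix f X Y b Z c d
  assume f: "f \<in> Hom C X Y" and el: "b \<in> Hom C Z (Crr (Lo X))" "c \<in> Hom C Z (Crr (Lo X))" "d \<in> Hom C Z X"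
  then show "\<langle>\<langle>zerom C (Lo X) Z, b\<rangle>, \<langle>c, d\<rangle>\<rangle> \<cdot> Dm (Dm f) = \<langle>\<langle>zerom C (Lo X) Z, c\<rangle>, \<langle>b, d\<rangle>\<rangle> \<cdot> Dm (Dm f)"
    using S_S_swap[of f X b Z c d] by auto
qed

section \<open>Recovering the coalgebra from its first components\<close>

sublocale G: gen_diff_restriction_structure C Lo Dm
  by (rule gen_diff)

lemma S_eq_F:
  assumes f: "f \<in> Ar C"
  shows "S f n = G.F f n"
proof (induction n)
  case (Suc n)
  define X where "X = Dom C f"
  have X [simp]: "X \<in> Ob C" using f by (simp add: X_def)
  let ?P = "npow C (l X) n X" let ?W = "l X \<boxtimes> ?P" let ?p = "nproj C (l X) n X"
  let ?z = "zerom C (L X) ?W" let ?Y = "Cod C f"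
  have F: "G.F f (Suc n) = \<langle>ntup C (replicate n ?z) (Pr0 C (l X) ?P), Pr1 C (l X) ?P\<rangle> \<cdot> S (S f n) 1"
    using Suc f by (simp add: G.F.simps(2) Let_def X_def[symmetric])
  \<comment> \<open>\<open>S_S_1\<close> is available for positive \<open>n\<close> only, since
    component 0 is the map itself; at \<open>n = 0\<close> both sides are the first
    component.\<close>
  show ?case
  proof (cases "n = 0")
    case True
    then show ?thesis unfolding F using f by (simp add: X_def)
  next
    case False
    let ?e = "Idn C ?W"
    have W: "?W \<in> Ob C" by simp
    let ?as = "map (\<lambda>i. Pr1 C (l X) ?P \<cdot> ?p i) [0..<n]" and ?x = "Pr1 C (l X) ?P \<cdot> ?p n"
    have zE: "?z \<in> El ?W ?e (l X)" and pE: "Pr0 C (l X) ?P \<in> El ?W ?e (l X)" and xE: "?x \<in> El ?W ?e X"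
      and asE: "\<forall>z\<in>set ?as. z \<in> El ?W ?e (l X)" by auto
    \<comment> \<open>Written as a tuple, the argument in the recursion of \<open>G.F\<close> is an
      instance of \<open>S_S_1\<close> with zeros for \<open>vs\<close> and the new variable for
      \<open>w\<close>.\<close>
    have eta: "ntup C ?as ?x = Pr1 C (l X) ?P" by (rule ntup_nproj_eta) auto
    have zs: "\<forall>z\<in>set (replicate n ?z). z \<in> El ?W ?e (l X)" using zE by auto
    have "G.F f (Suc n) = addm C (L ?Y) (ntup C (Pr0 C (l X) ?P # ?as) ?x \<cdot> S f (Suc n))
       (hom_sum C ?W (L ?Y) (\<lambda>i. ntup C (?as[i := replicate n ?z ! i]) ?x \<cdot> S f n) {..<n})"
    proof -
      have "\<langle>ntup C (replicate n ?z) (Pr0 C (l X) ?P), ntup C ?as ?x\<rangle> \<cdot> S (S f n) 1 =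
        addm C (L ?Y) (ntup C (Pr0 C (l X) ?P # ?as) ?x \<cdot> S f (Suc n))
       (hom_sum C ?W (L ?Y) (\<lambda>i. ntup C (?as[i := replicate n ?z ! i]) ?x \<cdot> S f n) {..<n})"
        using False by (intro S_S_1[OF f X_def[symmetric] _ zs pE asE xE]) auto
      then show ?thesis unfolding eta F .
    qed
    also have "ntup C (Pr0 C (l X) ?P # ?as) ?x = Idn C (npow C (l X) (Suc n) X)"
      using eta by simp
    also have "Idn C (npow C (l X) (Suc n) X) \<cdot> S f (Suc n) = S f (Suc n)"
      using f by (intro Idn_left) (simp_all add: X_def)
    \<comment> \<open>Every summand has a zero in one of its additive arguments, so it vanishes and
      only \<open>S f (Suc n)\<close> is left.\<close>
    also have "addm C (L ?Y) (S f (Suc n)) (hom_sum C ?W (L ?Y) (\<lambda>i. ntup C (?as[i := replicate n ?z ! i]) ?x \<cdot> S f n) {..<n}) =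
      addm C (L ?Y) (S f (Suc n)) (hom_sum C ?W (L ?Y) (\<lambda>i. ntup C (?as[i := replicate n ?z ! i]) ?x \<cdot> S f n) {})"
    proof (rule addm_hom_sum_zeros[OF _ W])
      show "tcm (L ?Y)" using f by simp
      let ?E = "Rst C (?x \<cdot> f)"
      show "S f (Suc n) \<in> El ?W ?E (l ?Y)"
        using f xE by (simp add: X_def)
      have ze: "ze ?e (L X) = ?z" using W by (intro ze_Idn) auto
      have *: "ntup C (?as[i := replicate n ?z ! i]) ?x \<cdot> S f n = ze ?E (L ?Y)" if "i < n" for i
        using ntup_S_zero[OF f X_def[symmetric], of i n, OF _ asE xE] that unfolding ze by simp
      show "ntup C (?as[i := replicate n ?z ! i]) ?x \<cdot> S f n = ze ?E (L ?Y)" if "i \<in> {..<n} - {}" for i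
        using * that by blast
      show "ntup C (?as[i := replicate n ?z ! i]) ?x \<cdot> S f n \<in> Hom C ?W (l ?Y)" if "i \<in> {..<n}" for i
      proof -
        have "i < n" using that by simp
        from *[OF this] show ?thesis using f xE by (simp add: X_def)
      qed
    qed auto
    also have "\<dots> = S f (Suc n)"
      using f W by (simp add: X_def)
    finally show ?thesis by simp
  qed
qed (use f in simp)

lemma Do_eq_coalg: "Do = restrict G.coalg_ob (Ob C)"
proof
  fix X show "Do X = restrict G.coalg_ob (Ob C) X"
    using Fo_Ob Do_eq[of X] by (cases "X \<in> Ob C") (auto simp: G.coalg_ob_def PiE_iff extensional_def)
qed

lemma Da_eq_coalg: "Da = restrict G.coalg_ar (Ar C)"
proof
  fix f show "Da f = restrict G.coalg_ar (Ar C) f"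
  proof (cases "f \<in> Ar C")
    case True
    then show ?thesis
      using Da_src_tgt[of f] S_eq_F[of f]
      by (intro farr.equality) (auto simp: G.coalg_ar_def G.coalg_ob_def)
  next
    case False
    then show ?thesis using Fa_Ar by (auto simp: PiE_iff extensional_def)
  qed
qed

end

theorem theorem3p13:
  fixes X :: "('o, 'm) crcat"
  assumes "cartesian_restriction_category X"
  shows "bij_betw
           (\<lambda>(Do, Da). ((\<lambda>A\<in>Ob X. fst (Do A)), (\<lambda>f\<in>Ar X. Fseq (Da f) 1)))
           {(Do, Da). faa_coalgebra X Do Da}
           {(L, D). gen_diff_restriction_structure X L D}"
    (is "bij_betw ?\<Phi> ?A ?B")
proof -
  let ?\<Psi> = "\<lambda>(L, D). (restrict (gen_diff_restriction_structure.coalg_ob L) (Ob X),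
    restrict (gen_diff_restriction_structure.coalg_ar X L D) (Ar X))"
  have coalg: "coalg X Do Da" if "faa_coalgebra X Do Da" for Do Da
    using assms that by (simp add: coalg_def crc_def)
  have \<Phi>: "?\<Phi> (Do, Da) = (coalg.Lo X Do, coalg.Dm X Da)" if "faa_coalgebra X Do Da" for Do Da
    by (simp add: coalg.Lo_def[OF coalg[OF that]] coalg.Dm_def[OF coalg[OF that]])
  show ?thesis
  proof (rule bij_betw_byWitness[where f'="?\<Psi>"])
    show "\<forall>a\<in>?A. ?\<Psi> (?\<Phi> a) = a"
      using \<Phi> coalg.Do_eq_coalg[OF coalg] coalg.Da_eq_coalg[OF coalg] by auto
    show "?\<Phi> ` ?A \<subseteq> ?B"
      using \<Phi> coalg.gen_diff[OF coalg] by auto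
    show "?\<Psi> ` ?B \<subseteq> ?A"
      using gen_diff_restriction_structure.coalg_coalgebra by auto
    show "\<forall>b\<in>?B. ?\<Phi> (?\<Psi> b) = b"
    proof
      fix b assume "b \<in> ?B"
      then obtain L D where b: "b = (L, D)" and LD: "gen_diff_restriction_structure X L D" by auto
      interpret gen_diff_restriction_structure X L D by (rule LD)
      \<comment> \<open>Values off objects and maps agree because \<open>L\<close> and
        \<open>D\<close> are extensional; on maps, the first iterated derivative is \<open>D\<close>
        itself.\<close>
      have "(\<lambda>A\<in>Ob X. fst (restrict coalg_ob (Ob X) A)) = L"
        using L_monoid by (auto simp: coalg_ob_def PiE_iff extensional_def restrict_def)
      moreover have "(\<lambda>f\<in>Ar X. Fseq (restrict coalg_ar (Ar X) f) 1) = D"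
        using D_ext by (auto simp: coalg_ar_def extensional_def restrict_def)
      ultimately show "?\<Phi> (?\<Psi> b) = b" by (simp add: b)
    qed
  qed
qed

end
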